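(* Let $(F_n)_{n\ge1}$ be a sequence of $r$CSP formulas with $\|\mathrm{eval}(F_n)\|_\infty\le d$ for all $n$ and $|V(F_n)|\to\infty$, such that for every finite $r$CSP formula $H$ with $\|\mathrm{eval}(H)\|_\infty\le d$ the sequence $t(\tilde H,\mathrm{eval}(F_n))$ converges. Then there exists a measurable function $W:[0,1]^{s([r],r)}\to\{0,1,\dots,d\}^{([q]^r)}$ such that $t(\tilde H,\mathrm{eval}(F_n))\to t(\tilde H,\Gamma_W)$ for every such $H$.
   Context: Fix integers $r,q,d\ge1$ and a set $K=[q]$ of states. A constraint type is a function $f:K^r\to\{0,1\}$. For a variable set $V=\{x_1,\dots,x_n\}$, a constraint is a pair $(f;e)$ with $f$ a constraint type and $e=(i_1,\dots,i_r)\in[n]^r$, representing the function $K^n\to\{0,1\}$, $(l_1,\dots,l_n)\mapsto f(l_{i_1},\dots,l_{i_r})$. An $r$CSP formula $F$ on $V(F)=V$ is a (multi)set of constraints. Its evaluation representation $\mathrm{eval}(F)$ is the array on $[n]^r$ with values in $L=\{0,1,\dots,d\}^{([q]^r)}$ (under the boundedness assumption) given by $\mathrm{eval}(F)_e(z)=\sum_{(f;e)\in F}f(z_1,\dots,z_r)$ for $e\in[n]^r$, $z\in[q]^r$; $\|\mathrm{eval}(F)\|_\infty\le d$ means all these numbers are at most $d$. Thus $\mathrm{eval}(F)$ is an $L$-decorated directed $r$-uniform hypergraph ($r$-array $V^r\to L$). For such an $H$, $\tilde H$ is the array on the same vertex set whose entry at $e$ is the continuous function on $L$ given by $A\mapsto\prod_{z\in[q]^r}A(z)^{H_e(z)}$,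 where $H_e=\mathrm{eval}(H)_e$. For an array $\tilde H$ of continuous functions on $L$ with vertex set $[m]$ and an $L$-valued array $G$ with vertex set $V(G)$: $t(\tilde H,G)=|V(G)|^{-m}\sum_{\phi:[m]\to V(G)}\prod_{(i_1,\dots,i_r)\in[m]^r}\tilde H_{i_1,\dots,i_r}(G_{\phi(i_1),\dots,\phi(i_r)})$, and $t_{\mathrm{inj}}$ is the same average over injective $\phi$. $s([r],r)$ denotes the set of nonempty subsets of $[r]$. For measurable $W:[0,1]^{s([r],r)}\to L$, let $(U_T)$ be i.i.d. uniform $[0,1]$ variables indexed by nonempty subsets $T\subset\mathbb N$ with $|T|\le r$ and $H_W$ the random array on $\mathbb N$ with entries $(H_W)_{i_1,\dots,i_r}=W((U_{\{i_j:j\in A\}})_{A\in s([r],r)})$. Then $t(\tilde H,\Gamma_W)$ is defined as $\mathbb E\,t_{\mathrm{inj}}(\tilde H,H_W|_{[m]})$ when $\tilde H$ has vertex set $[m]$, where $H_W|_{[m]}$ is the restriction of $H_W$ to $[m]$ ($\Gamma_W$ is the limit object associated with $W$). *)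

theory Defs
  imports "HOL-Probability.Probability" "HOL-Library.Multiset" "HOL-Library.FuncSet"
begin

text \<open>
  Index sets are zero-based: \<open>[n]\<close> is \<open>{..<n}\<close>. A tuple in \<open>[n]\<^sup>r\<close> is an extensional function
  \<open>{..<r} \<rightarrow>\<^sub>E {..<n}\<close>, so that \<open>e ` A\<close> is the set of entries of \<open>e\<close> at the positions in \<open>A\<close>.
\<close>

definition tuples :: "nat \<Rightarrow> nat \<Rightarrow> (nat \<Rightarrow> nat) set" where
  "tuples r n = {..<r} \<rightarrow>\<^sub>E {..<n}"

definition constraint_types :: "nat \<Rightarrow> nat \<Rightarrow> ((nat \<Rightarrow> nat) \<Rightarrow> nat) set" where
  "constraint_types r q = tuples r q \<rightarrow>\<^sub>E {0, 1}"

record csp =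
  nvars :: nat
  constraints :: "(((nat \<Rightarrow> nat) \<Rightarrow> nat) \<times> (nat \<Rightarrow> nat)) multiset"

definition csp_formula :: "nat \<Rightarrow> nat \<Rightarrow> csp \<Rightarrow> bool" where
  "csp_formula r q F \<longleftrightarrow>
     (\<forall>(f, e) \<in># constraints F. f \<in> constraint_types r q \<and> e \<in> tuples r (nvars F))"

definition csp_eval :: "nat \<Rightarrow> nat \<Rightarrow> csp \<Rightarrow> (nat \<Rightarrow> nat) \<Rightarrow> (nat \<Rightarrow> nat) \<Rightarrow> nat" where
  "csp_eval r q F = (\<lambda>e\<in>tuples r (nvars F). \<lambda>z\<in>tuples r q.
     (\<Sum>(f, e') \<in># filter_mset (\<lambda>(f, e'). e' = e) (constraints F). f z))"

definition eval_bounded :: "nat \<Rightarrow> nat \<Rightarrow> nat \<Rightarrow> csp \<Rightarrow> bool" where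
  "eval_bounded r q d F \<longleftrightarrow>
     (\<forall>e\<in>tuples r (nvars F). \<forall>z\<in>tuples r q. csp_eval r q F e z \<le> d)"

definition decorations :: "nat \<Rightarrow> nat \<Rightarrow> nat \<Rightarrow> ((nat \<Rightarrow> nat) \<Rightarrow> nat) set" where
  "decorations r q d = tuples r q \<rightarrow>\<^sub>E {0..d}"

lemma csp_eval_in_decorations:
  assumes "eval_bounded r q d F"
  shows "csp_eval r q F \<in> tuples r (nvars F) \<rightarrow>\<^sub>E decorations r q d"
  using assms unfolding eval_bounded_def decorations_def
  by (auto simp: csp_eval_def)

text \<open>
  The set of decorations is finite and carries the discrete topology, so every real function on
  it is continuous. The convention \<open>0 ^ 0 = 1\<close> is in force.
\<close>

definition tilde ::
  "nat \<Rightarrow> nat \<Rightarrow> ((nat \<Rightarrow> nat) \<Rightarrow> (nat \<Rightarrow> nat) \<Rightarrow> nat) \<Rightarrow>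
   (nat \<Rightarrow> nat) \<Rightarrow> ((nat \<Rightarrow> nat) \<Rightarrow> nat) \<Rightarrow> real" where
  "tilde r q H e A = (\<Prod>z\<in>tuples r q. real (A z) ^ H e z)"

text \<open>
  In the densities below, \<open>h\<close> is a function-valued array with vertex set \<open>[m]\<close> and \<open>G\<close> is an array
  with vertex set \<open>[N]\<close>.
\<close>

definition map_weight ::
  "nat \<Rightarrow> nat \<Rightarrow> ((nat \<Rightarrow> nat) \<Rightarrow> 'l \<Rightarrow> real) \<Rightarrow> ((nat \<Rightarrow> nat) \<Rightarrow> 'l) \<Rightarrow> (nat \<Rightarrow> nat) \<Rightarrow> real" where
  "map_weight r m h G \<phi> = (\<Prod>i\<in>tuples r m. h i (G (\<lambda>j\<in>{..<r}. \<phi> (i j))))"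

definition hom_density ::
  "nat \<Rightarrow> nat \<Rightarrow> ((nat \<Rightarrow> nat) \<Rightarrow> 'l \<Rightarrow> real) \<Rightarrow> nat \<Rightarrow> ((nat \<Rightarrow> nat) \<Rightarrow> 'l) \<Rightarrow> real" where
  "hom_density r m h N G = (\<Sum>\<phi>\<in>{..<m} \<rightarrow>\<^sub>E {..<N}. map_weight r m h G \<phi>) / real N ^ m"

definition injections :: "nat \<Rightarrow> nat \<Rightarrow> (nat \<Rightarrow> nat) set" where
  "injections m N = {\<phi> \<in> {..<m} \<rightarrow>\<^sub>E {..<N}. inj_on \<phi> {..<m}}"

definition inj_density ::
  "nat \<Rightarrow> nat \<Rightarrow> ((nat \<Rightarrow> nat) \<Rightarrow> 'l \<Rightarrow> real) \<Rightarrow> nat \<Rightarrow> ((nat \<Rightarrow> nat) \<Rightarrow> 'l) \<Rightarrow> real" where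
  "inj_density r m h N G =
     (\<Sum>\<phi>\<in>injections m N. map_weight r m h G \<phi>) / real (card (injections m N))"

definition csp_density :: "nat \<Rightarrow> nat \<Rightarrow> csp \<Rightarrow> csp \<Rightarrow> real" where
  "csp_density r q H F =
     hom_density r (nvars H) (tilde r q (csp_eval r q H)) (nvars F) (csp_eval r q F)"

definition unit_uniform :: "real measure" where
  "unit_uniform = restrict_space lborel {0..1}"

lemma space_unit_uniform: "space unit_uniform = {0..1}"
  by (simp add: unit_uniform_def space_restrict_space)

lemma prob_space_unit_uniform: "prob_space unit_uniform"
  by (rule prob_spaceI)
     (simp add: unit_uniform_def space_restrict_space emeasure_restrict_space)

definition nonempty_subsets :: "nat \<Rightarrow> nat set set" where
  "nonempty_subsets r = {A. A \<subseteq> {..<r} \<and> A \<noteq> {}}"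

definition W_domain :: "nat \<Rightarrow> (nat set \<Rightarrow> real) measure" where
  "W_domain r = (\<Pi>\<^sub>M A\<in>nonempty_subsets r. unit_uniform)"

text \<open>
  The i.i.d. uniform family \<open>(U\<^sub>T)\<close> is realised as the family of coordinates on the product space.
\<close>

definition U_space :: "nat \<Rightarrow> (nat set \<Rightarrow> real) measure" where
  "U_space r = (\<Pi>\<^sub>M T\<in>{T. finite T \<and> T \<noteq> {} \<and> card T \<le> r}. unit_uniform)"

definition random_array ::
  "nat \<Rightarrow> ((nat set \<Rightarrow> real) \<Rightarrow> 'l) \<Rightarrow> (nat set \<Rightarrow> real) \<Rightarrow> (nat \<Rightarrow> nat) \<Rightarrow> 'l" where
  "random_array r W U = (\<lambda>e\<in>{..<r} \<rightarrow>\<^sub>E UNIV. W (\<lambda>A\<in>nonempty_subsets r. U (e ` A)))"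

definition limit_density ::
  "nat \<Rightarrow> nat \<Rightarrow> ((nat \<Rightarrow> nat) \<Rightarrow> 'l \<Rightarrow> real) \<Rightarrow> ((nat set \<Rightarrow> real) \<Rightarrow> 'l) \<Rightarrow> real" where
  "limit_density r m h W =
     (\<integral>U. inj_density r m h m (restrict (random_array r W U) (tuples r m)) \<partial>U_space r)"

end

theory Submission
  imports Defs "HOL-Library.Diagonal_Subsequence"
begin

text \<open>
  Sampling the vertices of \<open>F\<^sub>n\<close> independently and uniformly turns \<open>eval(F\<^sub>n)\<close> into a
  random array that is exchangeable and dissociated. Along a subsequence the laws of its finite
  windows converge, and Kolmogorov's extension theorem yields a limiting process \<open>X\<close> indexed by
  tuples over a countable vertex set. As all densities converge by assumption, passing to a
  subsequence is harmless, and what remains is an Aldous--Hoover representation of \<open>X\<close>.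

  The vertices are split into actual ones and infinitely many levels of auxiliary ones. For a set
  \<open>S\<close> of actual vertices let \<open>Y\<^sub>S\<close> code the entries of \<open>X\<close> at all tuples that meet the actual vertices
  exactly in \<open>S\<close> and otherwise use auxiliary levels above \<open>|S|\<close>. Given the \<open>Y\<^sub>B\<close> with \<open>B \<subset> S\<close>, the
  variable \<open>Y\<^sub>S\<close> is independent of all \<open>Y\<^sub>A\<close> with \<open>|A| \<le> |S|\<close>, \<open>A \<noteq> S\<close>: an injection that fixes \<open>S\<close> and
  pushes the other actual vertices into level \<open>|S|\<close> preserves the law of \<open>X\<close> and maps the \<open>Y\<^sub>A\<close> to
  functions of the \<open>Y\<^sub>B\<close>, so both conditional expectations have the same \<open>L\<^sup>2\<close> norm. Hence
  \<open>Y\<^sub>S\<close> can be generated recursively from the \<open>Y\<^sub>B\<close> and a fresh uniform seed \<open>U\<^sub>S\<close>. The seed of the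
  empty set can be frozen because \<open>X\<close> is dissociated. The recursion depends on an
  enumeration of \<open>S\<close>; half of the randomness of the seeds of the vertices is spent on ordering them.
\<close>

section \<open>Coding sequences of digits by reals\<close>

text \<open>Auxiliary vertices are needed because the entries on a finite set of vertices do not
  reveal the hidden randomness that correlates them; infinitely many fresh vertices do. A block is
  therefore infinite, and \<open>Y\<^sub>S\<close> has to be packed into one real. Randomisation
  then only has to treat targets in [0,1], while the conditioning variable may live in any
  measurable space.

  A function \<open>W\<close> receives seeds indexed by sets of positions, not by vertices. From
  them it must learn in which order the recursion lists the vertices, and which positions of a tuple
  carry the same vertex. Both are read from the seeds of single vertices: these are almost surely
  distinct, so equal seeds mean equal vertices. Ordering by seeds permutes the vertices at random,
  but independently of the seeds left for coding, and exchangeability makes the law insensitive to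
  this.

  Densities enter only at the end: there are finitely many decorations, so every density is a fixed
  linear combination of probabilities of finite windows.\<close>

text \<open>
  Base \<open>D + 1\<close> instead of \<open>D\<close> keeps all tails strictly below one unit, so that the code is injective.
\<close>

definition seq_code :: "nat \<Rightarrow> (nat \<Rightarrow> nat) \<Rightarrow> real" where
  "seq_code D b = (\<Sum>n. real (b n) / real (D + 1) ^ Suc n)"

definition seq_digit :: "nat \<Rightarrow> nat \<Rightarrow> real \<Rightarrow> nat" where
  "seq_digit D n x = nat (\<lfloor>x * real (D + 1) ^ Suc n\<rfloor> mod int (D + 1))"

text \<open>The right-hand side is the code of the constant sequence \<open>D - 1\<close>, the
  largest code there is. It stays below 1, which is why floors recover digits.\<close>

lemma geometric_digit_sums:
  assumes "D \<ge> 1"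
  shows "(\<lambda>n. real (D - 1) / real (D + 1) ^ Suc n) sums (real (D - 1) / real D)"
proof -
  have "(\<lambda>n. (1 / real (D + 1)) ^ n) sums (1 / (1 - 1 / real (D + 1)))"
    using assms by (intro geometric_sums) auto
  from sums_mult[OF this, of "real (D - 1) / real (D + 1)"] show ?thesis
    using assms by (simp add: divide_simps power_divide)
qed

lemma seq_code_summable:
  assumes "\<And>n. b n < D"
  shows "summable (\<lambda>n. real (b n) / real (D + 1) ^ Suc n)"
proof (rule summable_comparison_test')
  have D: "D \<ge> 1" using assms[of 0] by simp
  show "summable (\<lambda>n. real (D - 1) / real (D + 1) ^ Suc n)"
    using geometric_digit_sums[OF D] by (rule sums_summable)
  show "norm (real (b n) / real (D + 1) ^ Suc n) \<le> real (D - 1) / real (D + 1) ^ Suc n" for n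
    using assms[of n] by (simp add: divide_right_mono del: power_Suc)
qed

lemma seq_code_bounds:
  assumes "\<And>n. b n < D"
  shows "0 \<le> seq_code D b" "seq_code D b < 1"
proof -
  have D: "D \<ge> 1" using assms[of 0] by simp
  show "0 \<le> seq_code D b"
    unfolding seq_code_def by (intro suminf_nonneg seq_code_summable assms) simp
  have le: "real (b n) \<le> real (D - 1)" for n
    using assms[of n] by simp
  have "seq_code D b \<le> (\<Sum>n. real (D - 1) / real (D + 1) ^ Suc n)"
    unfolding seq_code_def
    using le sums_summable[OF geometric_digit_sums[OF D]]
    by (intro suminf_le seq_code_summable assms divide_right_mono) (use D in auto)
  also have "\<dots> = real (D - 1) / real D"
    using geometric_digit_sums[OF D] by (rule sums_unique[symmetric])
  also have "\<dots> < 1" using D by (simp add: of_nat_diff divide_simps)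
  finally show "seq_code D b < 1" .
qed

text \<open>Multiplication by the base is the shift: the first digit is split off as the integer
  part, and what remains is again a code in \<open>{0..<1}\<close>.\<close>

lemma seq_code_Suc:
  assumes "\<And>n. b n < D"
  shows "seq_code D b * real (D + 1) = real (b 0) + seq_code D (\<lambda>n. b (Suc n))"
proof -
  have "seq_code D b = (\<Sum>n. real (b (Suc n)) / real (D + 1) ^ Suc (Suc n)) + real (b 0) / real (D + 1)"
    unfolding seq_code_def using suminf_split_head[OF seq_code_summable[of b D, OF assms]] by simp
  also have "(\<Sum>n. real (b (Suc n)) / real (D + 1) ^ Suc (Suc n)) = seq_code D (\<lambda>n. b (Suc n)) / real (D + 1)"
    unfolding seq_code_def
    using suminf_divide[OF seq_code_summable[of "\<lambda>n. b (Suc n)" D], of "real (D + 1)"] assms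
    by (simp add: mult.commute)
  finally show ?thesis by (simp add: divide_simps del: of_nat_add of_nat_Suc)
qed

lemma seq_digit_code:
  assumes "\<And>n. b n < D"
  shows "seq_digit D n (seq_code D b) = b n"
  using assms
proof (induction n arbitrary: b)
  case 0
  have "\<lfloor>seq_code D b * real (D + 1)\<rfloor> = int (b 0)"
    unfolding seq_code_Suc[OF 0] using seq_code_bounds[of "\<lambda>n. b (Suc n)" D] 0
    by (simp add: floor_unique)
  then show ?case using 0[of 0] by (simp add: seq_digit_def)
next
  case (Suc n)
  let ?c = "\<lambda>n. b (Suc n)"
  have "seq_code D b * real (D + 1) ^ Suc (Suc n)
      = (seq_code D b * real (D + 1)) * real (D + 1) ^ Suc n" by simp
  also have "\<dots> = seq_code D ?c * real (D + 1) ^ Suc n + of_int (int (b 0 * (D + 1) ^ Suc n))"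
    unfolding seq_code_Suc[OF Suc.prems] by (simp add: algebra_simps)
  finally have "\<lfloor>seq_code D b * real (D + 1) ^ Suc (Suc n)\<rfloor> =
     \<lfloor>seq_code D ?c * real (D + 1) ^ Suc n\<rfloor> + int (b 0 * (D + 1) ^ Suc n)"
    by (simp only: floor_add_int)
  \<comment> \<open>The first digit contributes a multiple of \<open>(D + 1) ^ Suc n\<close>, which
    is invisible modulo the base.\<close>
  moreover have "(x + int (b 0 * (D + 1) ^ Suc n)) mod int (D + 1) = x mod int (D + 1)" for x
  proof -
    have "x + int (b 0 * (D + 1) ^ Suc n) = x + int (D + 1) * int (b 0 * (D + 1) ^ n)" by (simp add: algebra_simps)
    then show ?thesis by (simp only: mod_mult_self2)
  qed
  ultimately show ?case
    using Suc.IH[of ?c] Suc.prems by (simp only: seq_digit_def)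
qed

lemma measurable_seq_digit[measurable]: "seq_digit D n \<in> measurable borel (count_space UNIV)"
  unfolding seq_digit_def by measurable

lemma borel_measurable_seq_code:
  assumes "\<And>n. f n \<in> measurable M (count_space UNIV)"
  shows "(\<lambda>x. seq_code D (\<lambda>n. f n x)) \<in> borel_measurable M"
  unfolding seq_code_def using assms
  by (intro borel_measurable_suminf borel_measurable_divide) (auto intro: measurable_compose)

section \<open>Noise outsourcing\<close>

text \<open>It suffices to test on the one set where \<open>g < f\<close>: there the integral of
  \<open>f - g\<close> must vanish. Finiteness of the integral of \<open>g\<close> permits the
  subtraction in \<open>ennreal\<close>.\<close>

lemma AE_le_of_set_nn_integral_le:
  fixes f g :: "'a \<Rightarrow> ennreal"
  assumes [measurable]: "f \<in> borel_measurable M" "g \<in> borel_measurable M"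
    and fin: "(\<integral>\<^sup>+x. g x \<partial>M) \<noteq> \<infinity>"
    and le: "\<And>A. A \<in> sets M \<Longrightarrow> (\<integral>\<^sup>+x. f x * indicator A x \<partial>M) \<le> (\<integral>\<^sup>+x. g x * indicator A x \<partial>M)"
  shows "AE x in M. f x \<le> g x"
proof -
  define A where "A = {x \<in> space M. g x < f x}"
  have A[measurable]: "A \<in> sets M" unfolding A_def by measurable
  have "(\<integral>\<^sup>+x. g x * indicator A x \<partial>M) \<le> (\<integral>\<^sup>+x. g x \<partial>M)"
    by (intro nn_integral_mono) (auto simp: indicator_def)
  then have finA: "(\<integral>\<^sup>+x. g x * indicator A x \<partial>M) < \<infinity>"
    using fin by (auto simp: top.not_eq_extremum intro: le_less_trans)
  have le2: "AE x in M. g x * indicator A x \<le> f x * indicator A x"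
    by (auto simp: A_def indicator_def)
  have "(\<integral>\<^sup>+x. f x * indicator A x - g x * indicator A x \<partial>M) =
      (\<integral>\<^sup>+x. f x * indicator A x \<partial>M) - (\<integral>\<^sup>+x. g x * indicator A x \<partial>M)"
    using finA le2 by (intro nn_integral_diff) auto
  also have "\<dots> = 0" using le[OF A] finA by (intro diff_eq_0_ennreal) auto
  finally have *: "AE x in M. f x * indicator A x - g x * indicator A x = 0"
    by (subst (asm) nn_integral_0_iff_AE) auto
  show ?thesis
    using * AE_space
  proof eventually_elim
    case (elim x)
    show ?case
    proof (rule ccontr)
      assume "\<not> f x \<le> g x"
      then have "g x < f x" "x \<in> A" using elim by (auto simp: A_def)
      then show False using elim by (auto simp: diff_eq_0_iff_ennreal)
    qed
  qed
qed

text \<open>Rectangles with a half-line as second factor are stable under intersection and generate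
  the product. Joint laws can thus be compared through distribution functions in the real
  coordinate.\<close>

lemma finite_measure_pair_borel_eqI:
  fixes P Q :: "('a \<times> real) measure"
  assumes sets: "sets P = sets (N \<Otimes>\<^sub>M borel)" "sets Q = sets (N \<Otimes>\<^sub>M borel)"
    and fin: "finite_measure P"
    and eq: "\<And>B t. B \<in> sets N \<Longrightarrow> emeasure P (B \<times> {..<t}) = emeasure Q (B \<times> {..<t})"
  shows "P = Q"
proof -
  define E where "E = {a \<times> b | a b. a \<in> sets N \<and> b \<in> range (lessThan :: real \<Rightarrow> _)}"
  have gen: "sets (N \<Otimes>\<^sub>M borel) = sets (sigma (space N \<times> space (borel::real measure)) E)"
    unfolding E_def
  proof (rule sets_pair_eq[where Ca="{space N}" and Cb="range (\<lambda>n::nat. {..<real n})"])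
    show "sets borel = sigma_sets (space borel) (range (lessThan :: real \<Rightarrow> _))"
      by (subst borel_eq_lessThan) (simp add: lessThan_def eucl_less_def)
    show "\<Union> (range (\<lambda>n. {..<real n})) = space borel"
      using reals_Archimedean2 by auto
  qed (auto simp: sets.space_closed sets.sigma_sets_eq)
  have E: "E \<subseteq> Pow (space N \<times> UNIV)"
    unfolding E_def using sets.sets_into_space by fastforce
  show ?thesis
  proof (rule measure_eqI_generator_eq[where E=E and \<Omega>="space N \<times> UNIV" and A="\<lambda>n::nat. space N \<times> {..<real n}"])
    show "Int_stable E"
    proof (rule Int_stableI)
      fix a b assume "a \<in> E" "b \<in> E"
      then obtain A s B t where *: "a = A \<times> {..<s}" "b = B \<times> {..<t}" "A \<in> sets N" "B \<in> sets N"
        by (auto simp: E_def)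
      then have "a \<inter> b = (A \<inter> B) \<times> {..<min s t}" by auto
      then show "a \<inter> b \<in> E" using * by (auto simp: E_def)
    qed
    show "(\<Union>n. space N \<times> {..<real n}) = space N \<times> UNIV"
      using reals_Archimedean2 by auto
    show "emeasure P (space N \<times> {..<real i}) \<noteq> \<infinity>" for i
      using fin finite_measure.emeasure_finite by auto
  qed (use E sets gen eq in \<open>auto simp: E_def\<close>)
qed

lemma sets_unit_uniform_cong: "sets unit_uniform = sets (restrict_space borel {0..1})"
  unfolding unit_uniform_def by (intro sets_restrict_space_cong) simp

lemma measurable_ident_unit_uniform[measurable]: "(\<lambda>x. x) \<in> borel_measurable unit_uniform"
  by (subst measurable_cong_sets[OF sets_unit_uniform_cong refl])
     (rule measurable_restrict_space1, simp)

text \<open>Stated for \<open>c\<close> in \<open>ennreal\<close> because a Radon-Nikodym derivative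
  will be inserted for it.\<close>

lemma unit_uniform_sublevel:
  "emeasure unit_uniform {u \<in> space unit_uniform. ennreal u \<le> c} = min 1 c"
proof (cases c)
  case (real x)
  have "{u \<in> space unit_uniform. ennreal u \<le> c} = {0..min 1 x}"
    using real by (auto simp: space_unit_uniform)
  then show ?thesis using real
    by (simp add: unit_uniform_def emeasure_restrict_space min_def ennreal_1[symmetric] del: ennreal_1)
next
  case top
  then have "{u \<in> space unit_uniform. ennreal u \<le> c} = {0..1}"
    by (auto simp: space_unit_uniform)
  then show ?thesis using top
    by (simp add: unit_uniform_def emeasure_restrict_space)
qed

text \<open>\<open>F (y, u)\<close> is the conditional quantile function of \<open>Z\<close> given
  \<open>Y = y\<close>, evaluated at \<open>u\<close>. It is assembled from conditional distribution
  functions at rational levels only, so that countably many null sets suffice and no regular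
  conditional distribution has to be chosen.\<close>

theorem outsourcing:
  assumes "prob_space M" and Y[measurable]: "Y \<in> measurable M N"
    and Z[measurable]: "Z \<in> borel_measurable M"
    and Z01: "\<And>x. x \<in> space M \<Longrightarrow> 0 \<le> Z x \<and> Z x \<le> 1"
  shows "\<exists>F \<in> borel_measurable (N \<Otimes>\<^sub>M unit_uniform).
    (\<forall>x. 0 \<le> F x \<and> F x \<le> (1::real)) \<and>
    distr M (N \<Otimes>\<^sub>M borel) (\<lambda>x. (Y x, Z x)) =
    distr (distr M N Y \<Otimes>\<^sub>M unit_uniform) (N \<Otimes>\<^sub>M borel) (\<lambda>(y, u). (y, F (y, u)))"
proof -
  interpret M: prob_space M by fact
  interpret U: prob_space unit_uniform by (rule prob_space_unit_uniform)
  define \<nu> where "\<nu> = distr M N Y"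
  have [simp, measurable_cong]: "sets \<nu> = sets N" by (simp add: \<nu>_def)
  have space_nu[simp]: "space \<nu> = space N" by (simp add: \<nu>_def)
  interpret nu: prob_space \<nu> unfolding \<nu>_def by (rule M.prob_space_distr) simp
  interpret nuU: pair_prob_space \<nu> unit_uniform ..
  \<comment> \<open>The law of \<open>Y\<close> on the event \<open>Z \<le> q\<close>. Its density
    \<open>G q\<close> with respect to \<open>\<nu>\<close> is a version of the conditional
    probability of \<open>Z \<le> q\<close> given \<open>Y\<close>.\<close>
  define \<nu>q where "\<nu>q q = distr (density M (indicator {x\<in>space M. Z x \<le> q})) N Y" for q
  have emq: "emeasure (\<nu>q q) A = emeasure M {x\<in>space M. Y x \<in> A \<and> Z x \<le> q}" if [measurable]: "A \<in> sets N" for A q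
    unfolding \<nu>q_def
    by (subst emeasure_distr, simp, simp, subst emeasure_density, simp, measurable)
       (auto simp: indicator_inter_arith[symmetric] nn_integral_indicator intro!: arg_cong[where f="emeasure M"])
  have emn: "emeasure \<nu> A = emeasure M {x\<in>space M. Y x \<in> A}" if [measurable]: "A \<in> sets N" for A
    unfolding \<nu>_def by (subst emeasure_distr) (auto intro!: arg_cong[where f="emeasure M"])
  have ac: "absolutely_continuous \<nu> (\<nu>q q)" for q
    unfolding absolutely_continuous_def
  proof safe
    fix A assume A: "A \<in> null_sets \<nu>"
    then have [measurable]: "A \<in> sets N" by auto
    have "emeasure (\<nu>q q) A \<le> emeasure \<nu> A"
      unfolding emq[OF \<open>A \<in> sets N\<close>] emn[OF \<open>A \<in> sets N\<close>] by (intro emeasure_mono) auto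
    then show "A \<in> null_sets (\<nu>q q)" using A by (auto simp: null_sets_def \<nu>q_def)
  qed
  define G where "G q = RN_deriv \<nu> (\<nu>q q)" for q
  have [measurable]: "G q \<in> borel_measurable N" for q
    using borel_measurable_RN_deriv[of \<nu> "\<nu>q q"] by (simp add: G_def cong: measurable_cong_sets)
  have sets_nuq: "sets (\<nu>q q) = sets \<nu>" for q by (simp add: \<nu>q_def)
  have Gint: "(\<integral>\<^sup>+y. G q y * indicator A y \<partial>\<nu>) = emeasure M {x\<in>space M. Y x \<in> A \<and> Z x \<le> q}"
    if [measurable]: "A \<in> sets N" for A q
  proof -
    have "(\<integral>\<^sup>+y. G q y * indicator A y \<partial>\<nu>) = emeasure (density \<nu> (G q)) A"
      by (subst emeasure_density) auto
    also have "density \<nu> (G q) = \<nu>q q"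
      unfolding G_def by (rule nu.density_RN_deriv[OF ac sets_nuq])
    finally show ?thesis by (simp add: emq)
  qed
  have Gfin: "(\<integral>\<^sup>+y. G q y \<partial>\<nu>) \<noteq> \<infinity>" for q
  proof -
    have "(\<integral>\<^sup>+y. G q y \<partial>\<nu>) = (\<integral>\<^sup>+y. G q y * indicator (space N) y \<partial>\<nu>)"
      by (intro nn_integral_cong) (auto simp: \<nu>_def)
    also have "\<dots> = emeasure M {x\<in>space M. Y x \<in> space N \<and> Z x \<le> q}" by (rule Gint) simp
    also have "\<dots> \<noteq> \<infinity>" using M.emeasure_finite by simp
    finally show ?thesis .
  qed
  have Gmono: "AE y in \<nu>. G p y \<le> G q y" if "p \<le> q" for p q
  proof (rule AE_le_of_set_nn_integral_le)
    fix A assume "A \<in> sets \<nu>"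
    then have [measurable]: "A \<in> sets N" by simp
    show "(\<integral>\<^sup>+y. G p y * indicator A y \<partial>\<nu>) \<le> (\<integral>\<^sup>+y. G q y * indicator A y \<partial>\<nu>)"
      unfolding Gint[OF \<open>A \<in> sets N\<close>] using that by (intro emeasure_mono) auto
  qed (use Gfin in \<open>auto cong: measurable_cong_sets\<close>)
  have G1: "AE y in \<nu>. G q y \<le> 1" for q
  proof (rule AE_le_of_set_nn_integral_le)
    fix A assume "A \<in> sets \<nu>"
    then have A[measurable]: "A \<in> sets N" by simp
    show "(\<integral>\<^sup>+y. G q y * indicator A y \<partial>\<nu>) \<le> (\<integral>\<^sup>+y. 1 * indicator A y \<partial>\<nu>)"
      unfolding Gint[OF A] by (simp add: emn) (intro emeasure_mono; auto)
  qed (auto simp: nu.emeasure_space_1[simplified] cong: measurable_cong_sets)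
  define R where "R = {q::real. q \<in> \<rat> \<and> 0 \<le> q \<and> q \<le> 1}"
  have Rc: "countable R" unfolding R_def by (rule countable_subset[OF _ countable_rat]) auto
  \<comment> \<open>The extra point 1 keeps the infimum over a nonempty set and \<open>F\<close> at
    most 1, also where no rational level reaches the seed.\<close>
  define S where "S x = insert 1 {q \<in> R. ennreal (snd x) \<le> G q (fst x)}" for x :: "_ \<times> real"
  define F where "F x = Inf (S x)" for x
  have S01: "S x \<subseteq> {0..1}" "S x \<noteq> {}" "1 \<in> S x" for x by (auto simp: S_def R_def)
  have Sbdd: "bdd_below (S x)" for x
    by (rule bdd_belowI[of _ 0]) (use S01[of x] in auto)
  have F01: "0 \<le> F x" "F x \<le> 1" for x
    unfolding F_def using S01[of x] Sbdd[of x] by (auto intro!: cInf_greatest cInf_lower)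
  \<comment> \<open>A strict bound on the infimum is an existential over the countable set
    \<open>R\<close>, which gives the measurability of \<open>F\<close>.\<close>
  have Fless: "F x < t \<longleftrightarrow> 1 < t \<or> (\<exists>q\<in>R. q < t \<and> ennreal (snd x) \<le> G q (fst x))" for x t
    unfolding F_def cInf_less_iff[OF S01(2) Sbdd] by (auto simp: S_def)
  have Fmeas[measurable]: "F \<in> borel_measurable (N \<Otimes>\<^sub>M unit_uniform)"
    unfolding borel_measurable_iff_less Fless
    using Rc by (auto intro!: measurable_sets sets.sets_Collect_disj sets.sets_Collect_countable_Bex) 
  have "distr M (N \<Otimes>\<^sub>M borel) (\<lambda>x. (Y x, Z x)) =
    distr (\<nu> \<Otimes>\<^sub>M unit_uniform) (N \<Otimes>\<^sub>M borel) (\<lambda>(y, u). (y, F (y, u)))"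
  proof (rule finite_measure_pair_borel_eqI[where N=N])
    show "finite_measure (distr M (N \<Otimes>\<^sub>M borel) (\<lambda>x. (Y x, Z x)))"
      by (intro prob_space.finite_measure M.prob_space_distr) simp
    fix B and t :: real assume B[measurable]: "B \<in> sets N"
    have L: "emeasure (distr M (N \<Otimes>\<^sub>M borel) (\<lambda>x. (Y x, Z x))) (B \<times> {..<t}) =
       emeasure M {x\<in>space M. Y x \<in> B \<and> Z x < t}"
      by (subst emeasure_distr) (auto intro!: arg_cong[where f="emeasure M"])
    have meas: "{x \<in> space (\<nu> \<Otimes>\<^sub>M unit_uniform). fst x \<in> B \<and> F x < t} \<in> sets (\<nu> \<Otimes>\<^sub>M unit_uniform)"
      by measurable
    have "emeasure (distr (\<nu> \<Otimes>\<^sub>M unit_uniform) (N \<Otimes>\<^sub>M borel) (\<lambda>(y, u). (y, F (y, u)))) (B \<times> {..<t}) =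
       emeasure (\<nu> \<Otimes>\<^sub>M unit_uniform) {x \<in> space (\<nu> \<Otimes>\<^sub>M unit_uniform). fst x \<in> B \<and> F x < t}"
      by (subst emeasure_distr) (auto intro!: arg_cong[where f="emeasure (\<nu> \<Otimes>\<^sub>M unit_uniform)"])
    also have "\<dots> = (\<integral>\<^sup>+y. emeasure unit_uniform {u \<in> space unit_uniform. F (y, u) < t} * indicator B y \<partial>\<nu>)"
      by (subst U.emeasure_pair_measure_alt[OF meas], intro nn_integral_cong)
         (auto simp: indicator_def space_pair_measure intro!: arg_cong[where f="emeasure unit_uniform"])
    finally have Rr: "emeasure (distr (\<nu> \<Otimes>\<^sub>M unit_uniform) (N \<Otimes>\<^sub>M borel) (\<lambda>(y, u). (y, F (y, u)))) (B \<times> {..<t}) = \<dots>" .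
    \<comment> \<open>Outside \<open>0 < t \<le> 1\<close> both sides are trivial, as
      \<open>F\<close> and \<open>Z\<close> stay in the unit interval. Inside, the extra point 1 of
      \<open>S\<close> is never below \<open>t\<close>.\<close>
    consider "t \<le> 0" | "1 < t" | "0 < t" "t \<le> 1" by linarith
    then have "(\<integral>\<^sup>+y. emeasure unit_uniform {u \<in> space unit_uniform. F (y, u) < t} * indicator B y \<partial>\<nu>)
      = emeasure M {x\<in>space M. Y x \<in> B \<and> Z x < t}"
    proof cases
      case 1
      have "{u \<in> space unit_uniform. F (y, u) < t} = {}" for y
        using F01(1) 1 by (auto simp: not_less intro: order_trans)
      moreover have "{x\<in>space M. Y x \<in> B \<and> Z x < t} = {}"
        using Z01 1 by force
      ultimately show ?thesis by (simp only: emeasure_empty mult_zero_left nn_integral_const)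
    next
      case 2
      have "{u \<in> space unit_uniform. F (y, u) < t} = space unit_uniform" for y
        using F01(2) 2 by (auto intro: le_less_trans)
      moreover have "{x\<in>space M. Y x \<in> B \<and> Z x < t} = {x\<in>space M. Y x \<in> B}"
        using Z01 2 by force
      ultimately show ?thesis
        by (simp only: U.emeasure_space_1 mult_1 nn_integral_indicator \<open>sets \<nu> = sets N\<close> B emn)
    next
      case 3
      \<comment> \<open>Rationals within \<open>1 / Suc n\<close> below \<open>t\<close>. Their
        running maxima \<open>p n\<close> increase to \<open>t\<close>, as monotone convergence
        requires.\<close>
      define q where "q n = (SOME q. q \<in> \<rat> \<and> max 0 (t - 1 / Suc n) < q \<and> q < t)" for n :: nat
      have q: "q n \<in> \<rat>" "max 0 (t - 1 / Suc n) < q n" "q n < t" for n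
      proof -
        have "max 0 (t - 1 / Suc n) < t" using 3 by auto
        from someI_ex[OF Rats_dense_in_real[OF this, unfolded Bex_def]]
        show "q n \<in> \<rat>" "max 0 (t - 1 / Suc n) < q n" "q n < t" unfolding q_def by blast+
      qed
      define p where "p n = Max (q ` {..n})" for n
      have p: "p n \<in> q ` {..n}" for n unfolding p_def by (intro Max_in) auto
      have pR: "p n \<in> R" "p n < t" for n
      proof -
        obtain j where "p n = q j" using p[of n] by auto
        with q[of j] 3 show "p n \<in> R" "p n < t" by (auto simp: R_def)
      qed
      have pinc: "p n \<le> p (Suc n)" for n
        unfolding p_def by (intro Max_mono) auto
      have plim: "\<exists>n. s \<le> p n" if "s < t" for s
      proof -
        have st: "0 < t - s" using that by simp
        obtain n where n: "1 / Suc n < t - s" using nat_approx_posE[OF st] by blast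
        have "q n \<le> p n" unfolding p_def by (intro Max_ge) auto
        with q(2)[of n] n show ?thesis by (intro exI[of _ n]) (auto simp: max_def split: if_splits)
      qed
      \<comment> \<open>One null set serves all pairs of rational levels. Off it \<open>G\<close> is
        monotone in the level, so \<open>F (y, u) < t\<close> holds exactly when \<open>u\<close> is
        at most \<open>G (p n) y\<close> for some \<open>n\<close>.\<close>
      have AEm: "AE y in \<nu>. (\<forall>a\<in>R. \<forall>b\<in>R. a \<le> b \<longrightarrow> G a y \<le> G b y) \<and> (\<forall>a\<in>R. G a y \<le> 1)"
        using Rc Gmono G1 by (auto simp: AE_ball_countable)
      have "AE y in \<nu>. emeasure unit_uniform {u \<in> space unit_uniform. F (y, u) < t} * indicator B y
         = (SUP n. G (p n) y * indicator B y)"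
        using AEm AE_space
      proof eventually_elim
        case (elim y)
        have [measurable]: "y \<in> space N" using elim by simp
        have "{u \<in> space unit_uniform. F (y, u) < t} = (\<Union>n. {u \<in> space unit_uniform. ennreal u \<le> G (p n) y})"
        proof (intro set_eqI iffI)
          fix u assume "u \<in> {u \<in> space unit_uniform. F (y, u) < t}"
          then obtain a where a: "u \<in> space unit_uniform" "a \<in> R" "a < t" "ennreal u \<le> G a y"
            using 3 by (auto simp: Fless)
          from plim[OF \<open>a < t\<close>] obtain n where "a \<le> p n" by auto
          with elim a pR have "ennreal u \<le> G (p n) y" by (meson order_trans)
          with a show "u \<in> (\<Union>n. {u \<in> space unit_uniform. ennreal u \<le> G (p n) y})" by auto
        qed (use pR in \<open>auto simp: Fless\<close>)
        also have "emeasure unit_uniform \<dots> = (SUP n. emeasure unit_uniform {u \<in> space unit_uniform. ennreal u \<le> G (p n) y})"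
        proof (rule SUP_emeasure_incseq[symmetric])
          show "range (\<lambda>n. {u \<in> space unit_uniform. ennreal u \<le> G (p n) y}) \<subseteq> sets unit_uniform"
            by auto
          show "incseq (\<lambda>n. {u \<in> space unit_uniform. ennreal u \<le> G (p n) y})"
          proof (rule incseq_SucI)
            fix n
            have "G (p n) y \<le> G (p (Suc n)) y" using elim pR pinc by blast
            then show "{u \<in> space unit_uniform. ennreal u \<le> G (p n) y} \<subseteq> {u \<in> space unit_uniform. ennreal u \<le> G (p (Suc n)) y}"
              by (auto intro: order_trans)
          qed
        qed
        also have "\<dots> = (SUP n. G (p n) y)"
          using elim pR by (intro SUP_cong refl) (auto simp: unit_uniform_sublevel min_absorb2)
        finally show ?case by (auto simp: indicator_def)
      qed
      then have "(\<integral>\<^sup>+y. emeasure unit_uniform {u \<in> space unit_uniform. F (y, u) < t} * indicator B y \<partial>\<nu>)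
         = (\<integral>\<^sup>+y. (SUP n. G (p n) y * indicator B y) \<partial>\<nu>)"
        by (intro nn_integral_cong_AE)
      also have "\<dots> = (SUP n. \<integral>\<^sup>+y. G (p n) y * indicator B y \<partial>\<nu>)"
      proof (rule nn_integral_monotone_convergence_SUP_AE)
        show "AE y in \<nu>. G (p i) y * indicator B y \<le> G (p (Suc i)) y * indicator B y" for i
          using Gmono[OF pinc[of i]] by eventually_elim (auto simp: indicator_def)
      qed simp
      also have "\<dots> = (SUP n. emeasure M {x\<in>space M. Y x \<in> B \<and> Z x \<le> p n})"
        by (simp add: Gint)
      also have "\<dots> = emeasure M (\<Union>n. {x\<in>space M. Y x \<in> B \<and> Z x \<le> p n})"
      proof (rule SUP_emeasure_incseq)
        show "range (\<lambda>n. {x\<in>space M. Y x \<in> B \<and> Z x \<le> p n}) \<subseteq> sets M" by auto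
        show "incseq (\<lambda>n. {x\<in>space M. Y x \<in> B \<and> Z x \<le> p n})"
          by (rule incseq_SucI) (use pinc in \<open>auto intro: order_trans\<close>)
      qed
      also have "(\<Union>n. {x\<in>space M. Y x \<in> B \<and> Z x \<le> p n}) = {x\<in>space M. Y x \<in> B \<and> Z x < t}"
        using plim pR by (auto intro: le_less_trans)
      finally show ?thesis .
    qed
    then show "emeasure (distr M (N \<Otimes>\<^sub>M borel) (\<lambda>x. (Y x, Z x))) (B \<times> {..<t}) =
      emeasure (distr (\<nu> \<Otimes>\<^sub>M unit_uniform) (N \<Otimes>\<^sub>M borel) (\<lambda>(y, u). (y, F (y, u)))) (B \<times> {..<t})"
      using L Rr by simp
  qed auto
  with Fmeas F01 show ?thesis unfolding \<nu>_def by blast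
qed

section \<open>Conditional independence from equality in law\<close>

text \<open>If \<open>F\<close> outsources \<open>Z\<close> from \<open>Y\<close>, this is a version
  of the conditional probability of \<open>Z < t\<close> given \<open>Y = y\<close>.\<close>

definition cond_less_prob :: "('b \<times> real \<Rightarrow> real) \<Rightarrow> real \<Rightarrow> 'b \<Rightarrow> real" where
  "cond_less_prob F t y = measure unit_uniform {u \<in> space unit_uniform. F (y, u) < t}"

lemma cond_less_prob_bounds: "0 \<le> cond_less_prob F t y" "cond_less_prob F t y \<le> 1"
proof -
  interpret U: prob_space unit_uniform by (rule prob_space_unit_uniform)
  show "0 \<le> cond_less_prob F t y" "cond_less_prob F t y \<le> 1" by (auto simp: cond_less_prob_def)
qed

lemma cond_less_prob_eq_integral:
  assumes [measurable]: "F \<in> borel_measurable (N \<Otimes>\<^sub>M unit_uniform)" "y \<in> space N"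
  shows "cond_less_prob F t y = (\<integral>u. indicator {..<t} (F (y, u)) \<partial>unit_uniform)"
proof -
  interpret U: prob_space unit_uniform by (rule prob_space_unit_uniform)
  have "(\<integral>u. indicator {..<t} (F (y, u)) \<partial>unit_uniform) =
    (\<integral>u. indicator {u \<in> space unit_uniform. F (y, u) < t} u \<partial>unit_uniform)"
    by (intro Bochner_Integration.integral_cong) (auto simp: indicator_def)
  also have "\<dots> = measure unit_uniform {u \<in> space unit_uniform. F (y, u) < t}"
    by simp
  finally show ?thesis by (simp add: cond_less_prob_def)
qed

lemma borel_measurable_cond_less_prob[measurable]:
  assumes [measurable]: "F \<in> borel_measurable (N \<Otimes>\<^sub>M unit_uniform)"
  shows "cond_less_prob F t \<in> borel_measurable N"
proof -
  interpret U: prob_space unit_uniform by (rule prob_space_unit_uniform)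
  show ?thesis
    by (subst measurable_cong[OF cond_less_prob_eq_integral[OF assms]])
       (auto intro!: U.borel_measurable_lebesgue_integral)
qed

text \<open>Fubini in the seed. This is the defining property of the conditional probability, tested
  against a bounded function \<open>g\<close> of the conditioning variable.\<close>

lemma integral_outsourced:
  fixes g :: "'b \<Rightarrow> real"
  assumes "prob_space \<nu>" and sets: "sets \<nu> = sets N"
    and [measurable]: "F \<in> borel_measurable (N \<Otimes>\<^sub>M unit_uniform)" "g \<in> borel_measurable N"
    and g: "\<And>y. \<bar>g y\<bar> \<le> C"
  shows "(\<integral>x. indicator {..<t} (snd x) * g (fst x) \<partial>distr (\<nu> \<Otimes>\<^sub>M unit_uniform) (N \<Otimes>\<^sub>M borel) (\<lambda>(y, u). (y, F (y, u))))
     = (\<integral>y. cond_less_prob F t y * g y \<partial>\<nu>)"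
proof -
  interpret U: prob_space unit_uniform by (rule prob_space_unit_uniform)
  interpret \<nu>: prob_space \<nu> by fact
  interpret P: pair_prob_space \<nu> unit_uniform ..
  note [measurable_cong] = sets
  have "(\<integral>x. indicator {..<t} (snd x) * g (fst x) \<partial>distr (\<nu> \<Otimes>\<^sub>M unit_uniform) (N \<Otimes>\<^sub>M borel) (\<lambda>(y, u). (y, F (y, u))))
    = (\<integral>x. indicator {..<t} (F x) * g (fst x) \<partial>(\<nu> \<Otimes>\<^sub>M unit_uniform))"
    by (subst integral_distr) (auto intro!: Bochner_Integration.integral_cong)
  also have "\<dots> = (\<integral>y. \<integral>u. indicator {..<t} (F (y, u)) * g (fst (y, u)) \<partial>unit_uniform \<partial>\<nu>)"
  proof (rule P.integral_fst'[symmetric])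
    show "integrable (\<nu> \<Otimes>\<^sub>M unit_uniform) (\<lambda>x. indicator {..<t} (F x) * g (fst x))"
      using g by (intro P.integrable_const_bound[where B=C]) (auto simp: indicator_def intro: order_trans[OF abs_ge_zero])
  qed
  also have "\<dots> = (\<integral>y. cond_less_prob F t y * g y \<partial>\<nu>)"
    by (intro Bochner_Integration.integral_cong refl)
       (simp add: cond_less_prob_eq_integral[OF assms(3)] sets_eq_imp_space_eq[OF sets])
  finally show ?thesis .
qed

text \<open>
  Conditioning on \<open>p' (Y)\<close>, \<open>Y\<close>, \<open>Y'\<close> uses more and more information, but the first and the last
  conditional expectation have the same law by assumption; equality of \<open>L\<^sup>2\<close> norms makes them agree.
\<close>

theorem cond_indep_transfer:
  fixes Z :: "'a \<Rightarrow> real" and Y :: "'a \<Rightarrow> 'b" and Y' :: "'a \<Rightarrow> 'c"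
  assumes "prob_space M"
    and Y[measurable]: "Y \<in> measurable M N" and Y'[measurable]: "Y' \<in> measurable M N'"
    and Z[measurable]: "Z \<in> borel_measurable M" and Z01: "\<And>x. x \<in> space M \<Longrightarrow> 0 \<le> Z x \<and> Z x \<le> 1"
    and p[measurable]: "p \<in> measurable N' N" and p'[measurable]: "p' \<in> measurable N N'"
    and Yp: "\<And>x. x \<in> space M \<Longrightarrow> Y x = p (Y' x)"
    and eqd: "distr M (N' \<Otimes>\<^sub>M borel) (\<lambda>x. (p' (Y x), Z x)) = distr M (N' \<Otimes>\<^sub>M borel) (\<lambda>x. (Y' x, Z x))"
    and F[measurable]: "F \<in> borel_measurable (N \<Otimes>\<^sub>M unit_uniform)"
    and FD: "distr M (N \<Otimes>\<^sub>M borel) (\<lambda>x. (Y x, Z x)) =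
      distr (distr M N Y \<Otimes>\<^sub>M unit_uniform) (N \<Otimes>\<^sub>M borel) (\<lambda>(y, u). (y, F (y, u)))"
  shows "distr M (N' \<Otimes>\<^sub>M borel) (\<lambda>x. (Y' x, Z x)) =
    distr (distr M N' Y' \<Otimes>\<^sub>M unit_uniform) (N' \<Otimes>\<^sub>M borel) (\<lambda>(y, u). (y, F (p y, u)))"
proof -
  interpret M: prob_space M by fact
  interpret U: prob_space unit_uniform by (rule prob_space_unit_uniform)
  \<comment> \<open>\<open>F'\<close> represents \<open>Z\<close> given \<open>Y'\<close>. As
    \<open>p' (Y)\<close> and \<open>Y'\<close> have the same joint law with \<open>Z\<close>, it
    also represents \<open>Z\<close> given \<open>p' (Y)\<close>.\<close>
  obtain F' where F'[measurable]: "F' \<in> borel_measurable (N' \<Otimes>\<^sub>M unit_uniform)"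
    and F'D: "distr M (N' \<Otimes>\<^sub>M borel) (\<lambda>x. (Y' x, Z x)) =
      distr (distr M N' Y' \<Otimes>\<^sub>M unit_uniform) (N' \<Otimes>\<^sub>M borel) (\<lambda>(y, u). (y, F' (y, u)))"
    using outsourcing[OF assms(1) Y' Z Z01] by blast
  have marg: "distr M N' (\<lambda>x. p' (Y x)) = distr M N' Y'"
  proof -
    have "distr M N' (\<lambda>x. p' (Y x)) = distr (distr M (N' \<Otimes>\<^sub>M borel) (\<lambda>x. (p' (Y x), Z x))) N' fst"
      by (subst distr_distr) (auto simp: comp_def)
    also have "\<dots> = distr M N' Y'"
      unfolding eqd by (subst distr_distr) (auto simp: comp_def)
    finally show ?thesis .
  qed
  have F''D: "distr M (N' \<Otimes>\<^sub>M borel) (\<lambda>x. (p' (Y x), Z x)) =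
      distr (distr M N' (\<lambda>x. p' (Y x)) \<Otimes>\<^sub>M unit_uniform) (N' \<Otimes>\<^sub>M borel) (\<lambda>(y, u). (y, F' (y, u)))"
    unfolding eqd marg by (rule F'D)
  have key: "(\<integral>x. indicator {..<t} (Z x) * g (X x) \<partial>M) = (\<integral>x. cond_less_prob G t (X x) * g (X x) \<partial>M)"
    if [measurable]: "X \<in> measurable M L" "G \<in> borel_measurable (L \<Otimes>\<^sub>M unit_uniform)" "g \<in> borel_measurable L"
      and "\<And>y. \<bar>g y\<bar> \<le> 1"
      and D: "distr M (L \<Otimes>\<^sub>M borel) (\<lambda>x. (X x, Z x)) =
        distr (distr M L X \<Otimes>\<^sub>M unit_uniform) (L \<Otimes>\<^sub>M borel) (\<lambda>(y, u). (y, G (y, u)))"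
    for X G L t and g :: "_ \<Rightarrow> real"
  proof -
    have "(\<integral>x. indicator {..<t} (Z x) * g (X x) \<partial>M) =
      (\<integral>x. indicator {..<t} (snd x) * g (fst x) \<partial>distr M (L \<Otimes>\<^sub>M borel) (\<lambda>x. (X x, Z x)))"
      by (subst integral_distr) auto
    also have "\<dots> = (\<integral>y. cond_less_prob G t y * g y \<partial>distr M L X)"
      unfolding D using that by (intro integral_outsourced M.prob_space_distr) auto
    also have "\<dots> = (\<integral>x. cond_less_prob G t (X x) * g (X x) \<partial>M)"
      by (subst integral_distr) auto
    finally show ?thesis .
  qed
  have eq: "AE x in M. cond_less_prob F' t (Y' x) = cond_less_prob F t (Y x)" for t
  proof -
    \<comment> \<open>\<open>k\<close>, \<open>k'\<close> and \<open>k''\<close> are the conditional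
      probabilities of \<open>Z < t\<close> given \<open>Y\<close>, \<open>Y'\<close> and
      \<open>p' (Y)\<close>.\<close>
    define k where "k x = cond_less_prob F t (Y x)" for x
    define k' where "k' x = cond_less_prob F' t (Y' x)" for x
    define k'' where "k'' x = cond_less_prob F' t (p' (Y x))" for x
    have [measurable]: "k \<in> borel_measurable M" "k' \<in> borel_measurable M" "k'' \<in> borel_measurable M"
      unfolding k_def k'_def k''_def by measurable
    have b: "0 \<le> k x" "k x \<le> 1" "0 \<le> k' x" "k' x \<le> 1" "0 \<le> k'' x" "k'' x \<le> 1" for x
      by (auto simp: k_def k'_def k''_def cond_less_prob_bounds)
    have [simp]: "integrable M (\<lambda>x. f x * g x)"
      if "f \<in> {k, k', k''}" "g \<in> {k, k', k''}" for f g
      using that b by (intro M.integrable_const_bound[where B=1]) (auto simp: abs_mult intro!: mult_le_one)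
    have abs: "\<bar>cond_less_prob G s y\<bar> \<le> 1" for G :: "'z \<times> real \<Rightarrow> real" and s y
      using cond_less_prob_bounds[of G s y] by simp
    \<comment> \<open>Since \<open>Y = p (Y')\<close>, the function \<open>k\<close> may be used as
      a test function of \<open>Y'\<close>; hence \<open>k' - k\<close> is orthogonal to
      \<open>k\<close>.\<close>
    have 1: "(\<integral>x. k' x * k x \<partial>M) = (\<integral>x. k x * k x \<partial>M)"
    proof -
      have "(\<integral>x. k' x * k x \<partial>M) = (\<integral>x. k' x * cond_less_prob F t (p (Y' x)) \<partial>M)"
        by (intro Bochner_Integration.integral_cong) (auto simp: k_def Yp)
      also have "\<dots> = (\<integral>x. indicator {..<t} (Z x) * cond_less_prob F t (p (Y' x)) \<partial>M)"
        unfolding k'_def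
        by (rule key[OF Y' F' _ _ F'D, symmetric]) (auto simp: abs)
      also have "\<dots> = (\<integral>x. indicator {..<t} (Z x) * cond_less_prob F t (Y x) \<partial>M)"
        by (intro Bochner_Integration.integral_cong) (auto simp: Yp)
      also have "\<dots> = (\<integral>x. k x * k x \<partial>M)"
        unfolding k_def by (rule key[OF Y F _ _ FD]) (auto simp: abs)
      finally show ?thesis .
    qed
    \<comment> \<open>Likewise \<open>k''\<close> is a function of \<open>Y\<close>, so
      \<open>k - k''\<close> is orthogonal to \<open>k''\<close>.\<close>
    have 2: "(\<integral>x. k x * k'' x \<partial>M) = (\<integral>x. k'' x * k'' x \<partial>M)"
    proof -
      have "(\<integral>x. k x * k'' x \<partial>M) = (\<integral>x. indicator {..<t} (Z x) * cond_less_prob F' t (p' (Y x)) \<partial>M)"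
        unfolding k_def k''_def
        by (rule key[OF Y F _ _ FD, symmetric]) (auto simp: abs)
      also have "\<dots> = (\<integral>x. k'' x * k'' x \<partial>M)"
        unfolding k''_def
        by (rule key[OF _ F' _ _ F''D]) (auto simp: abs)
      finally show ?thesis .
    qed
    have 3: "(\<integral>x. k'' x * k'' x \<partial>M) = (\<integral>x. k' x * k' x \<partial>M)"
    proof -
      have "(\<integral>x. k'' x * k'' x \<partial>M) = (\<integral>y. cond_less_prob F' t y * cond_less_prob F' t y \<partial>distr M N' (\<lambda>x. p' (Y x)))"
        unfolding k''_def by (subst integral_distr) auto
      also have "\<dots> = (\<integral>x. k' x * k' x \<partial>M)"
        unfolding marg k'_def by (subst integral_distr) auto
      finally show ?thesis .
    qed
    \<comment> \<open>By orthogonality the norm of \<open>k''\<close> is at most that of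
      \<open>k\<close>; since \<open>k''\<close> and \<open>k'\<close> agree in law, the same bound
      holds for \<open>k'\<close>.\<close>
    have "0 \<le> (\<integral>x. (k x - k'' x)\<^sup>2 \<partial>M)" by simp
    also have "\<dots> = (\<integral>x. k x * k x - 2 * (k x * k'' x) + k'' x * k'' x \<partial>M)"
      by (intro Bochner_Integration.integral_cong) (auto simp: power2_eq_square algebra_simps)
    also have "\<dots> = (\<integral>x. k x * k x \<partial>M) - (\<integral>x. k' x * k' x \<partial>M)"
      by (simp add: 2 3)
    finally have 4: "(\<integral>x. k' x * k' x \<partial>M) \<le> (\<integral>x. k x * k x \<partial>M)" by simp
    \<comment> \<open>By orthogonality again, the squared distance of \<open>k'\<close> and
      \<open>k\<close> is the difference of their squared norms, now known not to be
      positive.\<close>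
    have "(\<integral>x. (k' x - k x)\<^sup>2 \<partial>M) = (\<integral>x. k' x * k' x - 2 * (k' x * k x) + k x * k x \<partial>M)"
      by (intro Bochner_Integration.integral_cong) (auto simp: power2_eq_square algebra_simps)
    also have "\<dots> = (\<integral>x. k' x * k' x \<partial>M) - (\<integral>x. k x * k x \<partial>M)"
      by (simp add: 1)
    finally have "(\<integral>x. (k' x - k x)\<^sup>2 \<partial>M) \<le> 0" using 4 by simp
    then have z: "(\<integral>x. (k' x - k x)\<^sup>2 \<partial>M) = 0"
      by (intro antisym) auto
    have "integrable M (\<lambda>x. (k' x - k x)\<^sup>2)"
    proof (rule M.integrable_const_bound[where B=1])
      have "\<bar>k' x - k x\<bar> \<le> 1" for x using b(1-4)[of x] by linarith
      then show "AE x in M. norm ((k' x - k x)\<^sup>2) \<le> 1" by (auto simp: abs_square_le_1)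
    qed simp
    from integral_nonneg_eq_0_iff_AE[OF this] z show ?thesis by (auto simp: k_def k'_def)
  qed
  define Q where "Q = distr (distr M N' Y' \<Otimes>\<^sub>M unit_uniform) (N' \<Otimes>\<^sub>M borel) (\<lambda>(y, u). (y, F (p y, u)))"
  interpret Y': prob_space "distr M N' Y'" by (rule M.prob_space_distr) simp
  interpret YU: pair_prob_space "distr M N' Y'" unit_uniform ..
  interpret Q: prob_space Q unfolding Q_def by (rule YU.prob_space_distr) simp
  interpret P: prob_space "distr M (N' \<Otimes>\<^sub>M borel) (\<lambda>x. (Y' x, Z x))" by (rule M.prob_space_distr) simp
  show ?thesis
    unfolding Q_def[symmetric]
  proof (rule finite_measure_pair_borel_eqI[where N=N'])
    fix B and t :: real assume B[measurable]: "B \<in> sets N'"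
    have "measure (distr M (N' \<Otimes>\<^sub>M borel) (\<lambda>x. (Y' x, Z x))) (B \<times> {..<t}) =
      (\<integral>x. indicator {..<t} (Z x) * indicator B (Y' x) \<partial>M)"
    proof -
      have "measure (distr M (N' \<Otimes>\<^sub>M borel) (\<lambda>x. (Y' x, Z x))) (B \<times> {..<t}) =
        (\<integral>x. indicator (B \<times> {..<t}) x \<partial>distr M (N' \<Otimes>\<^sub>M borel) (\<lambda>x. (Y' x, Z x)))"
        by simp
      also have "\<dots> = (\<integral>x. indicator {..<t} (Z x) * indicator B (Y' x) \<partial>M)"
        by (subst integral_distr) (auto simp: indicator_times mult.commute)
      finally show ?thesis .
    qed
    also have "\<dots> = (\<integral>x. cond_less_prob F' t (Y' x) * indicator B (Y' x) \<partial>M)"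
      by (rule key[OF Y' F' _ _ F'D]) auto
    also have "\<dots> = (\<integral>x. cond_less_prob F t (p (Y' x)) * indicator B (Y' x) \<partial>M)"
    proof (intro integral_cong_AE)
      show "AE x in M. cond_less_prob F' t (Y' x) * indicator B (Y' x) = cond_less_prob F t (p (Y' x)) * indicator B (Y' x)"
        using eq[of t] AE_space by eventually_elim (simp add: Yp)
    qed auto
    also have "\<dots> = (\<integral>y. cond_less_prob (\<lambda>(y, u). F (p y, u)) t y * indicator B y \<partial>distr M N' Y')"
      by (subst integral_distr) (auto simp: cond_less_prob_def)
    also have "\<dots> = (\<integral>x. indicator {..<t} (snd x) * indicator B (fst x) \<partial>Q)"
      unfolding Q_def
      using integral_outsourced[where N=N' and \<nu>="distr M N' Y'" and F="\<lambda>(y, u). F (p y, u)" and C=1 and t=t and g="indicator B"]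
      by (simp add: Y'.prob_space_axioms)
    also have "\<dots> = (\<integral>x. indicator (B \<times> {..<t}) x \<partial>Q)"
      by (intro Bochner_Integration.integral_cong) (auto simp: indicator_def)
    also have "\<dots> = measure Q (B \<times> {..<t})"
      by (simp add: Q_def)
    finally show "emeasure (distr M (N' \<Otimes>\<^sub>M borel) (\<lambda>x. (Y' x, Z x))) (B \<times> {..<t}) = emeasure Q (B \<times> {..<t})"
      by (simp add: P.emeasure_eq_measure Q.emeasure_eq_measure)
  qed (auto simp: Q_def P.finite_measure_axioms)
qed

section \<open>Kolmogorov extension for finite-valued processes\<close>

text \<open>Cantor's diagonal argument over an enumeration of \<open>A\<close>, with compactness of
  \<open>{-B..B}\<close> at each stage.\<close>

lemma simultaneous_convergent_subseq:
  fixes f :: "nat \<Rightarrow> 'i \<Rightarrow> real"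
  assumes "countable A" and bound: "\<And>n i. \<bar>f n i\<bar> \<le> B"
  shows "\<exists>s. strict_mono s \<and> (\<forall>i\<in>A. convergent (\<lambda>k. f (s k) i))"
proof -
  interpret subseqs "\<lambda>n s. convergent (\<lambda>k. f (s k) (from_nat_into A n))"
  proof
    fix n and s :: "nat \<Rightarrow> nat"
    have "\<forall>k. f (s k) (from_nat_into A n) \<in> {-B..B}"
      using bound by (auto simp: abs_le_iff minus_le_iff)
    then obtain l r where "strict_mono r" "((\<lambda>k. f (s k) (from_nat_into A n)) \<circ> r) \<longlonglongrightarrow> l"
      using compact_Icc[of "-B" B] unfolding compact_def
      by (elim allE[of _ "\<lambda>k. f (s k) (from_nat_into A n)"]) blast
    then show "\<exists>r. strict_mono r \<and> convergent (\<lambda>k. f ((s \<circ> r) k) (from_nat_into A n))"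
      by (auto simp: convergent_def comp_def)
  qed
  have "convergent (\<lambda>k. f (diagseq k) (from_nat_into A n))" for n
  proof -
    \<comment> \<open>The diagonal follows the stage that handles index \<open>n\<close> only from
      \<open>Suc n\<close> on, hence the shift.\<close>
    have "convergent (\<lambda>k. f ((diagseq \<circ> ((+) (Suc n))) k) (from_nat_into A n))"
    proof (rule diagseq_holds)
      fix m and s r :: "nat \<Rightarrow> nat"
      assume "strict_mono r" "convergent (\<lambda>k. f (s k) (from_nat_into A m))"
      then show "convergent (\<lambda>k. f ((s \<circ> r) k) (from_nat_into A m))"
        using convergent_subseq_convergent[of "\<lambda>k. f (s k) (from_nat_into A m)" r] by (simp add: comp_def)
    qed
    then have "convergent (\<lambda>k. f (diagseq (k + Suc n)) (from_nat_into A n))"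
      by (simp add: comp_def add.commute)
    then show ?thesis by (rule convergent_ignore_initial_segment[THEN iffD1])
  qed
  then show ?thesis
    using subseq_diagseq \<open>countable A\<close> by (metis from_nat_into_surj)
qed

definition cylinder :: "'i set \<Rightarrow> nat \<Rightarrow> 'i set \<Rightarrow> ('i \<Rightarrow> nat) \<Rightarrow> ('i \<Rightarrow> nat) set" where
  "cylinder I D J a = {\<omega> \<in> I \<rightarrow>\<^sub>E {..<D}. \<forall>i\<in>J. \<omega> i = a i}"

lemma cylinder_eq_emb:
  assumes "J \<subseteq> I" "a \<in> J \<rightarrow>\<^sub>E {..<D}"
  shows "cylinder I D J a = prod_emb I (\<lambda>_. count_space {..<D}) J {a}"
  using assms unfolding cylinder_def prod_emb_def
  by (auto simp: space_PiM fun_eq_iff PiE_def extensional_def restrict_def)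

lemma sets_cylinder:
  assumes "finite J" "J \<subseteq> I"
  shows "cylinder I D J a \<in> sets (PiM I (\<lambda>_. count_space {..<D}))"
proof -
  have "cylinder I D J a = {\<omega> \<in> space (PiM I (\<lambda>_. count_space {..<D})). \<forall>i\<in>J. \<omega> i = a i}"
    by (simp add: cylinder_def space_PiM)
  also have "\<dots> \<in> sets (PiM I (\<lambda>_. count_space {..<D}))"
  proof (rule sets.sets_Collect_finite_All)
    fix i assume "i \<in> J"
    then have "(\<lambda>\<omega>. \<omega> i) \<in> measurable (PiM I (\<lambda>_. count_space {..<D})) (count_space {..<D})"
      using assms by (intro measurable_component_singleton) auto
    then have "(\<lambda>\<omega>. \<omega> i = a i) \<in> measurable (PiM I (\<lambda>_. count_space {..<D})) (count_space UNIV)"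
      by (rule measurable_compose) simp
    then show "{\<omega> \<in> space (PiM I (\<lambda>_. count_space {..<D})). \<omega> i = a i} \<in> sets (PiM I (\<lambda>_. count_space {..<D}))"
      by (simp add: pred_def)
  qed (use assms in auto)
  finally show ?thesis .
qed

text \<open>With finitely many values every finite-dimensional box is a finite disjoint union of
  cylinders, so agreement on cylinders determines the law.\<close>

lemma finite_valued_process_eqI:
  fixes P Q :: "('i \<Rightarrow> nat) measure"
  assumes sets: "sets P = sets (PiM I (\<lambda>_. count_space {..<D}))" "sets Q = sets (PiM I (\<lambda>_. count_space {..<D}))"
    and fin: "finite_measure P"
    and eq: "\<And>J a. finite J \<Longrightarrow> J \<subseteq> I \<Longrightarrow> a \<in> J \<rightarrow>\<^sub>E {..<D} \<Longrightarrow>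
      emeasure P (cylinder I D J a) = emeasure Q (cylinder I D J a)"
  shows "P = Q"
proof (rule measure_eqI_PiM_infinite[OF sets _ fin])
  fix A J assume J: "finite J" "J \<subseteq> I" and A: "\<And>i. i \<in> J \<Longrightarrow> A i \<in> sets (count_space {..<D})"
  define S where "S = (PiE J A :: ('i \<Rightarrow> nat) set)"
  have S: "S \<subseteq> J \<rightarrow>\<^sub>E {..<D}" unfolding S_def using A by (intro PiE_mono) auto
  have finS: "finite S"
    by (rule finite_subset[OF S]) (intro finite_PiE J, simp)
  have dec: "prod_emb I (\<lambda>_. count_space {..<D}) J S = (\<Union>a\<in>S. cylinder I D J a)"
  proof -
    have "(\<Union>a\<in>S. cylinder I D J a) = (\<Union>a\<in>S. prod_emb I (\<lambda>_. count_space {..<D}) J {a})"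
      using S J(2) by (intro SUP_cong refl cylinder_eq_emb) auto
    then show ?thesis by (auto simp: prod_emb_def)
  qed
  have disj: "disjoint_family_on (cylinder I D J) S"
    unfolding disjoint_family_on_def
  proof safe
    fix a b x assume "a \<in> S" "b \<in> S" "x \<in> cylinder I D J a" "x \<in> cylinder I D J b"
    moreover from this have "a \<in> extensional J" "b \<in> extensional J"
      using S by (auto simp: PiE_def)
    ultimately have "a = b"
      by (intro extensionalityI[of a J b]) (auto simp: cylinder_def)
    moreover assume "a \<noteq> b"
    ultimately show "x \<in> {}" by auto
  qed
  have "emeasure M (prod_emb I (\<lambda>_. count_space {..<D}) J S) = (\<Sum>a\<in>S. emeasure M (cylinder I D J a))"
    if "sets M = sets (PiM I (\<lambda>_. count_space {..<D}))" for M
    unfolding dec using finS disj sets_cylinder[OF J] that by (intro sum_emeasure[symmetric]) auto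
  then show "emeasure P (prod_emb I (\<lambda>_. count_space {..<D}) J (PiE J A)) =
    emeasure Q (prod_emb I (\<lambda>_. count_space {..<D}) J (PiE J A))"
    unfolding S_def[symmetric] using sets S J by (auto intro!: sum.cong eq)
qed

text \<open>The projective limit lives on a Polish state space: the finite laws are pushed to real
  coordinates, and the limit is rounded back. Consistency then only has to be checked for mass
  functions on finite windows.\<close>

theorem finite_valued_kolmogorov:
  fixes L :: "'i set \<Rightarrow> ('i \<Rightarrow> nat) \<Rightarrow> real"
  assumes D: "D \<ge> 1" and nonneg: "\<And>J a. 0 \<le> L J a"
    and one: "L {} (\<lambda>_. undefined) = 1"
    and cons: "\<And>J H a. J \<subseteq> H \<Longrightarrow> finite H \<Longrightarrow> H \<subseteq> I \<Longrightarrow> a \<in> J \<rightarrow>\<^sub>E {..<D} \<Longrightarrow>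
      L J a = (\<Sum>b\<in>{b \<in> H \<rightarrow>\<^sub>E {..<D}. restrict b J = a}. L H b)"
  shows "\<exists>P. prob_space P \<and> sets P = sets (PiM I (\<lambda>_. count_space {..<D})) \<and>
    (\<forall>J a. finite J \<longrightarrow> J \<subseteq> I \<longrightarrow> a \<in> J \<rightarrow>\<^sub>E {..<D} \<longrightarrow> measure P (cylinder I D J a) = L J a)"
proof -
  define E where "E J = (J \<rightarrow>\<^sub>E {..<D} :: ('i \<Rightarrow> nat) set)" for J
  have finE: "finite (E J)" if "finite J" for J
    using that unfolding E_def by (intro finite_PiE) auto
  define pm where "pm J = embed_pmf (\<lambda>a. if a \<in> E J then L J a else 0)" for J
  have pm: "pmf (pm J) a = (if a \<in> E J then L J a else 0)" if J: "finite J" "J \<subseteq> I" for J a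
    unfolding pm_def
  proof (rule pmf_embed_pmf)
    \<comment> \<open>Consistency with the empty window, whose only assignment is
      \<open>\<lambda>_. undefined\<close>.\<close>
    have "(\<Sum>a\<in>E J. L J a) = 1"
      using cons[of "{}" J "\<lambda>_. undefined"] J one by (simp add: E_def restrict_def)
    then have "(\<Sum>a\<in>E J. ennreal (L J a)) = 1"
      using nonneg by (subst sum_ennreal) auto
    moreover have "(\<integral>\<^sup>+a. ennreal (if a \<in> E J then L J a else 0) \<partial>count_space UNIV) = (\<Sum>a\<in>E J. ennreal (L J a))"
      using finE[OF J(1)] by (subst nn_integral_count_space'[where A="E J"]) auto
    ultimately show "(\<integral>\<^sup>+a. ennreal (if a \<in> E J then L J a else 0) \<partial>count_space UNIV) = 1" by simp
  qed (use nonneg in auto)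
  have supp: "set_pmf (pm J) \<subseteq> E J" if "finite J" "J \<subseteq> I" for J
    using pm[OF that] by (auto simp: set_pmf_eq split: if_splits)
  have proj: "map_pmf (\<lambda>b. restrict b J) (pm H) = pm J" if JH: "J \<subseteq> H" "finite H" "H \<subseteq> I" for J H
  proof (rule pmf_eqI)
    fix a
    have J: "finite J" "J \<subseteq> I" using JH finite_subset by auto
    have "pmf (map_pmf (\<lambda>b. restrict b J) (pm H)) a = measure (pm H) ((\<lambda>b. restrict b J) -` {a})"
      by (rule pmf_map)
    also have "\<dots> = measure (pm H) {b \<in> E H. restrict b J = a}"
      using supp[OF JH(2,3)] by (intro measure_pmf.finite_measure_eq_AE) (auto simp: AE_measure_pmf_iff)
    also have "\<dots> = (\<Sum>b\<in>{b \<in> E H. restrict b J = a}. pmf (pm H) b)"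
      using finE[OF JH(2)] by (intro measure_measure_pmf_finite) auto
    also have "\<dots> = (\<Sum>b\<in>{b \<in> E H. restrict b J = a}. L H b)"
      using JH by (intro sum.cong) (auto simp: pm)
    also have "\<dots> = pmf (pm J) a"
    proof (cases "a \<in> E J")
      case True
      then show ?thesis using cons[OF JH, of a] J by (simp add: pm E_def)
    next
      case False
      then have "{b \<in> E H. restrict b J = a} = {}" using JH by (auto simp: E_def)
      then show ?thesis using False J by (simp only: pm[OF J] sum.empty if_False)
    qed
    finally show "pmf (map_pmf (\<lambda>b. restrict b J) (pm H)) a = pmf (pm J) a" .
  qed
  define PP where "PP J = distr (pm J) (PiM J (\<lambda>_. borel)) (\<lambda>a. \<lambda>i\<in>J. real (a i))" for J
  have meas[simp]: "(\<lambda>a. \<lambda>i\<in>J. real (a i)) \<in> measurable (measure_pmf M) (PiM J (\<lambda>_. borel))" for J M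
    by (intro measurable_restrict) simp
  interpret polish_projective I PP
  proof (intro polish_projective.intro projective_family.intro)
    fix J H assume JH: "J \<subseteq> H" "finite H" "H \<subseteq> I"
    have "distr (PP H) (PiM J (\<lambda>_. borel)) (\<lambda>f. restrict f J) =
      distr (pm H) (PiM J (\<lambda>_. borel)) ((\<lambda>f. restrict f J) \<circ> (\<lambda>a. \<lambda>i\<in>H. real (a i)))"
      unfolding PP_def by (rule distr_distr[OF measurable_restrict_subset[OF JH(1)] meas])
    also have "(\<lambda>f. restrict f J) \<circ> (\<lambda>a. \<lambda>i\<in>H. real (a i)) = (\<lambda>a. \<lambda>i\<in>J. real (a i)) \<circ> (\<lambda>b. restrict b J)"
      using JH by (auto simp: fun_eq_iff restrict_def)
    also have "distr (pm H) (PiM J (\<lambda>_. borel)) \<dots> =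
       distr (distr (pm H) (count_space UNIV) (\<lambda>b. restrict b J)) (PiM J (\<lambda>_. borel)) (\<lambda>a. \<lambda>i\<in>J. real (a i))"
      by (rule distr_distr[symmetric]) (intro measurable_restrict, auto)
    also have "distr (pm H) (count_space UNIV) (\<lambda>b. restrict b J) = measure_pmf (pm J)"
      by (simp add: proj[OF JH, symmetric] map_pmf_rep_eq)
    finally show "PP J = distr (PP H) (PiM J (\<lambda>_. borel)) (\<lambda>f. restrict f J)"
      unfolding PP_def[of J] by (rule sym)
  next
    fix J assume "finite J" "J \<subseteq> I"
    show "prob_space (PP J)" unfolding PP_def by (intro measure_pmf.prob_space_distr meas)
  qed
  \<comment> \<open>Truncation at \<open>D - 1\<close> puts every coordinate into
    \<open>{..<D}\<close> everywhere, not just almost surely. On the values 0 to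
    \<open>D - 1\<close> the rounding is the identity.\<close>
  define rnd where "rnd x = min (D - 1) (nat \<lfloor>x\<rfloor>)" for x :: real
  have rnd[measurable]: "rnd \<in> measurable borel (count_space UNIV)" unfolding rnd_def by measurable
  have rndD: "rnd x < D" for x using D by (auto simp: rnd_def)
  have rndm: "rnd \<in> measurable borel (count_space {..<D})"
    using measurable_restrict_space2[OF _ rnd, of "{..<D}"] rndD by (simp add: restrict_count_space)
  define P where "P = distr lim (PiM I (\<lambda>_. count_space {..<D})) (\<lambda>\<omega>. \<lambda>i\<in>I. rnd (\<omega> i))"
  have Pm[measurable]: "(\<lambda>\<omega>. \<lambda>i\<in>I. rnd (\<omega> i)) \<in> measurable lim (PiM I (\<lambda>_. count_space {..<D}))"
    by (subst measurable_cong_sets[OF sets_lim refl])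
       (intro measurable_restrict measurable_compose[OF _ rndm] measurable_component_singleton)
  interpret P': prob_space P unfolding P_def by (intro P.prob_space_distr Pm)
  have "measure P (cylinder I D J a) = L J a" if J: "finite J" "J \<subseteq> I" and a: "a \<in> J \<rightarrow>\<^sub>E {..<D}" for J a
  proof -
    define B where "B = {x \<in> space (PiM J (\<lambda>_. borel)). \<forall>i\<in>J. rnd (x i) = a i}"
    have B[measurable]: "B \<in> sets (PiM J (\<lambda>_. borel))"
      unfolding B_def
    proof (rule sets.sets_Collect_finite_All[OF _ J(1)])
      fix i assume [measurable]: "i \<in> J"
      show "{x \<in> space (PiM J (\<lambda>_. borel)). rnd (x i) = a i} \<in> sets (PiM J (\<lambda>_. borel))"
        by measurable
    qed
    have "emeasure P (cylinder I D J a) = emeasure lim ((\<lambda>\<omega>. \<lambda>i\<in>I. rnd (\<omega> i)) -` cylinder I D J a \<inter> space lim)"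
      unfolding P_def using J by (intro emeasure_distr Pm sets_cylinder)
    also have "(\<lambda>\<omega>. \<lambda>i\<in>I. rnd (\<omega> i)) -` cylinder I D J a \<inter> space lim = emb I J B"
      using J rndD by (auto simp: cylinder_def prod_emb_def B_def space_PiM subset_eq)
    also have "emeasure lim (emb I J B) = PP J B"
      using J B by (intro emeasure_lim_emb) auto
    also have "\<dots> = emeasure (pm J) ((\<lambda>a. \<lambda>i\<in>J. real (a i)) -` B)"
      unfolding PP_def by (simp add: emeasure_distr[OF meas B])
    also have "\<dots> = emeasure (pm J) {a}"
    proof (rule emeasure_eq_AE)
      have "b \<in> (\<lambda>a. \<lambda>i\<in>J. real (a i)) -` B \<longleftrightarrow> b \<in> {a}" if "b \<in> set_pmf (pm J)" for b
      proof -
        have b: "b \<in> J \<rightarrow>\<^sub>E {..<D}" using supp[OF J] that by (auto simp: E_def)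
        then have "rnd (real (b i)) = b i" if "i \<in> J" for i
          using that by (auto simp: rnd_def PiE_iff)
        then show ?thesis using a b by (auto simp: B_def space_PiM fun_eq_iff PiE_def extensional_def)
      qed
      then show "AE x in pm J. (x \<in> (\<lambda>a. \<lambda>i\<in>J. real (a i)) -` B) = (x \<in> {a})"
        by (auto simp: AE_measure_pmf_iff)
    qed auto
    also have "\<dots> = ennreal (L J a)"
      using a J by (simp add: emeasure_pmf_single pm E_def)
    finally show ?thesis using nonneg by (simp add: P'.emeasure_eq_measure)
  qed
  then show ?thesis
    using P'.prob_space_axioms by (intro exI[of _ P]) (auto simp: P_def)
qed

section \<open>Limits of sampled arrays\<close>

definition comp_tuple :: "nat \<Rightarrow> ('v \<Rightarrow> 'w) \<Rightarrow> (nat \<Rightarrow> 'v) \<Rightarrow> nat \<Rightarrow> 'w" where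
  "comp_tuple r \<tau> e = (\<lambda>j\<in>{..<r}. \<tau> (e j))"

definition all_tuples :: "nat \<Rightarrow> (nat \<Rightarrow> 'v) set" where
  "all_tuples r = {..<r} \<rightarrow>\<^sub>E UNIV"

lemma comp_tuple_in[simp, intro]: "comp_tuple r \<tau> e \<in> all_tuples r"
  by (auto simp: comp_tuple_def all_tuples_def)

lemma comp_tuple_apply[simp]: "j < r \<Longrightarrow> comp_tuple r \<tau> e j = \<tau> (e j)"
  by (simp add: comp_tuple_def)

lemma comp_tuple_comp: "comp_tuple r \<sigma> (comp_tuple r \<tau> e) = comp_tuple r (\<lambda>v. \<sigma> (\<tau> v)) e"
  by (auto simp: comp_tuple_def)

lemma comp_tuple_cong: "(\<And>j. j < r \<Longrightarrow> \<tau> (e j) = \<sigma> (f j)) \<Longrightarrow> comp_tuple r \<tau> e = comp_tuple r \<sigma> f"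
  by (auto simp: comp_tuple_def)

lemma comp_tuple_id: "e \<in> all_tuples r \<Longrightarrow> comp_tuple r (\<lambda>v. v) e = e"
  by (auto simp: comp_tuple_def all_tuples_def PiE_def extensional_def fun_eq_iff)

lemma inj_on_comp_tuple:
  assumes "inj \<tau>" shows "inj_on (comp_tuple r \<tau>) (all_tuples r)"
proof (rule inj_onI)
  fix e f :: "nat \<Rightarrow> _" assume "e \<in> all_tuples r" "f \<in> all_tuples r" and eq: "comp_tuple r \<tau> e = comp_tuple r \<tau> f"
  moreover have "e j = f j" if "j < r" for j
    using fun_cong[OF eq, of j] that assms by (auto dest: injD)
  ultimately show "e = f"
    by (auto simp: all_tuples_def PiE_def extensional_def fun_eq_iff) (metis lessThan_iff)
qed

lemma countable_all_tuples: "countable (all_tuples r :: (nat \<Rightarrow> 'v::countable) set)"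
  unfolding all_tuples_def by (intro countable_PiE) auto

text \<open>Sampling is with replacement: \<open>hom_density\<close> runs over all maps, and i.i.d.
  labels make the sampled array exchangeable for every \<open>n\<close>.\<close>

definition vertex_sampling :: "nat \<Rightarrow> ('v \<Rightarrow> nat) measure" where
  "vertex_sampling n = PiM UNIV (\<lambda>_. measure_pmf (pmf_of_set {..<n}))"

lemma prob_space_vertex_sampling: "prob_space (vertex_sampling n)"
  unfolding vertex_sampling_def by (intro prob_space_PiM measure_pmf.prob_space_axioms)

lemma space_vertex_sampling[simp]: "space (vertex_sampling n) = UNIV"
  by (simp add: vertex_sampling_def space_PiM)

definition sample_event ::
  "nat \<Rightarrow> ((nat \<Rightarrow> nat) \<Rightarrow> nat) \<Rightarrow> (nat \<Rightarrow> 'v) set \<Rightarrow> ((nat \<Rightarrow> 'v) \<Rightarrow> nat) \<Rightarrow> ('v \<Rightarrow> nat) set" where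
  "sample_event r G J a = {\<phi>. \<forall>e\<in>J. G (comp_tuple r \<phi> e) = a e}"

text \<open>A product of finitely many countable discrete spaces is discrete, so \<open>G\<close>
  may be any function.\<close>

lemma measurable_comp_tuple:
  fixes G :: "(nat \<Rightarrow> nat) \<Rightarrow> nat"
  assumes "\<And>j. j < r \<Longrightarrow> e j \<in> V"
  shows "(\<lambda>\<phi>. G (comp_tuple r \<phi> e)) \<in> measurable (PiM V (\<lambda>_. measure_pmf M)) (count_space (UNIV :: nat set))"
proof -
  have "(\<lambda>\<phi>. comp_tuple r \<phi> e) \<in> measurable (PiM V (\<lambda>_. measure_pmf M)) (PiM {..<r} (\<lambda>_. count_space (UNIV :: nat set)))"
    unfolding comp_tuple_def using assms
    by (intro measurable_restrict measurable_compose[OF measurable_component_singleton[of _ V]]) auto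
  also have "PiM {..<r} (\<lambda>_. count_space (UNIV :: nat set)) = count_space (PiE {..<r} (\<lambda>_. UNIV))"
    by (rule count_space_PiM_finite) auto
  finally have "(\<lambda>\<phi>. comp_tuple r \<phi> e) \<in> measurable (PiM V (\<lambda>_. measure_pmf M)) (count_space (PiE {..<r} (\<lambda>_. UNIV)))" .
  from measurable_compose[OF this, of G "count_space UNIV"] show ?thesis by simp
qed

lemma sets_sample_event_gen:
  fixes G :: "(nat \<Rightarrow> nat) \<Rightarrow> nat"
  assumes "finite J" "\<And>e j. e \<in> J \<Longrightarrow> j < r \<Longrightarrow> e j \<in> V"
  shows "{\<phi> \<in> space (PiM V (\<lambda>_. measure_pmf M)). \<forall>e\<in>J. G (comp_tuple r \<phi> e) = a e} \<in> sets (PiM V (\<lambda>_. measure_pmf M))"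
proof (rule sets.sets_Collect_finite_All[OF _ assms(1)])
  fix e assume e: "e \<in> J"
  have [measurable]: "(\<lambda>\<phi>. G (comp_tuple r \<phi> e)) \<in> measurable (PiM V (\<lambda>_. measure_pmf M)) (count_space UNIV)"
    by (rule measurable_comp_tuple) (rule assms(2)[OF e])
  show "{\<phi> \<in> space (PiM V (\<lambda>_. measure_pmf M)). G (comp_tuple r \<phi> e) = a e} \<in> sets (PiM V (\<lambda>_. measure_pmf M))"
    by measurable
qed

lemma sets_sample_event:
  assumes "finite J" shows "sample_event r G J a \<in> sets (vertex_sampling n)"
  using sets_sample_event_gen[OF assms, of r UNIV "pmf_of_set {..<n}" G a]
  by (simp add: sample_event_def vertex_sampling_def space_PiM)

text \<open>Read along an injection, an i.i.d. family is again i.i.d. with the same law.\<close>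

lemma sample_event_relabel:
  assumes \<tau>: "inj \<tau>" and J: "finite J"
  shows "measure (vertex_sampling n) {\<phi>. \<forall>e\<in>J. G (comp_tuple r \<phi> (comp_tuple r \<tau> e)) = a e}
    = measure (vertex_sampling n) (sample_event r G J a)"
proof -
  have inv: "distr (vertex_sampling n) (vertex_sampling n) (\<lambda>\<phi>. \<lambda>v\<in>UNIV. \<phi> (\<tau> v)) = vertex_sampling n"
    unfolding vertex_sampling_def
    by (rule distr_PiM_reindex) (use \<tau> in \<open>auto intro: measure_pmf.prob_space_axioms\<close>)
  have "measure (vertex_sampling n) (sample_event r G J a) =
    measure (distr (vertex_sampling n) (vertex_sampling n) (\<lambda>\<phi>. \<lambda>v\<in>UNIV. \<phi> (\<tau> v))) (sample_event r G J a)"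
    by (simp only: inv)
  also have "\<dots> = measure (vertex_sampling n) ((\<lambda>\<phi>. \<lambda>v\<in>UNIV. \<phi> (\<tau> v)) -` sample_event r G J a \<inter> space (vertex_sampling n))"
  proof (rule measure_distr)
    show "(\<lambda>\<phi>. \<lambda>v\<in>UNIV. \<phi> (\<tau> v)) \<in> vertex_sampling n \<rightarrow>\<^sub>M vertex_sampling n"
      unfolding vertex_sampling_def by (intro measurable_restrict measurable_component_singleton) auto
  qed (rule sets_sample_event[OF J])
  also have "(\<lambda>\<phi>. \<lambda>v\<in>UNIV. \<phi> (\<tau> v)) -` sample_event r G J a \<inter> space (vertex_sampling n)
     = {\<phi>. \<forall>e\<in>J. G (comp_tuple r \<phi> (comp_tuple r \<tau> e)) = a e}"
    by (auto simp: sample_event_def comp_tuple_comp restrict_UNIV)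
  finally show ?thesis by simp
qed

text \<open>The two events read disjoint sets of independent labels. This is the source of
  dissociation.\<close>

lemma sample_event_indep:
  fixes J K :: "(nat \<Rightarrow> 'v) set"
  assumes J: "finite J" "finite K"
    and disj: "(\<Union>e\<in>J. e ` {..<r}) \<inter> (\<Union>e\<in>K. e ` {..<r}) = {}"
  shows "measure (vertex_sampling n) (sample_event r G J a \<inter> sample_event r G K b) =
    measure (vertex_sampling n) (sample_event r G J a) * measure (vertex_sampling n) (sample_event r G K b)"
proof -
  let ?M = "\<lambda>_::'v. measure_pmf (pmf_of_set {..<n})"
  let ?P = "PiM UNIV ?M"
  interpret prob_space ?P by (intro prob_space_PiM measure_pmf.prob_space_axioms)
  have "indep_vars ?M (\<lambda>v \<phi>. \<phi> v) UNIV"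
  proof (subst indep_vars_iff_distr_eq_PiM)
    show "(\<lambda>\<phi>. \<phi> v) \<in> measurable ?P (?M v)" for v by simp
    have "distr ?P (?M v) (\<lambda>\<phi>. \<phi> v) = ?M v" for v
      by (rule distr_PiM_component) (auto intro: measure_pmf.prob_space_axioms)
    then show "distr ?P ?P (\<lambda>x. \<lambda>i\<in>UNIV. x i) = PiM UNIV (\<lambda>v. distr ?P (?M v) (\<lambda>\<phi>. \<phi> v))"
      by (simp add: restrict_UNIV distr_id2)
  qed simp
  define VJ where "VJ = (\<Union>e\<in>J. e ` {..<r})"
  define VK where "VK = (\<Union>e\<in>K. e ` {..<r})"
  have ind: "indep_var (PiM VJ ?M) (\<lambda>\<phi>. restrict (\<lambda>v. \<phi> v) VJ) (PiM VK ?M) (\<lambda>\<phi>. restrict (\<lambda>v. \<phi> v) VK)"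
    using \<open>indep_vars ?M (\<lambda>v \<phi>. \<phi> v) UNIV\<close> disj
    by (intro indep_var_restrict) (auto simp: VJ_def VK_def)
  define A where "A = {\<phi> \<in> space (PiM VJ ?M). \<forall>e\<in>J. G (comp_tuple r \<phi> e) = a e}"
  define B where "B = {\<phi> \<in> space (PiM VK ?M). \<forall>e\<in>K. G (comp_tuple r \<phi> e) = b e}"
  have sets: "A \<in> sets (PiM VJ ?M)" "B \<in> sets (PiM VK ?M)"
    unfolding A_def B_def using J by (auto intro!: sets_sample_event_gen simp: VJ_def VK_def)
  have restr: "comp_tuple r (restrict \<phi> V) e = comp_tuple r \<phi> e" if "\<And>j. j < r \<Longrightarrow> e j \<in> V" for V and e :: "nat \<Rightarrow> 'v" and \<phi> :: "'v \<Rightarrow> nat"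
    using that by (intro comp_tuple_cong) auto
  have "comp_tuple r (restrict \<phi> VJ) e = comp_tuple r \<phi> e" if "e \<in> J" for e and \<phi> :: "'v \<Rightarrow> nat"
    using that by (intro restr) (auto simp: VJ_def)
  then have "(\<forall>e\<in>J. G (comp_tuple r (restrict \<phi> VJ) e) = a e) \<longleftrightarrow> (\<forall>e\<in>J. G (comp_tuple r \<phi> e) = a e)" for \<phi>
    by (intro ball_cong refl) simp
  then have 1: "(\<lambda>\<phi>. restrict (\<lambda>v. \<phi> v) VJ) -` A \<inter> space ?P = sample_event r G J a"
    by (auto simp: A_def sample_event_def space_PiM)
  have "comp_tuple r (restrict \<phi> VK) e = comp_tuple r \<phi> e" if "e \<in> K" for e and \<phi> :: "'v \<Rightarrow> nat"
    using that by (intro restr) (auto simp: VK_def)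
  then have "(\<forall>e\<in>K. G (comp_tuple r (restrict \<phi> VK) e) = b e) \<longleftrightarrow> (\<forall>e\<in>K. G (comp_tuple r \<phi> e) = b e)" for \<phi>
    by (intro ball_cong refl) simp
  then have 2: "(\<lambda>\<phi>. restrict (\<lambda>v. \<phi> v) VK) -` B \<inter> space ?P = sample_event r G K b"
    by (auto simp: B_def sample_event_def space_PiM)
  have "prob ((\<lambda>\<phi>. (restrict (\<lambda>v. \<phi> v) VJ, restrict (\<lambda>v. \<phi> v) VK)) -` (A \<times> B) \<inter> space ?P) =
    prob (sample_event r G J a) * prob (sample_event r G K b)"
    using indep_varD[OF ind sets] by (simp only: 1 2)
  also have "(\<lambda>\<phi>. (restrict (\<lambda>v. \<phi> v) VJ, restrict (\<lambda>v. \<phi> v) VK)) -` (A \<times> B) \<inter> space ?P =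
     sample_event r G J a \<inter> sample_event r G K b"
    by (subst 1[symmetric], subst 2[symmetric]) auto
  finally show ?thesis by (simp add: vertex_sampling_def)
qed

text \<open>Invariance is required under all injections and not just permutations, because the map
  \<open>push\<close> below is not surjective. Dissociation is stated on cylinders, the form in
  which it passes to limits of window probabilities.\<close>

locale exchangeable_process = prob_space P
  for P :: "((nat \<Rightarrow> 'v::countable) \<Rightarrow> nat) measure" +
  fixes r D :: nat
  assumes r_pos: "r \<ge> 1" and D_pos: "D \<ge> 1"
    and sets_P: "sets P = sets (PiM (all_tuples r) (\<lambda>_. count_space {..<D}))"
    and exchangeable: "\<And>\<tau>. inj \<tau> \<Longrightarrow>
      distr P (PiM (all_tuples r) (\<lambda>_. count_space {..<D})) (\<lambda>\<omega>. \<lambda>e\<in>all_tuples r. \<omega> (comp_tuple r \<tau> e)) = P"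
    and dissociated: "\<And>J K a b. finite J \<Longrightarrow> finite K \<Longrightarrow> J \<subseteq> all_tuples r \<Longrightarrow> K \<subseteq> all_tuples r \<Longrightarrow>
      a \<in> J \<rightarrow>\<^sub>E {..<D} \<Longrightarrow> b \<in> K \<rightarrow>\<^sub>E {..<D} \<Longrightarrow>
      (\<Union>e\<in>J. e ` {..<r}) \<inter> (\<Union>e\<in>K. e ` {..<r}) = {} \<Longrightarrow>
      prob (cylinder (all_tuples r) D J a \<inter> cylinder (all_tuples r) D K b) =
      prob (cylinder (all_tuples r) D J a) * prob (cylinder (all_tuples r) D K b)"

text \<open>There are only countably many finite windows with prescribed values, so one subsequence
  makes all their probabilities converge. Consistency, exchangeability and dissociation are
  equations between finitely many such probabilities and survive the limit.\<close>

theorem sampling_limit_process: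
  fixes N :: "nat \<Rightarrow> nat" and G :: "nat \<Rightarrow> (nat \<Rightarrow> nat) \<Rightarrow> nat"
  assumes r: "r \<ge> 1" and GD: "\<And>n e. G n e < D"
  shows "\<exists>s P. strict_mono s \<and> exchangeable_process (P :: ((nat \<Rightarrow> 'v::countable) \<Rightarrow> nat) measure) r D \<and>
    (\<forall>J a. finite J \<longrightarrow> J \<subseteq> all_tuples r \<longrightarrow> a \<in> J \<rightarrow>\<^sub>E {..<D} \<longrightarrow>
      (\<lambda>k. measure (vertex_sampling (N (s k))) (sample_event r (G (s k)) J a))
        \<longlonglongrightarrow> measure P (cylinder (all_tuples r) D J a))"
proof -
  let ?I = "all_tuples r :: (nat \<Rightarrow> 'v) set"
  have D: "D \<ge> 1" using GD[of 0 "\<lambda>_. 0"] by simp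
  define p where "p n J a = measure (vertex_sampling (N n)) (sample_event r (G n) J a)" for n and J :: "(nat \<Rightarrow> 'v) set" and a
  have p01: "0 \<le> p n J a" "p n J a \<le> 1" for n J a
    using prob_space.prob_le_1[OF prob_space_vertex_sampling] by (auto simp: p_def)
  define T where "T = (SIGMA J:{J. finite J \<and> J \<subseteq> ?I}. J \<rightarrow>\<^sub>E {..<D})"
  have "countable T" unfolding T_def
    by (intro countable_SIGMA countable_Collect_finite_subset countable_all_tuples)
       (auto intro!: countable_PiE)
  moreover have "\<bar>p n (fst x) (snd x)\<bar> \<le> 1" for n x using p01[of n "fst x" "snd x"] by simp
  ultimately obtain s where s: "strict_mono s" and conv: "\<forall>x\<in>T. convergent (\<lambda>k. p (s k) (fst x) (snd x))"
    using simultaneous_convergent_subseq[of T "\<lambda>n x. p n (fst x) (snd x)" 1] by blast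
  \<comment> \<open>The value 0 off the meaningful arguments makes \<open>L\<close> nonnegative
    everywhere, as the extension theorem demands.\<close>
  define L where "L J a = (if finite J \<and> J \<subseteq> ?I \<and> a \<in> J \<rightarrow>\<^sub>E {..<D} then lim (\<lambda>k. p (s k) J a) else 0)" for J a
  have lim: "(\<lambda>k. p (s k) J a) \<longlonglongrightarrow> L J a" if "finite J" "J \<subseteq> ?I" "a \<in> J \<rightarrow>\<^sub>E {..<D}" for J a
    using bspec[OF conv, of "(J, a)"] that by (auto simp: T_def L_def convergent_LIMSEQ_iff)
  have nonneg: "0 \<le> L J a" for J a
  proof (cases "finite J \<and> J \<subseteq> ?I \<and> a \<in> J \<rightarrow>\<^sub>E {..<D}")
    case True
    then show ?thesis by (intro LIMSEQ_le_const[OF lim]) (use p01 in auto)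
  next
    case False
    then have "L J a = 0" unfolding L_def by (rule if_not_P)
    then show ?thesis by simp
  qed
  have one: "L {} (\<lambda>_. undefined) = 1"
  proof (rule LIMSEQ_unique[OF lim])
    have "p n {} (\<lambda>_. undefined) = 1" for n
      using prob_space.prob_space[OF prob_space_vertex_sampling[of "N n"]] by (simp add: p_def sample_event_def)
    then show "(\<lambda>k. p (s k) {} (\<lambda>_. undefined)) \<longlonglongrightarrow> 1" by simp
  qed auto
  have pcons: "p n J a = (\<Sum>b\<in>{b \<in> H \<rightarrow>\<^sub>E {..<D}. restrict b J = a}. p n H b)"
    if "J \<subseteq> H" "finite H" "a \<in> J \<rightarrow>\<^sub>E {..<D}" for n J H a
  proof -
    interpret prob_space "vertex_sampling (N n) :: ('v \<Rightarrow> nat) measure" by (rule prob_space_vertex_sampling)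
    let ?B = "{b \<in> H \<rightarrow>\<^sub>E {..<D}. restrict b J = a}"
    have fin: "finite ?B" using that by (auto intro!: finite_subset[OF _ finite_PiE[of H "\<lambda>_. {..<D}"]])
    have "sample_event r (G n) J a = (\<Union>b\<in>?B. sample_event r (G n) H b)"
    proof (intro equalityI subsetI)
      fix \<phi> :: "'v \<Rightarrow> nat" assume \<phi>: "\<phi> \<in> sample_event r (G n) J a"
      define b where "b = (\<lambda>e\<in>H. G n (comp_tuple r \<phi> e))"
      have "restrict b J = a"
      proof (rule extensionalityI[of _ J])
        show "restrict b J e = a e" if "e \<in> J" for e
          using that \<phi> \<open>J \<subseteq> H\<close> by (auto simp: b_def sample_event_def)
      qed (use that in \<open>auto simp: PiE_def\<close>)
      then have "b \<in> ?B" by (auto simp: b_def GD)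
      moreover have "\<phi> \<in> sample_event r (G n) H b" by (simp add: b_def sample_event_def)
      ultimately show "\<phi> \<in> (\<Union>b\<in>?B. sample_event r (G n) H b)" by blast
    next
      fix \<phi> :: "'v \<Rightarrow> nat" assume "\<phi> \<in> (\<Union>b\<in>?B. sample_event r (G n) H b)"
      then show "\<phi> \<in> sample_event r (G n) J a"
        using \<open>J \<subseteq> H\<close> by (auto simp: sample_event_def)
    qed
    moreover have "disjoint_family_on (sample_event r (G n) H) ?B"
      unfolding disjoint_family_on_def
    proof safe
      fix b c and \<phi> :: "'v \<Rightarrow> nat" assume bc: "b \<in> H \<rightarrow>\<^sub>E {..<D}" "c \<in> H \<rightarrow>\<^sub>E {..<D}" "b \<noteq> c"
        and "\<phi> \<in> sample_event r (G n) H b" "\<phi> \<in> sample_event r (G n) H c"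
      then have "b = c" by (intro extensionalityI[of b H c]) (auto simp: sample_event_def PiE_def)
      with bc show "\<phi> \<in> {}" by simp
    qed
    ultimately show ?thesis
      unfolding p_def using fin that(2) by (auto intro!: finite_measure_finite_Union sets_sample_event)
  qed
  have cons: "L J a = (\<Sum>b\<in>{b \<in> H \<rightarrow>\<^sub>E {..<D}. restrict b J = a}. L H b)"
    if that': "J \<subseteq> H" "finite H" "H \<subseteq> ?I" "a \<in> J \<rightarrow>\<^sub>E {..<D}" for J H a
  proof (rule LIMSEQ_unique)
    show "(\<lambda>k. p (s k) J a) \<longlonglongrightarrow> L J a"
      using that finite_subset by (intro lim) auto
    have "(\<lambda>k. \<Sum>b\<in>{b \<in> H \<rightarrow>\<^sub>E {..<D}. restrict b J = a}. p (s k) H b) \<longlonglongrightarrow>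
      (\<Sum>b\<in>{b \<in> H \<rightarrow>\<^sub>E {..<D}. restrict b J = a}. L H b)"
      using that by (intro tendsto_sum lim) auto
    then show "(\<lambda>k. p (s k) J a) \<longlonglongrightarrow> (\<Sum>b\<in>{b \<in> H \<rightarrow>\<^sub>E {..<D}. restrict b J = a}. L H b)"
      by (simp only: pcons[OF that'(1,2,4), symmetric])
  qed
  have "\<exists>P. prob_space P \<and> sets P = sets (PiM ?I (\<lambda>_. count_space {..<D})) \<and>
    (\<forall>J a. finite J \<longrightarrow> J \<subseteq> ?I \<longrightarrow> a \<in> J \<rightarrow>\<^sub>E {..<D} \<longrightarrow> measure P (cylinder ?I D J a) = L J a)"
    using D nonneg one cons by (rule finite_valued_kolmogorov)
  then obtain P where P: "prob_space P \<and> sets P = sets (PiM ?I (\<lambda>_. count_space {..<D})) \<and>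
    (\<forall>J a. finite J \<longrightarrow> J \<subseteq> ?I \<longrightarrow> a \<in> J \<rightarrow>\<^sub>E {..<D} \<longrightarrow> measure P (cylinder ?I D J a) = L J a)"
    by (rule exE)
  then have "prob_space P" and sets: "sets P = sets (PiM ?I (\<lambda>_. count_space {..<D}))" and
    PL: "\<And>J a. finite J \<Longrightarrow> J \<subseteq> ?I \<Longrightarrow> a \<in> J \<rightarrow>\<^sub>E {..<D} \<Longrightarrow> measure P (cylinder ?I D J a) = L J a"
    by simp_all
  interpret P: prob_space P by fact
  have sp: "space P = ?I \<rightarrow>\<^sub>E {..<D}" using sets_eq_imp_space_eq[OF sets] by (simp add: space_PiM)
  have "exchangeable_process P r D"
  proof unfold_locales
    fix \<tau> :: "'v \<Rightarrow> 'v" assume \<tau>: "inj \<tau>"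
    let ?f = "\<lambda>\<omega>. \<lambda>e\<in>?I. \<omega> (comp_tuple r \<tau> e)"
    have f: "?f \<in> measurable P (PiM ?I (\<lambda>_. count_space {..<D}))"
      by (subst measurable_cong_sets[OF sets refl])
         (intro measurable_restrict measurable_component_singleton, auto)
    show "distr P (PiM ?I (\<lambda>_. count_space {..<D})) ?f = P"
    proof (rule finite_valued_process_eqI[where I="?I" and D=D])
      show "finite_measure (distr P (PiM ?I (\<lambda>_. count_space {..<D})) ?f)"
        by (intro prob_space.finite_measure P.prob_space_distr f)
      fix J a assume J: "finite J" "J \<subseteq> ?I" and a: "a \<in> J \<rightarrow>\<^sub>E {..<D}"
      \<comment> \<open>The preimage of a cylinder under relabelling is the cylinder over the
        relabelled window \<open>K\<close>. Injectivity of \<open>\<tau>\<close> makes the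
        transported assignment \<open>b\<close> well defined.\<close>
      define K where "K = comp_tuple r \<tau> ` J"
      have inj: "inj_on (comp_tuple r \<tau>) J" using inj_on_comp_tuple[OF \<tau>] J(2) inj_on_subset by blast
      define b where "b = (\<lambda>e\<in>K. a (the_inv_into J (comp_tuple r \<tau>) e))"
      have bJ: "b (comp_tuple r \<tau> e) = a e" if "e \<in> J" for e
        using that inj by (simp add: b_def K_def the_inv_into_f_f)
      have K: "finite K" "K \<subseteq> ?I" using J by (auto simp: K_def)
      have b: "b \<in> K \<rightarrow>\<^sub>E {..<D}"
      proof (rule PiE_I)
        fix e assume "e \<in> K"
        then obtain e' where "e' \<in> J" "e = comp_tuple r \<tau> e'" by (auto simp: K_def)
        then show "b e \<in> {..<D}" using bJ a by auto
      qed (simp add: b_def)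
      have "emeasure (distr P (PiM ?I (\<lambda>_. count_space {..<D})) ?f) (cylinder ?I D J a) =
        emeasure P (?f -` cylinder ?I D J a \<inter> space P)"
        using J by (intro emeasure_distr f sets_cylinder)
      also have "?f -` cylinder ?I D J a \<inter> space P = cylinder ?I D K b"
        using J by (auto simp: cylinder_def sp K_def bJ subset_eq)
      also have "emeasure P \<dots> = L K b"
        using PL[OF K b] by (simp add: P.emeasure_eq_measure)
      also have "L K b = L J a"
      proof (rule LIMSEQ_unique[OF lim[OF K b]])
        have "p n K b = p n J a" for n
        proof -
          have "p n K b = measure (vertex_sampling (N n)) {\<phi>. \<forall>e\<in>J. G n (comp_tuple r \<phi> (comp_tuple r \<tau> e)) = a e}"
            unfolding p_def sample_event_def K_def by (simp add: bJ)
          then show ?thesis unfolding sample_event_relabel[OF \<tau> J(1)] p_def .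
        qed
        then show "(\<lambda>k. p (s k) K b) \<longlonglongrightarrow> L J a" using lim[OF J a] by simp
      qed
      finally show "emeasure (distr P (PiM ?I (\<lambda>_. count_space {..<D})) ?f) (cylinder ?I D J a) = emeasure P (cylinder ?I D J a)"
        by (simp only: P.emeasure_eq_measure PL[OF J a])
    qed (simp_all add: sets)
  next
    fix J K a b assume J: "finite J" "finite K" "J \<subseteq> ?I" "K \<subseteq> ?I" "a \<in> J \<rightarrow>\<^sub>E {..<D}" "b \<in> K \<rightarrow>\<^sub>E {..<D}"
      and disj: "(\<Union>e\<in>J. e ` {..<r}) \<inter> (\<Union>e\<in>K. e ` {..<r}) = {}"
    \<comment> \<open>A common tuple would share its vertex at position 0, which exists since
      \<open>r \<ge> 1\<close>. Disjoint windows allow the two assignments to be glued.\<close>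
    have JK: "J \<inter> K = {}"
    proof (rule ccontr)
      assume "J \<inter> K \<noteq> {}"
      then obtain e where "e \<in> J" "e \<in> K" by auto
      moreover have "e 0 \<in> e ` {..<r}" using r by auto
      ultimately show False using disj by blast
    qed
    define c where "c = (\<lambda>e\<in>J \<union> K. if e \<in> J then a e else b e)"
    have c: "c \<in> (J \<union> K) \<rightarrow>\<^sub>E {..<D}" using J by (auto simp: c_def PiE_iff)
    have cJ: "c e = a e" if "e \<in> J" for e using that by (simp add: c_def)
    have cK: "c e = b e" if "e \<in> K" for e using that JK by (auto simp: c_def)
    have "cylinder ?I D J a \<inter> cylinder ?I D K b = cylinder ?I D (J \<union> K) c"
      by (auto simp: cylinder_def cJ cK)
    then have "measure P (cylinder ?I D J a \<inter> cylinder ?I D K b) = L (J \<union> K) c"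
      using PL[of "J \<union> K" c] J c by simp
    also have "\<dots> = L J a * L K b"
    proof (rule LIMSEQ_unique[OF lim])
      have "p n (J \<union> K) c = p n J a * p n K b" for n
      proof -
        have "sample_event r (G n) (J \<union> K) c = sample_event r (G n) J a \<inter> sample_event r (G n) K b"
          by (auto simp: sample_event_def cJ cK)
        then show ?thesis using sample_event_indep[OF J(1,2) disj] by (simp add: p_def)
      qed
      then show "(\<lambda>k. p (s k) (J \<union> K) c) \<longlonglongrightarrow> L J a * L K b"
        using lim J by (auto intro!: tendsto_mult)
    qed (use J c in auto)
    finally show "measure P (cylinder ?I D J a \<inter> cylinder ?I D K b) = measure P (cylinder ?I D J a) * measure P (cylinder ?I D K b)"
      using PL J by simp
  qed (use r D sets in auto)
  then show ?thesis using s lim PL unfolding p_def by (intro exI[of _ s] exI[of _ P]) auto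
qed

section \<open>Blocks of tuples and their codes\<close>

text \<open>Together with \<open>elem_index S\<close> this is the pair of inverse order isomorphisms
  between \<open>{..<card S}\<close> and a finite set \<open>S\<close>.\<close>

definition nth_elem :: "nat set \<Rightarrow> nat \<Rightarrow> nat" where
  "nth_elem S i = sorted_list_of_set S ! i"

definition elem_index :: "nat set \<Rightarrow> nat \<Rightarrow> nat" where
  "elem_index S s = card {x \<in> S. x < s}"

lemma nth_elem_in: "finite S \<Longrightarrow> i < card S \<Longrightarrow> nth_elem S i \<in> S"
  unfolding nth_elem_def by (metis nth_mem set_sorted_list_of_set length_sorted_list_of_set)

lemma nth_elem_less: "finite S \<Longrightarrow> i < j \<Longrightarrow> j < card S \<Longrightarrow> nth_elem S i < nth_elem S j"
  unfolding nth_elem_def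
  using sorted_wrt_nth_less[OF strict_sorted_list_of_set[of S], of i j] by simp

lemma nth_elem_strict_mono: "finite S \<Longrightarrow> strict_mono_on {..<card S} (nth_elem S)"
  by (auto simp: strict_mono_on_def nth_elem_less)

lemma inj_on_nth_elem: "finite S \<Longrightarrow> inj_on (nth_elem S) {..<card S}"
  using nth_elem_strict_mono strict_mono_on_imp_inj_on by blast

lemma nth_elem_image: "finite S \<Longrightarrow> nth_elem S ` {..<card S} = S"
  by (rule card_subset_eq) (auto simp: nth_elem_in card_image inj_on_nth_elem)

text \<open>Order embeddings commute with the increasing enumeration; the behaviour of codes under
  increasing maps rests on this.\<close>

lemma nth_elem_of_strict_mono_image:
  assumes "finite B" "strict_mono_on B f" "i < card B"
  shows "nth_elem (f ` B) i = f (nth_elem B i)"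
proof -
  have "map f (sorted_list_of_set B) = sorted_list_of_set (f ` B)"
  proof (rule strict_sorted_equal)
    show "sorted_wrt (<) (map f (sorted_list_of_set B))"
      unfolding sorted_wrt_map
      by (rule sorted_wrt_mono_rel[OF _ strict_sorted_list_of_set])
         (use assms in \<open>auto simp: strict_mono_on_def\<close>)
  qed (use assms in auto)
  then show ?thesis
    using assms unfolding nth_elem_def by (metis nth_map length_sorted_list_of_set)
qed

lemma nth_elem_lessThan: "i < k \<Longrightarrow> nth_elem {..<k} i = i"
  unfolding nth_elem_def by (simp add: lessThan_atLeast0)

lemma elem_index_nth_elem:
  assumes "finite S" "i < card S" shows "elem_index S (nth_elem S i) = i"
proof -
  have "{x \<in> S. x < nth_elem S i} = nth_elem S ` {..<i}"
  proof (intro equalityI subsetI)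
    fix x assume x: "x \<in> {x \<in> S. x < nth_elem S i}"
    then obtain j where j: "j < card S" "x = nth_elem S j" using nth_elem_image[OF assms(1)] by auto
    have "\<not> i \<le> j" using x j nth_elem_less[OF assms(1), of i j] by (auto simp: le_less)
    then show "x \<in> nth_elem S ` {..<i}" using j by auto
  qed (use assms nth_elem_in nth_elem_less in auto)
  then show ?thesis
    using inj_on_subset[OF inj_on_nth_elem[OF assms(1)], of "{..<i}"] assms
    by (simp add: elem_index_def card_image)
qed

lemma nth_elem_elem_index: "finite S \<Longrightarrow> s \<in> S \<Longrightarrow> nth_elem S (elem_index S s) = s"
proof -
  assume S: "finite S" "s \<in> S"
  then obtain i where "i < card S" "s = nth_elem S i" using nth_elem_image[of S] by auto
  then show ?thesis using elem_index_nth_elem[OF S(1)] by simp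
qed

lemma elem_index_image: "finite S \<Longrightarrow> elem_index S ` S = {..<card S}"
proof -
  assume S: "finite S"
  have "elem_index S ` S = elem_index S ` nth_elem S ` {..<card S}" by (simp only: nth_elem_image[OF S])
  also have "\<dots> = {..<card S}" using elem_index_nth_elem[OF S] by (force simp: image_image)
  finally show ?thesis .
qed

text \<open>
  Vertices are pairs: \<open>(0, i)\<close> is the actual vertex \<open>i\<close>, and the vertices \<open>(l, i)\<close> with \<open>l > 0\<close> are auxiliary.
  The block of a set \<open>S\<close> of actual vertices consists of the tuples that meet level \<open>0\<close> exactly
  in \<open>S\<close> and otherwise use levels above \<open>card S\<close> only. Reserving level \<open>k\<close> for sets smaller than
  \<open>k\<close> is what makes room for the injection \<open>push\<close> below.
\<close>

definition lift_vertex :: "(nat \<Rightarrow> nat) \<Rightarrow> nat \<times> nat \<Rightarrow> nat \<times> nat" where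
  "lift_vertex f v = (if fst v = 0 then (0, f (snd v)) else v)"

definition block :: "nat \<Rightarrow> nat \<Rightarrow> (nat \<Rightarrow> nat \<times> nat) set" where
  "block r k = {g \<in> all_tuples r. {i. (0, i) \<in> g ` {..<r}} = {..<k} \<and>
     (\<forall>v \<in> g ` {..<r}. fst v = 0 \<or> k < fst v)}"

lemma countable_block: "countable (block r k)"
  by (rule countable_subset[OF _ countable_all_tuples[of r]]) (auto simp: block_def)

text \<open>A constant auxiliary tuple serves for \<open>k = 0\<close>, otherwise the tuple that
  lists the \<open>k\<close> vertices and then repeats the last one; this takes
  \<open>k \<le> r\<close> positions.\<close>

lemma block_nonempty:
  assumes "k \<le> r" "r \<ge> 1" shows "block r k \<noteq> {}"
proof (cases "k = 0")
  case True
  have "(\<lambda>j\<in>{..<r}. (1, 0)) \<in> block r k"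
    using True by (auto simp: block_def all_tuples_def)
  then show ?thesis by auto
next
  case False
  have "{i. \<exists>j<r. i = min j (k - 1)} = {..<k}"
  proof (intro equalityI subsetI)
    fix i assume "i \<in> {..<k}"
    then show "i \<in> {i. \<exists>j<r. i = min j (k - 1)}" using assms by (intro CollectI exI[of _ i]) auto
  qed (use False in auto)
  then have "(\<lambda>j\<in>{..<r}. (0, min j (k - 1))) \<in> block r k"
    by (auto simp: block_def all_tuples_def image_iff)
  then show ?thesis by auto
qed

definition block_elem :: "nat \<Rightarrow> nat \<Rightarrow> nat \<Rightarrow> nat \<Rightarrow> nat \<times> nat" where
  "block_elem r k n = from_nat_into (block r k) n"

text \<open>Blocks of all sets of one size are enumerated through the same canonical block over
  \<open>{..<card S}\<close>, so that equal digit positions have equal meaning for different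
  sets.\<close>

definition block_code :: "nat \<Rightarrow> nat \<Rightarrow> nat set \<Rightarrow> ((nat \<Rightarrow> nat \<times> nat) \<Rightarrow> nat) \<Rightarrow> real" where
  "block_code r D S \<omega> = seq_code D (\<lambda>n. \<omega> (comp_tuple r (lift_vertex (nth_elem S)) (block_elem r (card S) n)))"

definition proper_subsets :: "nat \<Rightarrow> nat set set" where
  "proper_subsets k = Pow {..<k} - {{..<k}}"

text \<open>Indexed by subsets of \<open>{..<card S}\<close> instead of subsets of \<open>S\<close>,
  so that all sets of one size share one target space and one transition function.\<close>

definition sub_codes :: "nat \<Rightarrow> nat \<Rightarrow> nat set \<Rightarrow> ((nat \<Rightarrow> nat \<times> nat) \<Rightarrow> nat) \<Rightarrow> nat set \<Rightarrow> real" where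
  "sub_codes r D S \<omega> = (\<lambda>B\<in>proper_subsets (card S). block_code r D (nth_elem S ` B) \<omega>)"

definition relabel :: "nat \<Rightarrow> ('v \<Rightarrow> 'v) \<Rightarrow> ((nat \<Rightarrow> 'v) \<Rightarrow> nat) \<Rightarrow> (nat \<Rightarrow> 'v) \<Rightarrow> nat" where
  "relabel r \<tau> \<omega> = (\<lambda>e\<in>all_tuples r. \<omega> (comp_tuple r \<tau> e))"

text \<open>Actual vertices outside \<open>S\<close> go to the odd places of level
  \<open>card S\<close>, and the former occupants of that level move to the even places. Every
  vertex that the block of \<open>S\<close> uses stays fixed.\<close>

definition push :: "nat set \<Rightarrow> nat \<times> nat \<Rightarrow> nat \<times> nat" where
  "push S v = (if fst v = 0 then (if snd v \<in> S then v else (card S, 2 * snd v + 1))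
     else if fst v = card S then (card S, 2 * snd v) else v)"

text \<open>Positivity of \<open>card S\<close> keeps the receiving level apart from the actual
  vertices.\<close>

lemma inj_push: "card S > 0 \<Longrightarrow> inj (push S)"
proof (rule injI)
  fix v w assume k: "card S > 0" and eq: "push S v = push S w"
  have odd: "2 * i + 1 \<noteq> 2 * j" for i j :: nat by presburger
  obtain a i b j where "v = (a, i)" "w = (b, j)" by (cases v, cases w)
  then show "v = w"
    using k eq odd[of i j] odd[of j i] by (auto simp: push_def split: if_splits)
qed

lemma extend_to_injection:
  assumes "finite S"
  shows "\<exists>\<tau> :: nat \<times> nat \<Rightarrow> nat \<times> nat. inj \<tau> \<and> (\<forall>i<card S. \<tau> (0, i) = (0, nth_elem S i)) \<and> (\<forall>l i. l > 0 \<longrightarrow> \<tau> (l, i) = (l, i))"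
proof -
  \<comment> \<open>Beyond the first \<open>card S\<close> indices everything is shifted past the
    maximum of \<open>S\<close> to avoid collisions; inserting 0 gives a maximum even for
    \<open>S = {}\<close>.\<close>
  define f where "f i = (if i < card S then nth_elem S i else i + Suc (Max (insert 0 S)))" for i
  have le: "nth_elem S i \<le> Max (insert 0 S)" if "i < card S" for i
    using assms nth_elem_in[OF assms that] by (intro Max_ge) auto
  have "inj f"
  proof (rule injI)
    fix i j assume "f i = f j"
    then show "i = j"
      using le[of i] le[of j] inj_onD[OF inj_on_nth_elem[OF assms], of i j]
      by (auto simp: f_def split: if_splits)
  qed
  have "inj (lift_vertex f)"
  proof (rule injI)
    fix v w assume eq: "lift_vertex f v = lift_vertex f w"
    obtain a i b j where "v = (a, i)" "w = (b, j)" by (cases v, cases w)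
    then show "v = w"
      using eq injD[OF \<open>inj f\<close>, of i j] by (auto simp: lift_vertex_def split: if_splits)
  qed
  then show ?thesis by (intro exI[of _ "lift_vertex f"]) (auto simp: lift_vertex_def f_def)
qed

lemma measurable_coordinate:
  assumes "e \<in> all_tuples r"
  shows "(\<lambda>\<omega>. \<omega> e) \<in> measurable (PiM (all_tuples r) (\<lambda>_. count_space {..<D})) (count_space (UNIV :: nat set))"
  using measurable_component_singleton[OF assms, of "\<lambda>_. count_space {..<D}"]
  by (rule measurable_compose) simp

lemma borel_measurable_block_code:
  "block_code r D S \<in> borel_measurable (PiM (all_tuples r) (\<lambda>_. count_space {..<D}))"
  unfolding block_code_def by (intro borel_measurable_seq_code measurable_coordinate) simp

section \<open>Block codes under relabelling of the vertices\<close>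

locale vertex_process = exchangeable_process P r D
  for P :: "((nat \<Rightarrow> nat \<times> nat) \<Rightarrow> nat) measure" and r D
begin

abbreviation "Y \<equiv> block_code r D"

lemma space_P: "space P = all_tuples r \<rightarrow>\<^sub>E {..<D}"
  using sets_eq_imp_space_eq[OF sets_P] by (simp add: space_PiM)

lemma value_less: "\<omega> \<in> space P \<Longrightarrow> e \<in> all_tuples r \<Longrightarrow> \<omega> e < D"
  by (auto simp: space_P PiE_iff)

lemma measurable_Y[measurable]: "Y S \<in> borel_measurable P"
  by (subst measurable_cong_sets[OF sets_P refl]) (rule borel_measurable_block_code)

lemma Y_bounds: "\<omega> \<in> space P \<Longrightarrow> 0 \<le> Y S \<omega> \<and> Y S \<omega> \<le> 1"
  unfolding block_code_def
  using seq_code_bounds[of "\<lambda>n. \<omega> (comp_tuple r (lift_vertex (nth_elem S)) (block_elem r (card S) n))" D]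
  by (auto simp: value_less)

text \<open>The code loses no entry of its block; this is what allows pushed codes to be recomputed
  from other codes.\<close>

lemma digit_Y:
  assumes "\<omega> \<in> space P" "g \<in> block r (card S)"
  shows "seq_digit D (to_nat_on (block r (card S)) g) (Y S \<omega>) = \<omega> (comp_tuple r (lift_vertex (nth_elem S)) g)"
  unfolding block_code_def block_elem_def using assms
  by (subst seq_digit_code) (auto simp: value_less countable_block)

lemma measurable_relabel[measurable]: "relabel r \<tau> \<in> measurable P P"
  unfolding relabel_def
  by (subst measurable_cong_sets[OF sets_P sets_P]) (intro measurable_restrict measurable_component_singleton, simp)

lemma relabel_space: "\<omega> \<in> space P \<Longrightarrow> relabel r \<tau> \<omega> \<in> space P"
  using measurable_relabel by (rule measurable_space)

lemma distr_relabel: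
  assumes "inj \<tau>" and [measurable]: "X \<in> measurable P N"
  shows "distr P N (\<lambda>\<omega>. X (relabel r \<tau> \<omega>)) = distr P N X"
proof -
  have "distr P N X = distr (distr P P (relabel r \<tau>)) N X"
    using exchangeable[OF assms(1)] unfolding relabel_def
    by (subst (asm) distr_cong[OF refl sets_P[symmetric] refl]) simp
  also have "\<dots> = distr P N (\<lambda>\<omega>. X (relabel r \<tau> \<omega>))"
    by (subst distr_distr) (auto simp: comp_def)
  finally show ?thesis by simp
qed

lemma Y_relabel:
  "Y S (relabel r \<tau> \<omega>) =
    seq_code D (\<lambda>n. \<omega> (comp_tuple r (\<lambda>v. \<tau> (lift_vertex (nth_elem S) v)) (block_elem r (card S) n)))"
  by (simp add: block_code_def relabel_def comp_tuple_comp)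

lemma block_elem_in: "k \<le> r \<Longrightarrow> block_elem r k n \<in> block r k"
  unfolding block_elem_def using block_nonempty[OF _ r_pos] by (rule from_nat_into)

lemma block_vertex_cases:
  assumes "g \<in> block r k" "j < r"
  obtains i where "g j = (0, i)" "i < k" | l i where "g j = (l, i)" "l > k"
proof -
  have "g j \<in> g ` {..<r}" using assms by auto
  show ?thesis
  proof (cases "fst (g j) = 0")
    case True
    then have "(0, snd (g j)) \<in> g ` {..<r}" using \<open>g j \<in> g ` {..<r}\<close> by (metis prod.collapse)
    then have "snd (g j) < k" using assms(1) by (auto simp: block_def)
    then show ?thesis using True that(1)[of "snd (g j)"] by (metis prod.collapse)
  next
    case False
    have "\<forall>v \<in> g ` {..<r}. fst v = 0 \<or> k < fst v" using assms(1) by (simp add: block_def)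
    from bspec[OF this \<open>g j \<in> g ` {..<r}\<close>] have "k < fst (g j)" using False by simp
    then show ?thesis using that(2) by (metis prod.collapse)
  qed
qed

text \<open>For increasing \<open>f\<close> the enumerations of \<open>B\<close> and of its image
  match, so the code is transported digit by digit without any rearrangement.\<close>

lemma Y_relabel_mono:
  assumes "finite B" "card B \<le> r" "strict_mono_on B f"
    and \<tau>: "\<And>i. i \<in> B \<Longrightarrow> \<tau> (0, i) = (0, f i)" "\<And>l i. l > 0 \<Longrightarrow> \<tau> (l, i) = (l, i)"
  shows "Y B (relabel r \<tau> \<omega>) = Y (f ` B) \<omega>"
proof -
  have card: "card (f ` B) = card B"
    using assms(3) by (intro card_image strict_mono_on_imp_inj_on)
  have "comp_tuple r (\<lambda>v. \<tau> (lift_vertex (nth_elem B) v)) (block_elem r (card B) n) =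
     comp_tuple r (lift_vertex (nth_elem (f ` B))) (block_elem r (card B) n)" for n
  proof (rule comp_tuple_cong)
    fix j assume j: "j < r"
    show "\<tau> (lift_vertex (nth_elem B) (block_elem r (card B) n j)) = lift_vertex (nth_elem (f ` B)) (block_elem r (card B) n j)"
      using block_elem_in[OF assms(2), of n] j
    proof (cases rule: block_vertex_cases)
      case (1 i)
      then show ?thesis
        using \<tau>(1)[OF nth_elem_in[OF assms(1), of i]] nth_elem_of_strict_mono_image[OF assms(1,3), of i]
        by (simp add: lift_vertex_def)
    next
      case (2 l i)
      then show ?thesis using \<tau>(2)[of l i] by (simp add: lift_vertex_def)
    qed
  qed
  then show ?thesis unfolding Y_relabel by (simp add: block_code_def card)
qed

abbreviation "codes_space k \<equiv> (\<Pi>\<^sub>M B\<in>proper_subsets k. (borel :: real measure))"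

lemma measurable_sub_codes[measurable]: "card S = k \<Longrightarrow> sub_codes r D S \<in> measurable P (codes_space k)"
  unfolding sub_codes_def by (hypsubst, intro measurable_restrict measurable_Y)

text \<open>Exchangeability along an injection that extends \<open>nth_elem S\<close> and thus
  carries \<open>{..<k}\<close> increasingly onto \<open>S\<close>. As a consequence, one transition
  function per size will do.\<close>

lemma sub_codes_law:
  assumes S: "finite S" "card S = k" "k \<le> r"
  shows "distr P (codes_space k \<Otimes>\<^sub>M borel) (\<lambda>\<omega>. (sub_codes r D S \<omega>, Y S \<omega>)) =
    distr P (codes_space k \<Otimes>\<^sub>M borel) (\<lambda>\<omega>. (sub_codes r D {..<k} \<omega>, Y {..<k} \<omega>))"
proof -
  obtain \<tau> :: "nat \<times> nat \<Rightarrow> nat \<times> nat" where \<tau>: "inj \<tau>" "\<And>i. i < card S \<Longrightarrow> \<tau> (0, i) = (0, nth_elem S i)" "\<And>l i. l > 0 \<Longrightarrow> \<tau> (l, i) = (l, i)"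
    using extend_to_injection[OF S(1)] by blast
  have *: "Y B (relabel r \<tau> \<omega>) = Y (nth_elem S ` B) \<omega>" if "B \<subseteq> {..<k}" for B \<omega>
  proof (rule Y_relabel_mono)
    show "finite B" using that finite_subset by blast
    have "card B \<le> k" using that card_mono[of "{..<k}" B] by simp
    then show "card B \<le> r" using S by simp
    show "strict_mono_on B (nth_elem S)"
      using nth_elem_strict_mono[OF S(1)] that S by (auto simp: strict_mono_on_def)
  qed (use \<tau> that S in auto)
  have id: "nth_elem {..<k} ` B = B" if "B \<subseteq> {..<k}" for B
    using that by (force simp: nth_elem_lessThan)
  have "sub_codes r D {..<k} (relabel r \<tau> \<omega>) = sub_codes r D S \<omega>" for \<omega>
    using S by (auto simp: sub_codes_def proper_subsets_def * id fun_eq_iff restrict_def)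
  moreover have "Y {..<k} (relabel r \<tau> \<omega>) = Y S \<omega>" for \<omega>
    using *[of "{..<k}" \<omega>] nth_elem_image[OF S(1)] S by simp
  ultimately show ?thesis
    using distr_relabel[OF \<tau>(1), of "\<lambda>\<omega>. (sub_codes r D {..<k} \<omega>, Y {..<k} \<omega>)"]
    by simp
qed

section \<open>Pushing foreign vertices into an auxiliary level\<close>

lemma card_Int_less:
  assumes "finite A" "finite S" "card A \<le> card S" "A \<noteq> S"
  shows "card (A \<inter> S) < card S"
proof -
  have "A \<inter> S \<noteq> S" using assms card_seteq[of A S] by auto
  then show ?thesis using assms by (intro psubset_card_mono) auto
qed

text \<open>The pattern of the pushed tuple within the canonical block for
  \<open>A \<inter> S\<close>, that is, the place where the code of \<open>A \<inter> S\<close>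
  stores its entry.\<close>

definition push_position :: "nat set \<Rightarrow> nat set \<Rightarrow> nat \<Rightarrow> nat \<Rightarrow> nat \<times> nat" where
  "push_position S A n = comp_tuple r
     (\<lambda>v. lift_vertex (elem_index (A \<inter> S)) (push S (lift_vertex (nth_elem A) v))) (block_elem r (card A) n)"

text \<open>After pushing, a tuple from the block of \<open>A\<close> meets the actual vertices
  exactly in \<open>A \<inter> S\<close>. Its other levels are \<open>card S\<close> or above
  \<open>card A\<close>, and both exceed \<open>card (A \<inter> S)\<close>, so the tuple lies in
  the block of \<open>A \<inter> S\<close>, a proper subset of \<open>S\<close>.\<close>

lemma push_position_block:
  assumes A: "finite A" "finite S" "card A \<le> card S" "A \<noteq> S" "card S \<le> r" "card S > 0"
  shows "push_position S A n \<in> block r (card (A \<inter> S))"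
    and "comp_tuple r (lift_vertex (nth_elem (A \<inter> S))) (push_position S A n) =
      comp_tuple r (\<lambda>v. push S (lift_vertex (nth_elem A) v)) (block_elem r (card A) n)"
proof -
  let ?g = "block_elem r (card A) n" and ?k = "card S" and ?C = "A \<inter> S"
  have g: "?g \<in> block r (card A)" using A by (intro block_elem_in) simp
  have lt: "card ?C < ?k" by (rule card_Int_less) fact+
  have le: "card ?C \<le> card A" using A by (intro card_mono) auto
  have finC: "finite ?C" using A by simp
  have cases: "(\<exists>i<card A. nth_elem A i \<in> ?C \<and> ?g j = (0, i) \<and> push S (lift_vertex (nth_elem A) (?g j)) = (0, nth_elem A i)) \<or>
     (\<exists>l i. l > card ?C \<and> push S (lift_vertex (nth_elem A) (?g j)) = (l, i) \<and> (fst (?g j) = 0 \<longrightarrow> nth_elem A (snd (?g j)) \<notin> S))"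
    if j: "j < r" for j
    using g j
  proof (cases rule: block_vertex_cases)
    case (1 i)
    then show ?thesis
      using nth_elem_in[OF A(1), of i] lt by (auto simp: push_def lift_vertex_def)
  next
    case (2 l i)
    then show ?thesis using le lt by (auto simp: push_def lift_vertex_def)
  qed
  \<comment> \<open>No vertex of \<open>A \<inter> S\<close> is lost: the block of \<open>A\<close>
    meets every vertex of \<open>A\<close>, and those in \<open>S\<close> are fixed.\<close>
  have lev0: "{i. (0, i) \<in> push_position S A n ` {..<r}} = elem_index ?C ` ?C"
  proof (intro equalityI subsetI)
    fix i assume "i \<in> {i. (0, i) \<in> push_position S A n ` {..<r}}"
    then obtain j where j: "j < r" "push_position S A n j = (0, i)" by force
    from cases[OF j(1)] show "i \<in> elem_index ?C ` ?C"
      using j by (auto simp: push_position_def lift_vertex_def)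
  next
    fix i assume "i \<in> elem_index ?C ` ?C"
    then obtain s where s: "s \<in> ?C" "i = elem_index ?C s" by auto
    have "elem_index A s < card A"
      using s A elem_index_image[of A] by auto
    then have "(0, elem_index A s) \<in> ?g ` {..<r}" using g by (auto simp: block_def)
    then obtain j where j: "j < r" "?g j = (0, elem_index A s)" by force
    have "push_position S A n j = (0, i)"
      using j s nth_elem_elem_index[OF A(1), of s] by (simp add: push_position_def lift_vertex_def push_def)
    then show "i \<in> {i. (0, i) \<in> push_position S A n ` {..<r}}" using j(1) by (auto simp: image_iff intro!: bexI[of _ j])
  qed
  show "push_position S A n \<in> block r (card ?C)"
    unfolding block_def
  proof (intro CollectI conjI ballI)
    show "push_position S A n \<in> all_tuples r" by (simp add: push_position_def)
    show "{i. (0, i) \<in> push_position S A n ` {..<r}} = {..<card ?C}"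
      unfolding lev0 by (rule elem_index_image[OF finC])
    fix v assume "v \<in> push_position S A n ` {..<r}"
    then obtain j where j: "j < r" "v = push_position S A n j" by auto
    from cases[OF j(1)] show "fst v = 0 \<or> card ?C < fst v"
      using j by (auto simp: push_position_def lift_vertex_def)
  qed
  show "comp_tuple r (lift_vertex (nth_elem ?C)) (push_position S A n) =
      comp_tuple r (\<lambda>v. push S (lift_vertex (nth_elem A) v)) ?g"
    unfolding push_position_def comp_tuple_comp
  proof (rule comp_tuple_cong)
    fix j assume "j < r"
    from cases[OF this] show "lift_vertex (nth_elem ?C) (lift_vertex (elem_index ?C) (push S (lift_vertex (nth_elem A) (?g j)))) =
      push S (lift_vertex (nth_elem A) (?g j))"
      using nth_elem_elem_index[OF finC] by (auto simp: lift_vertex_def)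
  qed
qed

lemma Y_push:
  assumes "finite S" "card S \<le> r" shows "Y S (relabel r (push S) \<omega>) = Y S \<omega>"
proof -
  have "comp_tuple r (\<lambda>v. push S (lift_vertex (nth_elem S) v)) (block_elem r (card S) n) =
    comp_tuple r (lift_vertex (nth_elem S)) (block_elem r (card S) n)" for n
  proof (rule comp_tuple_cong)
    fix j assume j: "j < r"
    show "push S (lift_vertex (nth_elem S) (block_elem r (card S) n j)) = lift_vertex (nth_elem S) (block_elem r (card S) n j)"
      using block_elem_in[OF assms(2), of n] j
      by (cases rule: block_vertex_cases) (auto simp: lift_vertex_def push_def nth_elem_in[OF assms(1)])
  qed
  then show ?thesis unfolding Y_relabel by (simp add: block_code_def)
qed

text \<open>An instance of \<open>cond_indep_transfer\<close> with the codes of the proper subsets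
  of \<open>S\<close> as \<open>Y\<close> and all codes in \<open>\<A>\<close> as \<open>Y'\<close>.
  Relabelling by \<open>push S\<close> turns the latter into functions of the former.
  \<open>F k\<close> depends on the size only, by \<open>sub_codes_law\<close>; it is taken from the
  canonical set \<open>{..<k}\<close>.\<close>

theorem block_code_transition:
  "\<exists>F. \<forall>k\<in>{1..r}. F k \<in> borel_measurable (codes_space k \<Otimes>\<^sub>M unit_uniform) \<and>
    (\<forall>S \<A>. finite S \<longrightarrow> card S = k \<longrightarrow> S \<notin> \<A> \<longrightarrow> (\<forall>A\<in>\<A>. finite A \<and> card A \<le> k) \<longrightarrow> (\<forall>B. B \<subset> S \<longrightarrow> B \<in> \<A>) \<longrightarrow>
      distr P ((\<Pi>\<^sub>M A\<in>\<A>. borel) \<Otimes>\<^sub>M borel) (\<lambda>\<omega>. (\<lambda>A\<in>\<A>. Y A \<omega>, Y S \<omega>)) =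
      distr (distr P (\<Pi>\<^sub>M A\<in>\<A>. borel) (\<lambda>\<omega>. \<lambda>A\<in>\<A>. Y A \<omega>) \<Otimes>\<^sub>M unit_uniform) ((\<Pi>\<^sub>M A\<in>\<A>. borel) \<Otimes>\<^sub>M borel)
        (\<lambda>(y, u). (y, F k (\<lambda>B\<in>proper_subsets k. y (nth_elem S ` B), u))))"
proof -
  have "\<exists>F. F \<in> borel_measurable (codes_space k \<Otimes>\<^sub>M unit_uniform) \<and>
    (\<forall>S \<A>. finite S \<longrightarrow> card S = k \<longrightarrow> S \<notin> \<A> \<longrightarrow> (\<forall>A\<in>\<A>. finite A \<and> card A \<le> k) \<longrightarrow> (\<forall>B. B \<subset> S \<longrightarrow> B \<in> \<A>) \<longrightarrow>
      distr P ((\<Pi>\<^sub>M A\<in>\<A>. borel) \<Otimes>\<^sub>M borel) (\<lambda>\<omega>. (\<lambda>A\<in>\<A>. Y A \<omega>, Y S \<omega>)) =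
      distr (distr P (\<Pi>\<^sub>M A\<in>\<A>. borel) (\<lambda>\<omega>. \<lambda>A\<in>\<A>. Y A \<omega>) \<Otimes>\<^sub>M unit_uniform) ((\<Pi>\<^sub>M A\<in>\<A>. borel) \<Otimes>\<^sub>M borel)
        (\<lambda>(y, u). (y, F (\<lambda>B\<in>proper_subsets k. y (nth_elem S ` B), u))))"
    if k: "k \<in> {1..r}" for k
  proof -
    have [measurable]: "sub_codes r D {..<k} \<in> measurable P (codes_space k)" by (intro measurable_sub_codes) simp
    obtain F where F[measurable]: "F \<in> borel_measurable (codes_space k \<Otimes>\<^sub>M unit_uniform)"
      and FD: "distr P (codes_space k \<Otimes>\<^sub>M borel) (\<lambda>\<omega>. (sub_codes r D {..<k} \<omega>, Y {..<k} \<omega>)) =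
        distr (distr P (codes_space k) (sub_codes r D {..<k}) \<Otimes>\<^sub>M unit_uniform) (codes_space k \<Otimes>\<^sub>M borel) (\<lambda>(y, u). (y, F (y, u)))"
      using outsourcing[OF prob_space_axioms, of "sub_codes r D {..<k}" "codes_space k" "Y {..<k}"] Y_bounds by auto
    have main: "distr P ((\<Pi>\<^sub>M A\<in>\<A>. borel) \<Otimes>\<^sub>M borel) (\<lambda>\<omega>. (\<lambda>A\<in>\<A>. Y A \<omega>, Y S \<omega>)) =
      distr (distr P (\<Pi>\<^sub>M A\<in>\<A>. borel) (\<lambda>\<omega>. \<lambda>A\<in>\<A>. Y A \<omega>) \<Otimes>\<^sub>M unit_uniform) ((\<Pi>\<^sub>M A\<in>\<A>. borel) \<Otimes>\<^sub>M borel)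
        (\<lambda>(y, u). (y, F (\<lambda>B\<in>proper_subsets k. y (nth_elem S ` B), u)))"
      if S: "finite S" "card S = k" "S \<notin> \<A>" and \<A>: "\<And>A. A \<in> \<A> \<Longrightarrow> finite A \<and> card A \<le> k"
        and sub: "\<And>B. B \<subset> S \<Longrightarrow> B \<in> \<A>" for S \<A>
    proof -
      have inA: "nth_elem S ` B \<in> \<A>" if "B \<in> proper_subsets k" for B
      proof (rule sub, rule psubsetI)
        have "B \<subseteq> {..<k}" using that by (auto simp: proper_subsets_def)
        show "nth_elem S ` B \<subseteq> S" using \<open>B \<subseteq> {..<k}\<close> nth_elem_in[OF S(1)] S by auto
        have "card B < card {..<k}" using that by (intro psubset_card_mono) (auto simp: proper_subsets_def)
        then have "card (nth_elem S ` B) < card S"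
          using card_image_le[of B "nth_elem S"] \<open>B \<subseteq> {..<k}\<close> S finite_subset[of B "{..<k}"] by auto
        then show "nth_elem S ` B \<noteq> S" by auto
      qed
      let ?p = "\<lambda>y. \<lambda>B\<in>proper_subsets k. y (nth_elem S ` B) :: real"
      \<comment> \<open>Pushed codes computed from sub-codes: digits are read from the code of
        \<open>A \<inter> S\<close> at the pushed positions and packed again. The set
        \<open>{i. i < k \<and> nth_elem S i \<in> A}\<close> is \<open>A \<inter> S\<close> in the
        numbering of \<open>S\<close>.\<close>
      define p' where "p' y = (\<lambda>A\<in>\<A>. seq_code D (\<lambda>n. seq_digit D
          (to_nat_on (block r (card (A \<inter> S))) (push_position S A n)) (y {i. i < k \<and> nth_elem S i \<in> A})))" for y :: "nat set \<Rightarrow> real"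
      have AS: "nth_elem S ` {i. i < k \<and> nth_elem S i \<in> A} = A \<inter> S" for A
        using nth_elem_image[OF S(1)] S by auto
      have ps: "{i. i < k \<and> nth_elem S i \<in> A} \<in> proper_subsets k" if "A \<in> \<A>" for A
      proof -
        have "card (A \<inter> S) < card S" using that \<A> S by (intro card_Int_less) auto
        then have "{i. i < k \<and> nth_elem S i \<in> A} \<noteq> {..<k}"
          using AS[of A] nth_elem_image[OF S(1)] S by auto
        then show ?thesis by (auto simp: proper_subsets_def)
      qed
      have Ypush: "(\<lambda>A\<in>\<A>. Y A (relabel r (push S) \<omega>)) = p' (sub_codes r D S \<omega>)" if \<omega>: "\<omega> \<in> space P" for \<omega>
        unfolding p'_def
      proof (rule restrict_ext)
        fix A assume A: "A \<in> \<A>"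
        have A': "finite A" "finite S" "card A \<le> card S" "A \<noteq> S" "card S \<le> r" "card S > 0"
          using \<A>[OF A] S A k by auto
        note pp = push_position_block[OF A']
        have "Y A (relabel r (push S) \<omega>) = seq_code D (\<lambda>n. \<omega> (comp_tuple r (lift_vertex (nth_elem (A \<inter> S))) (push_position S A n)))"
          unfolding Y_relabel pp(2) ..
        also have "\<dots> = seq_code D (\<lambda>n. seq_digit D (to_nat_on (block r (card (A \<inter> S))) (push_position S A n)) (Y (A \<inter> S) \<omega>))"
          using digit_Y[OF \<omega> pp(1)] by simp
        also have "Y (A \<inter> S) \<omega> = sub_codes r D S \<omega> {i. i < k \<and> nth_elem S i \<in> A}"
          using ps[OF A] S by (simp add: sub_codes_def AS)
        finally show "Y A (relabel r (push S) \<omega>) = seq_code D (\<lambda>n. seq_digit D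
          (to_nat_on (block r (card (A \<inter> S))) (push_position S A n)) (sub_codes r D S \<omega> {i. i < k \<and> nth_elem S i \<in> A}))" .
      qed
      have [measurable]: "sub_codes r D S \<in> measurable P (codes_space k)" using S by (intro measurable_sub_codes)
      have Y'm: "(\<lambda>\<omega>. \<lambda>A\<in>\<A>. Y A \<omega>) \<in> measurable P (\<Pi>\<^sub>M A\<in>\<A>. borel)"
        by (intro measurable_restrict) simp
      have p'm: "p' \<in> measurable (codes_space k) (\<Pi>\<^sub>M A\<in>\<A>. borel)"
        unfolding p'_def
      proof (intro measurable_restrict borel_measurable_seq_code)
        fix A n assume "A \<in> \<A>"
        have [measurable]: "(\<lambda>y. y {i. i < k \<and> nth_elem S i \<in> A}) \<in> borel_measurable (codes_space k)"
          using ps[OF \<open>A \<in> \<A>\<close>] by (rule measurable_component_singleton)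
        show "(\<lambda>y. seq_digit D (to_nat_on (block r (card (A \<inter> S))) (push_position S A n)) (y {i. i < k \<and> nth_elem S i \<in> A}))
          \<in> codes_space k \<rightarrow>\<^sub>M count_space UNIV" by measurable
      qed
      have marg: "distr P (codes_space k) (sub_codes r D S) = distr P (codes_space k) (sub_codes r D {..<k})"
      proof -
        have "distr P (codes_space k) (sub_codes r D S') =
          distr (distr P (codes_space k \<Otimes>\<^sub>M borel) (\<lambda>\<omega>. (sub_codes r D S' \<omega>, Y S' \<omega>))) (codes_space k) fst"
          if "card S' = k" for S'
          using measurable_sub_codes[OF that] by (subst distr_distr) (auto simp: comp_def)
        from this[of S] this[of "{..<k}"] show ?thesis
          using sub_codes_law[of S k] S k by simp
      qed
      show ?thesis
      proof (rule cond_indep_transfer[OF prob_space_axioms, where N="codes_space k" and Y="sub_codes r D S" and p="?p" and p'=p'])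
        show "?p \<in> (\<Pi>\<^sub>M A\<in>\<A>. borel) \<rightarrow>\<^sub>M codes_space k"
          by (intro measurable_restrict measurable_component_singleton inA)
        show "sub_codes r D S \<omega> = ?p (\<lambda>A\<in>\<A>. Y A \<omega>)" for \<omega>
          using inA S by (auto simp: sub_codes_def fun_eq_iff)
        show "distr P ((\<Pi>\<^sub>M A\<in>\<A>. borel) \<Otimes>\<^sub>M borel) (\<lambda>\<omega>. (p' (sub_codes r D S \<omega>), Y S \<omega>)) =
          distr P ((\<Pi>\<^sub>M A\<in>\<A>. borel) \<Otimes>\<^sub>M borel) (\<lambda>\<omega>. (\<lambda>A\<in>\<A>. Y A \<omega>, Y S \<omega>))"
        proof -
          \<comment> \<open>Relabelling by \<open>push S\<close> preserves the law of the process;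
            it fixes \<open>Y S\<close> and turns the other codes into \<open>p'\<close> of the
            sub-codes.\<close>
          have "distr P ((\<Pi>\<^sub>M A\<in>\<A>. borel) \<Otimes>\<^sub>M borel) (\<lambda>\<omega>. (p' (sub_codes r D S \<omega>), Y S \<omega>)) =
            distr P ((\<Pi>\<^sub>M A\<in>\<A>. borel) \<Otimes>\<^sub>M borel) (\<lambda>\<omega>. (\<lambda>A\<in>\<A>. Y A (relabel r (push S) \<omega>), Y S (relabel r (push S) \<omega>)))"
            using Ypush Y_push[OF S(1)] S k by (intro distr_cong) auto
          also have "\<dots> = distr P ((\<Pi>\<^sub>M A\<in>\<A>. borel) \<Otimes>\<^sub>M borel) (\<lambda>\<omega>. (\<lambda>A\<in>\<A>. Y A \<omega>, Y S \<omega>))"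
            using S k Y'm by (intro distr_relabel inj_push) auto
          finally show ?thesis .
        qed
        show "distr P (codes_space k \<Otimes>\<^sub>M borel) (\<lambda>\<omega>. (sub_codes r D S \<omega>, Y S \<omega>)) =
          distr (distr P (codes_space k) (sub_codes r D S) \<Otimes>\<^sub>M unit_uniform) (codes_space k \<Otimes>\<^sub>M borel) (\<lambda>(y, u). (y, F (y, u)))"
          using sub_codes_law[of S k] S k FD unfolding marg by simp
      qed (fact Y'm p'm F measurable_Y | simp add: Y_bounds)+
    qed
    show ?thesis
      by (intro exI[of _ F] conjI allI impI, rule F) (rule main; blast)
  qed
  then show ?thesis by (intro bchoice ballI)
qed

end

section \<open>Recursive coding by independent seeds\<close>

text \<open>The seed of the empty set is its code, with no transition function applied. The inner
  \<open>if\<close> writes out a restriction, so that each recursive call carries the fact that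
  \<open>B\<close> is a proper subset, on which termination depends.\<close>

function coded_value :: "(nat \<Rightarrow> (nat set \<Rightarrow> real) \<times> real \<Rightarrow> real) \<Rightarrow> nat set \<Rightarrow> (nat set \<Rightarrow> real) \<Rightarrow> real" where
  "coded_value F S u = (if finite S \<and> S \<noteq> {}
     then F (card S) (\<lambda>B. if B \<in> proper_subsets (card S) then coded_value F (nth_elem S ` B) u else undefined, u S)
     else u S)"
  by auto

lemma card_nth_elem_image_less:
  assumes "B \<in> proper_subsets (card S)" "finite S" "S \<noteq> {}"
  shows "card (nth_elem S ` B) < card S"
proof -
  have B: "B \<subset> {..<card S}" using assms(1) by (auto simp: proper_subsets_def)
  then have "finite B" "card B < card S" using psubset_card_mono[OF _ B] finite_subset[of B "{..<card S}"] by auto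
  then show ?thesis using card_image_le[of B "nth_elem S"] by simp
qed

termination by (relation "Wellfounded.measure (\<lambda>(F, S, u). card S)") (auto simp: card_nth_elem_image_less)

declare coded_value.simps[simp del]

lemma coded_value_empty[simp]: "coded_value F {} u = u {}"
  by (subst coded_value.simps) simp

lemma coded_value_empty_fun: "coded_value F {} = (\<lambda>u. u {})"
  by (simp add: fun_eq_iff)

lemma coded_value_nonempty:
  "finite S \<Longrightarrow> S \<noteq> {} \<Longrightarrow> coded_value F S u =
    F (card S) (\<lambda>B\<in>proper_subsets (card S). coded_value F (nth_elem S ` B) u, u S)"
  by (subst coded_value.simps) (simp add: restrict_def)

lemma nth_elem_image_subset: "finite S \<Longrightarrow> B \<in> proper_subsets (card S) \<Longrightarrow> nth_elem S ` B \<subseteq> S"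
  using nth_elem_in by (auto simp: proper_subsets_def)

lemma coded_value_cong:
  "finite S \<Longrightarrow> (\<And>T. T \<subseteq> S \<Longrightarrow> u T = v T) \<Longrightarrow> coded_value F S u = coded_value F S v"
proof (induction "card S" arbitrary: S rule: less_induct)
  case less
  show ?case
  proof (cases "S = {}")
    case False
    have "coded_value F (nth_elem S ` B) u = coded_value F (nth_elem S ` B) v" if B: "B \<in> proper_subsets (card S)" for B
      using nth_elem_image_subset[OF less.prems(1) B] card_nth_elem_image_less[OF B less.prems(1) False] less.prems
      by (intro less.hyps) (auto intro: finite_subset)
    then show ?thesis
      using False less.prems by (simp add: coded_value_nonempty cong: restrict_cong)
  qed (use less.prems in simp)
qed

definition seed_measure :: "real measure \<Rightarrow> nat set \<Rightarrow> real measure" where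
  "seed_measure \<nu> T = (if T = {} then \<nu> else unit_uniform)"

definition down_closed :: "'a set set \<Rightarrow> bool" where
  "down_closed \<A> \<longleftrightarrow> (\<forall>A\<in>\<A>. \<forall>B. B \<subseteq> A \<longrightarrow> B \<in> \<A>)"

text \<open>Only the sigma-algebra of \<open>\<nu>\<close> matters. Thus \<open>borel\<close> may
  stand in its place once the seed of the empty set is a fixed number.\<close>

lemma borel_measurable_coded_value:
  assumes F: "\<And>k. k \<in> {1..r} \<Longrightarrow> F k \<in> borel_measurable ((\<Pi>\<^sub>M B\<in>proper_subsets k. borel) \<Otimes>\<^sub>M unit_uniform)"
    and \<nu>: "sets \<nu> = sets borel" and "down_closed \<A>"
  shows "S \<in> \<A> \<Longrightarrow> finite S \<Longrightarrow> card S \<le> r \<Longrightarrow> coded_value F S \<in> borel_measurable (\<Pi>\<^sub>M T\<in>\<A>. seed_measure \<nu> T)"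
proof (induction "card S" arbitrary: S rule: less_induct)
  case less
  have comp: "(\<lambda>u. u S) \<in> measurable (\<Pi>\<^sub>M T\<in>\<A>. seed_measure \<nu> T) (seed_measure \<nu> S)"
    using less.prems by (intro measurable_component_singleton)
  show ?case
  proof (cases "S = {}")
    case True
    then have "(\<lambda>u. u S) \<in> borel_measurable (\<Pi>\<^sub>M T\<in>\<A>. seed_measure \<nu> T)"
      using comp \<nu> by (simp add: seed_measure_def cong: measurable_cong_sets)
    then show ?thesis using True by (simp add: coded_value_empty_fun)
  next
    case False
    let ?k = "card S"
    have k: "?k \<in> {1..r}" using False less.prems by (auto simp: Suc_le_eq card_gt_0_iff)
    have "(\<lambda>u. \<lambda>B\<in>proper_subsets ?k. coded_value F (nth_elem S ` B) u) \<in>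
      measurable (\<Pi>\<^sub>M T\<in>\<A>. seed_measure \<nu> T) (\<Pi>\<^sub>M B\<in>proper_subsets ?k. borel)"
    proof (rule measurable_restrict)
      fix B assume B: "B \<in> proper_subsets ?k"
      have "nth_elem S ` B \<subseteq> S" using nth_elem_image_subset less.prems B by auto
      moreover from this have "nth_elem S ` B \<in> \<A>" using \<open>down_closed \<A>\<close> less.prems by (auto simp: down_closed_def)
      moreover have "card (nth_elem S ` B) < card S" using card_nth_elem_image_less[OF B] False less.prems by simp
      ultimately show "coded_value F (nth_elem S ` B) \<in> borel_measurable (\<Pi>\<^sub>M T\<in>\<A>. seed_measure \<nu> T)"
        using less.prems by (intro less.hyps) (auto intro: finite_subset)
    qed
    moreover have "(\<lambda>u. u S) \<in> measurable (\<Pi>\<^sub>M T\<in>\<A>. seed_measure \<nu> T) unit_uniform"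
      using comp False by (simp add: seed_measure_def)
    ultimately have "(\<lambda>u. (\<lambda>B\<in>proper_subsets ?k. coded_value F (nth_elem S ` B) u, u S)) \<in>
      measurable (\<Pi>\<^sub>M T\<in>\<A>. seed_measure \<nu> T) ((\<Pi>\<^sub>M B\<in>proper_subsets ?k. borel) \<Otimes>\<^sub>M unit_uniform)"
      by (rule measurable_Pair)
    from measurable_compose[OF this F[OF k]]
    have "(\<lambda>u. F ?k (\<lambda>B\<in>proper_subsets ?k. coded_value F (nth_elem S ` B) u, u S)) \<in> borel_measurable (\<Pi>\<^sub>M T\<in>\<A>. seed_measure \<nu> T)" .
    then show ?thesis by (simp add: coded_value_nonempty False less.prems cong: measurable_cong)
  qed
qed

section \<open>Storing the entries of the actual array in the codes\<close>

definition tuple_support :: "nat \<Rightarrow> (nat \<Rightarrow> nat) \<Rightarrow> nat set" where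
  "tuple_support r e = e ` {..<r}"

text \<open>A tuple of actual vertices belongs to the block of its own support; this is the index of
  the digit of that code in which its entry is stored.\<close>

definition tuple_position :: "nat \<Rightarrow> (nat \<Rightarrow> nat) \<Rightarrow> nat" where
  "tuple_position r e = to_nat_on (block r (card (tuple_support r e)))
     (comp_tuple r (\<lambda>i. (0, elem_index (tuple_support r e) i)) e)"

text \<open>A base \<open>D + 1\<close> digit of an arbitrary real may be \<open>D\<close>, hence the truncation.\<close>

definition clip_digit :: "nat \<Rightarrow> nat \<Rightarrow> real \<Rightarrow> nat" where
  "clip_digit D n x = min (D - 1) (seq_digit D n x)"

lemma measurable_clip_digit[measurable]: "clip_digit D n \<in> measurable borel (count_space UNIV)"
  unfolding clip_digit_def by (rule measurable_compose[OF measurable_seq_digit]) simp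

definition coded_entry ::
  "nat \<Rightarrow> nat \<Rightarrow> (nat \<Rightarrow> (nat set \<Rightarrow> real) \<times> real \<Rightarrow> real) \<Rightarrow> (nat \<Rightarrow> nat) \<Rightarrow> (nat set \<Rightarrow> real) \<Rightarrow> nat" where
  "coded_entry r D F e u = clip_digit D (tuple_position r e) (coded_value F (tuple_support r e) u)"

lemma finite_tuple_support[simp]: "finite (tuple_support r e)"
  by (simp add: tuple_support_def)

lemma card_tuple_support: "card (tuple_support r e) \<le> r"
  unfolding tuple_support_def using card_image_le[of "{..<r}" e] by simp

lemma tuple_position_block:
  "comp_tuple r (\<lambda>i. (0, elem_index (tuple_support r e) i)) e \<in> block r (card (tuple_support r e))"
proof -
  let ?S = "tuple_support r e" and ?g = "comp_tuple r (\<lambda>i. (0::nat, elem_index (tuple_support r e) i)) e"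
  have img: "?g ` {..<r} = (\<lambda>i. (0::nat, elem_index ?S i)) ` ?S"
    by (auto simp: tuple_support_def comp_tuple_def image_image)
  show ?thesis
    unfolding block_def
  proof (intro CollectI conjI)
    have "{i. (0::nat, i) \<in> (\<lambda>i. (0, elem_index ?S i)) ` ?S} = elem_index ?S ` ?S" by auto
    also have "\<dots> = {..<card ?S}" by (rule elem_index_image) simp
    finally show "{i. (0, i) \<in> ?g ` {..<r}} = {..<card ?S}" unfolding img .
    show "\<forall>v\<in>?g ` {..<r}. fst v = 0 \<or> card ?S < fst v" unfolding img by simp
  qed simp
qed

lemma (in vertex_process) digit_Y_support:
  assumes "\<omega> \<in> space P"
  shows "clip_digit D (tuple_position r e) (Y (tuple_support r e) \<omega>) = \<omega> (comp_tuple r (Pair 0) e)"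
proof -
  let ?S = "tuple_support r e" and ?g = "comp_tuple r (\<lambda>i. (0::nat, elem_index (tuple_support r e) i)) e"
  have "comp_tuple r (lift_vertex (nth_elem ?S)) ?g = comp_tuple r (Pair 0) e"
    unfolding comp_tuple_comp
    by (rule comp_tuple_cong) (auto simp: lift_vertex_def nth_elem_elem_index tuple_support_def)
  then show ?thesis
    unfolding tuple_position_def clip_digit_def
    using digit_Y[OF assms tuple_position_block[of r e]] value_less[OF assms, of "comp_tuple r (Pair 0) e"] by simp
qed

section \<open>Joint law of the codes as a function of independent seeds\<close>

context vertex_process
begin

definition "\<nu> = distr P borel (Y {})"

lemma sets_nu[simp, measurable_cong]: "sets \<nu> = sets borel" by (simp add: \<nu>_def)

lemma seed_empty: "seed_measure \<nu> {} = \<nu>" by (simp add: seed_measure_def)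

lemma prob_space_seed: "prob_space (seed_measure \<nu> T)"
  unfolding seed_measure_def \<nu>_def by (auto intro!: prob_space_distr prob_space_unit_uniform)

text \<open>Down-closed families are those for which the recursion needs no seeds from outside the
  family.\<close>

definition is_coding :: "(nat \<Rightarrow> (nat set \<Rightarrow> real) \<times> real \<Rightarrow> real) \<Rightarrow> bool" where
  "is_coding F \<longleftrightarrow> (\<forall>k\<in>{1..r}. F k \<in> borel_measurable (codes_space k \<Otimes>\<^sub>M unit_uniform)) \<and>
    (\<forall>\<A>. finite \<A> \<longrightarrow> down_closed \<A> \<longrightarrow> (\<forall>A\<in>\<A>. finite A \<and> card A \<le> r) \<longrightarrow>
      distr P (\<Pi>\<^sub>M A\<in>\<A>. borel) (\<lambda>\<omega>. \<lambda>A\<in>\<A>. Y A \<omega>) =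
      distr (\<Pi>\<^sub>M A\<in>\<A>. seed_measure \<nu> A) (\<Pi>\<^sub>M A\<in>\<A>. borel) (\<lambda>u. \<lambda>A\<in>\<A>. coded_value F A u))"

text \<open>Induction over the family, taking off a set \<open>S\<close> of maximal size: the rest
  is still down-closed, contains all proper subsets of \<open>S\<close> and no set larger than
  \<open>S\<close>, exactly the situation of \<open>block_code_transition\<close>.\<close>

theorem ex_coding: "\<exists>F. is_coding F"
proof -
  obtain F where "\<forall>k\<in>{1..r}. F k \<in> borel_measurable (codes_space k \<Otimes>\<^sub>M unit_uniform) \<and>
    (\<forall>S \<A>. finite S \<longrightarrow> card S = k \<longrightarrow> S \<notin> \<A> \<longrightarrow> (\<forall>A\<in>\<A>. finite A \<and> card A \<le> k) \<longrightarrow> (\<forall>B. B \<subset> S \<longrightarrow> B \<in> \<A>) \<longrightarrow>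
      distr P ((\<Pi>\<^sub>M A\<in>\<A>. borel) \<Otimes>\<^sub>M borel) (\<lambda>\<omega>. (\<lambda>A\<in>\<A>. Y A \<omega>, Y S \<omega>)) =
      distr (distr P (\<Pi>\<^sub>M A\<in>\<A>. borel) (\<lambda>\<omega>. \<lambda>A\<in>\<A>. Y A \<omega>) \<Otimes>\<^sub>M unit_uniform) ((\<Pi>\<^sub>M A\<in>\<A>. borel) \<Otimes>\<^sub>M borel)
        (\<lambda>(y, u). (y, F k (\<lambda>B\<in>proper_subsets k. y (nth_elem S ` B), u))))"
    using block_code_transition by (rule exE)
  then have F: "\<And>k. k \<in> {1..r} \<Longrightarrow> F k \<in> borel_measurable (codes_space k \<Otimes>\<^sub>M unit_uniform)"
    and trans: "\<And>S \<A>. finite S \<Longrightarrow> card S \<in> {1..r} \<Longrightarrow> S \<notin> \<A> \<Longrightarrow> (\<forall>A\<in>\<A>. finite A \<and> card A \<le> card S) \<Longrightarrow> (\<forall>B. B \<subset> S \<longrightarrow> B \<in> \<A>) \<Longrightarrow>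
      distr P ((\<Pi>\<^sub>M A\<in>\<A>. borel) \<Otimes>\<^sub>M borel) (\<lambda>\<omega>. (\<lambda>A\<in>\<A>. Y A \<omega>, Y S \<omega>)) =
      distr (distr P (\<Pi>\<^sub>M A\<in>\<A>. borel) (\<lambda>\<omega>. \<lambda>A\<in>\<A>. Y A \<omega>) \<Otimes>\<^sub>M unit_uniform) ((\<Pi>\<^sub>M A\<in>\<A>. borel) \<Otimes>\<^sub>M borel)
        (\<lambda>(y, u). (y, F (card S) (\<lambda>B\<in>proper_subsets (card S). y (nth_elem S ` B), u)))"
    by blast+
  have "distr P (\<Pi>\<^sub>M A\<in>\<A>. borel) (\<lambda>\<omega>. \<lambda>A\<in>\<A>. Y A \<omega>) =
      distr (\<Pi>\<^sub>M A\<in>\<A>. seed_measure \<nu> A) (\<Pi>\<^sub>M A\<in>\<A>. borel) (\<lambda>u. \<lambda>A\<in>\<A>. coded_value F A u)"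
    if "finite \<A>" "down_closed \<A>" "\<forall>A\<in>\<A>. finite A \<and> card A \<le> r" for \<A>
    using that
  proof (induction "card \<A>" arbitrary: \<A> rule: less_induct)
    case less
    show ?case
    proof (cases "\<A> = {}")
      case True
      interpret E: prob_space "\<Pi>\<^sub>M A\<in>{}. seed_measure \<nu> A"
        by (intro prob_space_PiM prob_space_seed)
      show ?thesis using True by (simp add: restrict_def distr_const E.distr_const space_PiM)
    next
      case False
      obtain S where S: "S \<in> \<A>" and max: "\<And>A. A \<in> \<A> \<Longrightarrow> card A \<le> card S"
      proof -
        have "Max (card ` \<A>) \<in> card ` \<A>" using less.prems False by (intro Max_in) auto
        then obtain S where "S \<in> \<A>" "card S = Max (card ` \<A>)" by auto
        then show ?thesis using less.prems(1) by (intro that[of S]) auto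
      qed
      define \<B> where "\<B> = \<A> - {S}"
      have \<A>: "\<A> = insert S \<B>" "S \<notin> \<B>" using S by (auto simp: \<B>_def)
      have finS: "finite S" "card S \<le> r" using S less.prems by auto
      have "down_closed \<B>"
        unfolding down_closed_def
      proof (intro ballI allI impI)
        fix A B assume AB: "A \<in> \<B>" "B \<subseteq> A"
        then have "B \<in> \<A>" using less.prems(2) by (auto simp: down_closed_def \<A>)
        moreover have "B \<noteq> S"
        proof
          assume "B = S"
          moreover have "finite A" "card A \<le> card S" using AB less.prems max by (auto simp: \<B>_def)
          ultimately have "S = A" using AB by (intro card_seteq) auto
          then show False using AB \<A> by auto
        qed
        ultimately show "B \<in> \<B>" by (simp add: \<B>_def)
      qed
      moreover have "card \<B> < card \<A>" using S less.prems unfolding \<B>_def by (intro card_Diff1_less)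
      ultimately have IH: "distr P (\<Pi>\<^sub>M A\<in>\<B>. borel) (\<lambda>\<omega>. \<lambda>A\<in>\<B>. Y A \<omega>) =
        distr (\<Pi>\<^sub>M A\<in>\<B>. seed_measure \<nu> A) (\<Pi>\<^sub>M A\<in>\<B>. borel) (\<lambda>u. \<lambda>A\<in>\<B>. coded_value F A u)"
        using less.prems by (intro less.hyps) (auto simp: \<B>_def)
      show ?thesis
      proof (cases "S = {}")
        case True
        \<comment> \<open>A set of maximal size can be empty only if it is the whole family; its
          code has law \<open>\<nu>\<close> by definition.\<close>
        have "\<B> = {}"
        proof -
          have "A = {}" if "A \<in> \<A>" for A using max[OF that] True less.prems that by auto
          then show ?thesis using True by (auto simp: \<B>_def)
        qed
        with \<A> True have A: "\<A> = {{}}" by simp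
        have [measurable]: "(\<lambda>x::real. \<lambda>A\<in>{{}}. x) \<in> measurable borel (\<Pi>\<^sub>M A\<in>{{}}. borel)"
          by (intro measurable_restrict) simp
        have "distr P (\<Pi>\<^sub>M A\<in>{{}}. borel) (\<lambda>\<omega>. \<lambda>A\<in>{{}}. Y A \<omega>) = distr P (\<Pi>\<^sub>M A\<in>{{}}. borel) (\<lambda>\<omega>. \<lambda>A\<in>{{}}. Y {} \<omega>)"
          by (intro distr_cong) (auto simp: fun_eq_iff)
        also have "\<dots> = distr \<nu> (\<Pi>\<^sub>M A\<in>{{}}. borel) (\<lambda>x. \<lambda>A\<in>{{}}. x)"
          unfolding \<nu>_def by (subst distr_distr) (auto simp: comp_def)
        also have "\<nu> = distr (\<Pi>\<^sub>M A\<in>{{}}. seed_measure \<nu> A) \<nu> (\<lambda>u. u {})"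
          using distr_PiM_component[of "{{}}" "seed_measure \<nu>" "{}", OF prob_space_seed]
          by (simp only: seed_empty singletonI)
        also have "distr \<dots> (\<Pi>\<^sub>M A\<in>{{}}. borel) (\<lambda>x. \<lambda>A\<in>{{}}. x) =
          distr (\<Pi>\<^sub>M A\<in>{{}}. seed_measure \<nu> A) (\<Pi>\<^sub>M A\<in>{{}}. borel) ((\<lambda>x. \<lambda>A\<in>{{}}. x) \<circ> (\<lambda>u. u {}))"
        proof (rule distr_distr)
          show "(\<lambda>u. u {}) \<in> measurable (\<Pi>\<^sub>M A\<in>{{}}. seed_measure \<nu> A) \<nu>"
            using measurable_component_singleton[of "{}" "{{}}" "seed_measure \<nu>"] by (simp only: seed_empty singletonI)
        qed (subst measurable_cong_sets[OF sets_nu refl], measurable)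
        also have "\<dots> = distr (\<Pi>\<^sub>M A\<in>{{}}. seed_measure \<nu> A) (\<Pi>\<^sub>M A\<in>{{}}. borel) (\<lambda>u. \<lambda>A\<in>{{}}. coded_value F A u)"
          by (intro distr_cong) (auto simp: fun_eq_iff)
        finally show ?thesis unfolding A .
      next
        case False
        let ?k = "card S"
        have k: "?k \<in> {1..r}" using False finS by (auto simp: Suc_le_eq card_gt_0_iff)
        let ?SB = "\<Pi>\<^sub>M A\<in>\<B>. seed_measure \<nu> A"
        let ?Q = "\<Pi>\<^sub>M A\<in>\<B>. (borel :: real measure)" and ?R = "\<Pi>\<^sub>M A\<in>\<A>. (borel :: real measure)"
        let ?y = "\<lambda>u. \<lambda>A\<in>\<B>. coded_value F A u"
        let ?f = "\<lambda>(y, u). (y, F ?k (\<lambda>B\<in>proper_subsets ?k. y (nth_elem S ` B), u))"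
        let ?upd = "\<lambda>(y, z). y(S := z :: real)"
        have subB: "nth_elem S ` B \<in> \<B>" if "B \<in> proper_subsets ?k" for B
        proof -
          have "nth_elem S ` B \<in> \<A>"
            using less.prems(2) nth_elem_image_subset[OF finS(1) that] S by (auto simp: down_closed_def)
          moreover have "nth_elem S ` B \<noteq> S" using card_nth_elem_image_less[OF that finS(1) False] by auto
          ultimately show ?thesis by (simp add: \<B>_def)
        qed
        have updm: "?upd \<in> measurable (?Q \<Otimes>\<^sub>M borel) ?R"
          unfolding \<A>(1)
          by (subst case_prod_beta', rule measurable_fun_upd[where J=\<B>]) auto
        have fm: "?f \<in> measurable (?Q \<Otimes>\<^sub>M unit_uniform) (?Q \<Otimes>\<^sub>M borel)"
        proof -
          have "(\<lambda>x. (\<lambda>B\<in>proper_subsets ?k. fst x (nth_elem S ` B), snd x)) \<in>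
            measurable (?Q \<Otimes>\<^sub>M unit_uniform) (codes_space ?k \<Otimes>\<^sub>M unit_uniform)"
            using subB by (intro measurable_Pair measurable_restrict measurable_compose[OF measurable_fst measurable_component_singleton] measurable_snd) auto
          from measurable_compose[OF this F[OF k]]
          show ?thesis unfolding case_prod_beta' by (intro measurable_Pair measurable_fst)
        qed
        have ym: "?y \<in> measurable ?SB ?Q"
          using less.prems \<A> \<open>down_closed \<B>\<close>
          by (intro measurable_restrict borel_measurable_coded_value[where r=r] F) auto
        interpret B: prob_space ?SB by (intro prob_space_PiM prob_space_seed)
        interpret U: prob_space unit_uniform by (rule prob_space_unit_uniform)
        interpret BU: pair_prob_space ?SB unit_uniform ..
        have "distr P ?R (\<lambda>\<omega>. \<lambda>A\<in>\<A>. Y A \<omega>) = distr (distr P (?Q \<Otimes>\<^sub>M borel) (\<lambda>\<omega>. (\<lambda>A\<in>\<B>. Y A \<omega>, Y S \<omega>))) ?R ?upd"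
        proof -
          have m: "(\<lambda>\<omega>. (\<lambda>A\<in>\<B>. Y A \<omega>, Y S \<omega>)) \<in> measurable P (?Q \<Otimes>\<^sub>M borel)"
            by (intro measurable_Pair measurable_restrict measurable_Y)
          show ?thesis
            unfolding distr_distr[OF updm m]
            by (intro distr_cong) (auto simp: \<A> fun_eq_iff)
        qed
        also have "distr P (?Q \<Otimes>\<^sub>M borel) (\<lambda>\<omega>. (\<lambda>A\<in>\<B>. Y A \<omega>, Y S \<omega>)) =
          distr (distr P ?Q (\<lambda>\<omega>. \<lambda>A\<in>\<B>. Y A \<omega>) \<Otimes>\<^sub>M unit_uniform) (?Q \<Otimes>\<^sub>M borel) ?f"
        proof (rule trans)
          show "\<forall>B. B \<subset> S \<longrightarrow> B \<in> \<B>"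
            using less.prems(2) S by (auto simp: down_closed_def \<B>_def)
          show "\<forall>A\<in>\<B>. finite A \<and> card A \<le> card S" using max less.prems by (auto simp: \<B>_def)
        qed (use k finS \<A> in auto)
        also have "distr P ?Q (\<lambda>\<omega>. \<lambda>A\<in>\<B>. Y A \<omega>) \<Otimes>\<^sub>M unit_uniform =
           distr ?SB ?Q ?y \<Otimes>\<^sub>M distr unit_uniform unit_uniform (\<lambda>x. x)"
          unfolding IH by simp
        also have "\<dots> = distr (?SB \<Otimes>\<^sub>M unit_uniform) (?Q \<Otimes>\<^sub>M unit_uniform) (\<lambda>(x, u). (?y x, u))"
          by (rule pair_measure_distr) (use ym in \<open>auto intro: prob_space_imp_sigma_finite prob_space_unit_uniform\<close>)
        also have "distr (distr \<dots> (?Q \<Otimes>\<^sub>M borel) ?f) ?R ?upd =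
          distr (?SB \<Otimes>\<^sub>M unit_uniform) ?R (\<lambda>x. ?upd (?f ((\<lambda>(x, u). (?y x, u)) x)))"
        proof -
          have ym': "(\<lambda>(x, u). (?y x, u)) \<in> measurable (?SB \<Otimes>\<^sub>M unit_uniform) (?Q \<Otimes>\<^sub>M unit_uniform)"
            unfolding case_prod_beta' by (intro measurable_Pair measurable_compose[OF measurable_fst ym] measurable_snd)
          show ?thesis
            unfolding distr_distr[OF fm ym'] by (subst distr_distr[OF updm]) (auto simp: comp_def intro: measurable_comp[OF ym' fm, unfolded comp_def])
        qed
        also have "\<dots> = distr (?SB \<Otimes>\<^sub>M unit_uniform) ?R (\<lambda>(x, u). \<lambda>A\<in>\<A>. coded_value F A (x(S := u)))"
        proof (intro distr_cong refl)
          fix x assume "x \<in> space (?SB \<Otimes>\<^sub>M unit_uniform)"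
          obtain w u where x: "x = (w, u)" by (cases x)
          \<comment> \<open>Codes of sets in \<open>\<B>\<close> depend only on seeds of sets in
            \<open>\<B>\<close>, so they ignore the seed of \<open>S\<close>.\<close>
          have cB: "coded_value F A (w(S := u)) = coded_value F A w" if "A \<in> \<B>" for A
          proof (rule coded_value_cong)
            show "finite A" using that less.prems by (auto simp: \<B>_def)
            fix T assume "T \<subseteq> A"
            then have "T \<in> \<B>" using that \<open>down_closed \<B>\<close> by (auto simp: down_closed_def)
            then show "(w(S := u)) T = w T" using \<A> by auto
          qed
          have cS: "coded_value F S (w(S := u)) = F ?k (\<lambda>B\<in>proper_subsets ?k. ?y w (nth_elem S ` B), u)"
          proof -
            have "(\<lambda>B\<in>proper_subsets ?k. coded_value F (nth_elem S ` B) (w(S := u))) = (\<lambda>B\<in>proper_subsets ?k. ?y w (nth_elem S ` B))"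
              using subB cB by (auto simp: fun_eq_iff)
            then show ?thesis using finS False by (simp add: coded_value_nonempty)
          qed
          show "?upd (?f ((\<lambda>(x, u). (?y x, u)) x)) = (\<lambda>(x, u). \<lambda>A\<in>\<A>. coded_value F A (x(S := u))) x"
            using \<A> by (auto simp: x fun_eq_iff cB cS)
        qed
        \<comment> \<open>The factors are swapped to match the form in which a product measure is
          extended by one coordinate.\<close>
        also have "\<dots> = distr (unit_uniform \<Otimes>\<^sub>M ?SB) ?R (\<lambda>(u, x). \<lambda>A\<in>\<A>. coded_value F A (x(S := u)))"
        proof -
          have cm: "(\<lambda>u. \<lambda>A\<in>\<A>. coded_value F A u) \<in> measurable (\<Pi>\<^sub>M A\<in>\<A>. seed_measure \<nu> A) ?R"
            using less.prems by (intro measurable_restrict borel_measurable_coded_value[where r=r] F) auto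
          have "(\<lambda>x. (fst x)(S := snd x)) \<in> measurable (?SB \<Otimes>\<^sub>M unit_uniform) (\<Pi>\<^sub>M A\<in>\<A>. seed_measure \<nu> A)"
            unfolding \<A>(1) using False
            by (intro measurable_fun_upd[where J=\<B>]) (auto simp: seed_measure_def)
          from measurable_compose[OF this cm]
          have "(\<lambda>(x, u). \<lambda>A\<in>\<A>. coded_value F A (x(S := u))) \<in> measurable (?SB \<Otimes>\<^sub>M unit_uniform) ?R"
            by (simp add: case_prod_beta')
          then show ?thesis
            by (subst BU.distr_pair_swap, subst distr_distr) (auto simp: comp_def case_prod_beta' measurable_pair_swap')
        qed
        also have "\<dots> = distr (distr (unit_uniform \<Otimes>\<^sub>M ?SB) (\<Pi>\<^sub>M A\<in>\<A>. seed_measure \<nu> A) (\<lambda>(x, X). X(S := x))) ?R (\<lambda>u. \<lambda>A\<in>\<A>. coded_value F A u)"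
        proof -
          have cm: "(\<lambda>u. \<lambda>A\<in>\<A>. coded_value F A u) \<in> measurable (\<Pi>\<^sub>M A\<in>\<A>. seed_measure \<nu> A) ?R"
            using less.prems by (intro measurable_restrict borel_measurable_coded_value[where r=r] F) auto
          have "(\<lambda>x. (snd x)(S := fst x)) \<in> measurable (unit_uniform \<Otimes>\<^sub>M ?SB) (\<Pi>\<^sub>M A\<in>\<A>. seed_measure \<nu> A)"
            unfolding \<A>(1) using False
            by (intro measurable_fun_upd[where J=\<B>]) (auto simp: seed_measure_def)
          then have um: "(\<lambda>(x, X). X(S := x)) \<in> measurable (unit_uniform \<Otimes>\<^sub>M ?SB) (\<Pi>\<^sub>M A\<in>\<A>. seed_measure \<nu> A)"
            by (simp add: case_prod_beta')
          show ?thesis unfolding distr_distr[OF cm um] by (simp add: comp_def case_prod_beta')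
        qed
        also have "distr (unit_uniform \<Otimes>\<^sub>M ?SB) (\<Pi>\<^sub>M A\<in>\<A>. seed_measure \<nu> A) (\<lambda>(x, X). X(S := x)) = (\<Pi>\<^sub>M A\<in>\<A>. seed_measure \<nu> A)"
        proof -
          have "seed_measure \<nu> S = unit_uniform" using False by (simp add: seed_measure_def)
          then show ?thesis
            using distr_pair_PiM_eq_PiM[of \<B> "seed_measure \<nu>" S, OF prob_space_seed prob_space_seed]
            by (simp only: \<A>(1))
        qed
        finally show ?thesis .
      qed
    qed
  qed
  then show ?thesis using F unfolding is_coding_def by (intro exI[of _ F]) simp
qed

end

section \<open>Freezing the seed of the empty set\<close>

context vertex_process
begin

definition actual_event :: "(nat \<Rightarrow> nat) set \<Rightarrow> ((nat \<Rightarrow> nat) \<Rightarrow> nat) \<Rightarrow> ((nat \<Rightarrow> nat \<times> nat) \<Rightarrow> nat) set" where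
  "actual_event T a = {\<omega> \<in> space P. \<forall>e\<in>T. \<omega> (comp_tuple r (Pair 0) e) = a e}"

lemma actual_event_eq_cylinder:
  assumes T: "T \<subseteq> all_tuples r" "a \<in> T \<rightarrow> {..<D}"
  obtains b where "b \<in> comp_tuple r (Pair 0) ` T \<rightarrow>\<^sub>E {..<D}"
    "actual_event T a = cylinder (all_tuples r) D (comp_tuple r (Pair 0) ` T) b"
    "\<And>e. e \<in> T \<Longrightarrow> b (comp_tuple r (Pair 0) e) = a e"
proof -
  let ?J = "comp_tuple r (Pair (0::nat)) ` T :: (nat \<Rightarrow> nat \<times> nat) set"
  have inj: "inj_on (comp_tuple r (Pair (0::nat))) T"
  proof (rule inj_onI)
    fix e f :: "nat \<Rightarrow> nat" assume "e \<in> T" "f \<in> T" and eq: "comp_tuple r (Pair (0::nat)) e = comp_tuple r (Pair 0) f"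
    moreover have "e j = f j" if "j < r" for j using fun_cong[OF eq, of j] that by simp
    ultimately show "e = f" using T(1)
      by (intro extensionalityI[of e "{..<r}" f]) (auto simp: all_tuples_def PiE_def)
  qed
  define b where "b = (\<lambda>e\<in>?J. a (the_inv_into T (comp_tuple r (Pair 0)) e))"
  have b: "b (comp_tuple r (Pair 0) e) = a e" if "e \<in> T" for e
    using that inj by (simp add: b_def the_inv_into_f_f)
  have "b \<in> ?J \<rightarrow>\<^sub>E {..<D}"
  proof (rule PiE_I)
    fix g assume "g \<in> ?J"
    then obtain e where "e \<in> T" "g = comp_tuple r (Pair 0) e" by auto
    then show "b g \<in> {..<D}" using b T by auto
  qed (simp add: b_def)
  moreover have "actual_event T a = cylinder (all_tuples r) D ?J b"
    by (auto simp: actual_event_def cylinder_def space_P b)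
  ultimately show ?thesis using b by (rule that)
qed

lemma sets_actual_event:
  assumes "finite T"
  shows "actual_event T a \<in> sets P"
  unfolding actual_event_def
proof (rule sets.sets_Collect_finite_All[OF _ assms])
  fix e assume "e \<in> T"
  have [measurable]: "(\<lambda>\<omega>. \<omega> (comp_tuple r (Pair 0) e)) \<in> measurable P (count_space UNIV)"
    by (subst measurable_cong_sets[OF sets_P refl]) (rule measurable_coordinate, simp)
  show "{\<omega> \<in> space P. \<omega> (comp_tuple r (Pair 0) e) = a e} \<in> sets P" by measurable
qed

text \<open>The block of the empty set avoids the actual vertices, so dissociation gives
  independence on cylinders. Conditioning on the event turns the product formula into an equality of
  two laws on the window \<open>block r 0\<close>, and this reaches all events of
  \<open>Y {}\<close>.\<close>

lemma actual_event_indep_empty_code: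
  assumes T: "finite T" "T \<subseteq> all_tuples r" "a \<in> T \<rightarrow> {..<D}" and C: "C \<in> sets borel"
  shows "prob {\<omega> \<in> actual_event T a. Y {} \<omega> \<in> C} = prob (actual_event T a) * prob {\<omega> \<in> space P. Y {} \<omega> \<in> C}"
proof (cases "prob (actual_event T a) = 0")
  case True
  have "prob {\<omega> \<in> actual_event T a. Y {} \<omega> \<in> C} \<le> prob (actual_event T a)"
    by (intro finite_measure_mono sets_actual_event T) auto
  then show ?thesis using True by (simp add: antisym)
next
  case False
  let ?A = "actual_event T a" and ?K = "block r 0"
  let ?N = "PiM ?K (\<lambda>_. count_space {..<D})"
  note A = sets_actual_event[OF T(1), of a]
  obtain b where b: "b \<in> comp_tuple r (Pair 0) ` T \<rightarrow>\<^sub>E {..<D}"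
    "?A = cylinder (all_tuples r) D (comp_tuple r (Pair 0) ` T) b"
    using actual_event_eq_cylinder[OF T(2,3)] by metis
  have Ksub: "?K \<subseteq> all_tuples r" by (auto simp: block_def)
  have resm: "(\<lambda>\<omega>. restrict \<omega> ?K) \<in> measurable P ?N"
    by (subst measurable_cong_sets[OF sets_P refl]) (rule measurable_restrict_subset[OF Ksub])
  interpret Q: prob_space "uniform_measure P ?A"
    using False by (intro prob_space_uniform_measure) (auto simp: emeasure_eq_measure)
  have resm': "(\<lambda>\<omega>. restrict \<omega> ?K) \<in> measurable (uniform_measure P ?A) ?N"
    using resm by (simp cong: measurable_cong_sets)
  have eq: "distr (uniform_measure P ?A) ?N (\<lambda>\<omega>. restrict \<omega> ?K) = distr P ?N (\<lambda>\<omega>. restrict \<omega> ?K)"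
  proof (rule finite_valued_process_eqI[where I="?K" and D=D])
    show "finite_measure (distr (uniform_measure P ?A) ?N (\<lambda>\<omega>. restrict \<omega> ?K))"
      by (intro prob_space.finite_measure Q.prob_space_distr resm')
    fix J c assume J: "finite J" "J \<subseteq> ?K" and c: "c \<in> J \<rightarrow>\<^sub>E {..<D}"
    have pre: "(\<lambda>\<omega>. restrict \<omega> ?K) -` cylinder ?K D J c \<inter> space P = cylinder (all_tuples r) D J c"
    proof (intro equalityI subsetI)
      fix \<omega> assume "\<omega> \<in> (\<lambda>\<omega>. restrict \<omega> ?K) -` cylinder ?K D J c \<inter> space P"
      then show "\<omega> \<in> cylinder (all_tuples r) D J c"
        using J by (auto simp: cylinder_def space_P subset_eq)
    next
      fix \<omega> assume "\<omega> \<in> cylinder (all_tuples r) D J c"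
      then show "\<omega> \<in> (\<lambda>\<omega>. restrict \<omega> ?K) -` cylinder ?K D J c \<inter> space P"
        using J Ksub by (auto simp: cylinder_def space_P subset_eq)
    qed
    have cyl: "cylinder (all_tuples r) D J c \<in> sets P"
      using sets_cylinder[of J "all_tuples r" D c] J Ksub sets_P by auto
    have "emeasure (distr (uniform_measure P ?A) ?N (\<lambda>\<omega>. restrict \<omega> ?K)) (cylinder ?K D J c) =
      emeasure (uniform_measure P ?A) (cylinder (all_tuples r) D J c)"
      using J by (subst emeasure_distr[OF resm']) (auto intro!: sets_cylinder simp: pre)
    also have "\<dots> = emeasure P (?A \<inter> cylinder (all_tuples r) D J c) / emeasure P ?A"
      by (rule emeasure_uniform_measure[OF A cyl])
    also have "\<dots> = prob (?A \<inter> cylinder (all_tuples r) D J c) / prob ?A"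
      using False by (simp add: emeasure_eq_measure divide_ennreal zero_less_measure_iff)
    also have "prob (?A \<inter> cylinder (all_tuples r) D J c) = prob ?A * prob (cylinder (all_tuples r) D J c)"
      unfolding b(2)
    proof (rule dissociated)
      have 1: "fst v = 0" if "v \<in> (\<Union>e\<in>comp_tuple r (Pair (0::nat)) ` T. e ` {..<r})" for v :: "nat \<times> nat"
        using that by auto
      have 2: "fst v \<noteq> 0" if v: "v \<in> (\<Union>e\<in>J. e ` {..<r})" for v
      proof
        assume "fst v = 0"
        obtain g where g: "g \<in> J" "v \<in> g ` {..<r}" using v by auto
        have "{i. (0, i) \<in> g ` {..<r}} = {..<0}" using g(1) J by (auto simp: block_def)
        moreover have "snd v \<in> {i. (0, i) \<in> g ` {..<r}}"
          using g(2) \<open>fst v = 0\<close> by (metis mem_Collect_eq prod.collapse)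
        ultimately show False by simp
      qed
      show "(\<Union>e\<in>comp_tuple r (Pair 0) ` T. e ` {..<r}) \<inter> (\<Union>e\<in>J. e ` {..<r}) = {}"
        using 1 2 by blast
    qed (use T J Ksub b c in auto)
    also have "prob ?A * prob (cylinder (all_tuples r) D J c) / prob ?A = prob (cylinder (all_tuples r) D J c)"
      using False by simp
    also have "ennreal \<dots> = emeasure (distr P ?N (\<lambda>\<omega>. restrict \<omega> ?K)) (cylinder ?K D J c)"
      using J by (subst emeasure_distr[OF resm]) (auto intro!: sets_cylinder simp: pre emeasure_eq_measure)
    finally show "emeasure (distr (uniform_measure P ?A) ?N (\<lambda>\<omega>. restrict \<omega> ?K)) (cylinder ?K D J c) =
      emeasure (distr P ?N (\<lambda>\<omega>. restrict \<omega> ?K)) (cylinder ?K D J c)" .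
  qed simp_all
  \<comment> \<open>Tuples in the block of the empty set contain no actual vertex. Lifting does not
    move them, so \<open>Y {}\<close> depends on the restriction to that block only.\<close>
  have inK: "comp_tuple r (lift_vertex (nth_elem {})) (block_elem r 0 n) \<in> ?K" for n
  proof -
    have g: "block_elem r 0 n \<in> block r 0" by (intro block_elem_in) simp
    have "comp_tuple r (lift_vertex (nth_elem {})) (block_elem r 0 n) = comp_tuple r (\<lambda>v. v) (block_elem r 0 n)"
    proof (rule comp_tuple_cong)
      fix j assume "j < r"
      with g show "lift_vertex (nth_elem {}) (block_elem r 0 n j) = block_elem r 0 n j"
        by (cases rule: block_vertex_cases) (auto simp: lift_vertex_def)
    qed
    also have "\<dots> = block_elem r 0 n" using g by (intro comp_tuple_id) (auto simp: block_def)
    finally show ?thesis using g by simp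
  qed
  have Yres: "Y {} (restrict \<omega> ?K) = Y {} \<omega>" for \<omega>
    unfolding block_code_def using inK by simp
  have Ym: "Y {} \<in> borel_measurable ?N"
    unfolding block_code_def
  proof (rule borel_measurable_seq_code)
    fix n
    have "(\<lambda>\<omega>. \<omega> (comp_tuple r (lift_vertex (nth_elem {})) (block_elem r (card {}) n))) \<in> measurable ?N (count_space {..<D})"
      using inK[of n] by (intro measurable_component_singleton) simp
    then show "(\<lambda>\<omega>. \<omega> (comp_tuple r (lift_vertex (nth_elem {})) (block_elem r (card {}) n))) \<in> measurable ?N (count_space UNIV)"
      by (rule measurable_compose) simp
  qed
  let ?C = "Y {} -` C \<inter> space ?N"
  have Cm: "?C \<in> sets ?N" using Ym C by (rule measurable_sets)
  have pre: "(\<lambda>\<omega>. restrict \<omega> ?K) -` ?C \<inter> space P = {\<omega> \<in> space P. Y {} \<omega> \<in> C}"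
    using measurable_space[OF resm] by (auto simp: Yres)
  have C'm: "{\<omega> \<in> space P. Y {} \<omega> \<in> C} \<in> sets P" using C by measurable
  have "emeasure (uniform_measure P ?A) {\<omega> \<in> space P. Y {} \<omega> \<in> C} = emeasure P {\<omega> \<in> space P. Y {} \<omega> \<in> C}"
    using arg_cong[OF eq, of "\<lambda>M. emeasure M ?C"]
    by (simp only: emeasure_distr[OF resm Cm] emeasure_distr[OF resm' Cm] space_uniform_measure pre)
  then have "prob (?A \<inter> {\<omega> \<in> space P. Y {} \<omega> \<in> C}) / prob ?A = prob {\<omega> \<in> space P. Y {} \<omega> \<in> C}"
    using False by (simp add: emeasure_uniform_measure[OF A C'm] emeasure_eq_measure divide_ennreal zero_less_measure_iff)
  moreover have "?A \<inter> {\<omega> \<in> space P. Y {} \<omega> \<in> C} = {\<omega> \<in> ?A. Y {} \<omega> \<in> C}"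
    by (auto simp: actual_event_def)
  ultimately show ?thesis using False by (simp add: field_simps)
qed

text \<open>The bound \<open>r\<close> matches the index set of \<open>U_space\<close>; supports of
  tuples never exceed it.\<close>

definition seed_sets :: "nat \<Rightarrow> nat set set" where
  "seed_sets m = {A. A \<subseteq> {..<m} \<and> A \<noteq> {} \<and> card A \<le> r}"

lemma finite_seed_sets[simp]: "finite (seed_sets m)"
  by (rule finite_subset[of _ "Pow {..<m}"]) (auto simp: seed_sets_def)

lemma tuples_eq: "e \<in> tuples r m \<Longrightarrow> e \<in> all_tuples r"
  by (auto simp: tuples_def all_tuples_def)

lemma finite_tuples[simp]: "finite (tuples r m)"
  unfolding tuples_def by (intro finite_PiE) auto

lemma tuple_support_seed_sets: "e \<in> tuples r m \<Longrightarrow> tuple_support r e \<in> seed_sets m"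
proof -
  assume "e \<in> tuples r m"
  moreover have "0 \<in> {..<r}" using r_pos by simp
  ultimately show ?thesis
    using card_tuple_support[of r e] by (auto simp: tuple_support_def seed_sets_def tuples_def)
qed

lemma down_closed_seed_sets: "down_closed (insert {} (seed_sets m))"
  unfolding down_closed_def
proof (intro ballI allI impI)
  fix A B assume AB: "A \<in> insert {} (seed_sets m)" "B \<subseteq> A"
  then have "A \<subseteq> {..<m}" "card A \<le> r" by (auto simp: seed_sets_def)
  moreover from this AB have "card B \<le> card A" by (intro card_mono) (auto intro: finite_subset)
  ultimately show "B \<in> insert {} (seed_sets m)" using AB by (auto simp: seed_sets_def)
qed

text \<open>As a function of \<open>y\<close> the left-hand side is the conditional probability of
  the window event given \<open>Y {} = y\<close>. By independence it has the same integral over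
  every \<open>C\<close> as a constant, hence it is that constant almost everywhere.\<close>

lemma AE_coded_array:
  assumes F: "is_coding F" and a: "a \<in> tuples r m \<rightarrow>\<^sub>E {..<D}"
  shows "AE y in \<nu>. measure (\<Pi>\<^sub>M A\<in>seed_sets m. unit_uniform)
    {u \<in> space (\<Pi>\<^sub>M A\<in>seed_sets m. unit_uniform). \<forall>e\<in>tuples r m. coded_entry r D F e (u({} := y)) = a e} =
    prob (actual_event (tuples r m) a)"
proof -
  let ?T = "tuples r m" and ?W = "seed_sets m"
  let ?\<A> = "insert {} ?W"
  let ?SM = "\<Pi>\<^sub>M A\<in>?\<A>. seed_measure \<nu> A" and ?U = "\<Pi>\<^sub>M A\<in>?W. unit_uniform" and ?Q = "\<Pi>\<^sub>M A\<in>?\<A>. (borel :: real measure)"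
  have emp: "{} \<notin> ?W" by (simp add: seed_sets_def)
  have dc: "down_closed ?\<A>" by (rule down_closed_seed_sets)
  have \<A>: "\<forall>A\<in>?\<A>. finite A \<and> card A \<le> r" by (auto simp: seed_sets_def intro: finite_subset)
  have Fm: "\<And>k. k \<in> {1..r} \<Longrightarrow> F k \<in> borel_measurable (codes_space k \<Otimes>\<^sub>M unit_uniform)"
    and law: "distr P ?Q (\<lambda>\<omega>. \<lambda>A\<in>?\<A>. Y A \<omega>) = distr ?SM ?Q (\<lambda>u. \<lambda>A\<in>?\<A>. coded_value F A u)"
    using F dc \<A> by (auto simp: is_coding_def)
  interpret nu: prob_space \<nu> unfolding \<nu>_def by (intro prob_space_distr) simp
  interpret U: prob_space ?U by (intro prob_space_PiM prob_space_unit_uniform)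
  interpret nuU: pair_prob_space \<nu> ?U ..
  define E where "E = {x \<in> space (\<nu> \<Otimes>\<^sub>M ?U). \<forall>e\<in>?T. coded_entry r D F e ((snd x)({} := fst x)) = a e}"
  define q where "q y = emeasure ?U {u \<in> space ?U. \<forall>e\<in>?T. coded_entry r D F e (u({} := y)) = a e}" for y
  have cm: "(\<lambda>u. \<lambda>A\<in>?\<A>. coded_value F A u) \<in> measurable ?SM ?Q"
    using \<A> by (intro measurable_restrict borel_measurable_coded_value[where r=r] Fm dc) auto
  have um: "(\<lambda>(x, X). X({} := x)) \<in> measurable (\<nu> \<Otimes>\<^sub>M ?U) ?SM"
  proof -
    have "(\<lambda>x. (snd x)({} := fst x)) \<in> measurable (\<nu> \<Otimes>\<^sub>M (\<Pi>\<^sub>M A\<in>?W. seed_measure \<nu> A)) ?SM"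
      by (intro measurable_fun_upd[where J="?W"]) (auto simp: seed_measure_def)
    moreover have "(\<Pi>\<^sub>M A\<in>?W. seed_measure \<nu> A) = ?U"
      using emp by (intro PiM_cong) (auto simp: seed_measure_def)
    ultimately show ?thesis by (simp add: case_prod_beta')
  qed
  have pairSM: "?SM = distr (\<nu> \<Otimes>\<^sub>M ?U) ?SM (\<lambda>(x, X). X({} := x))"
  proof -
    have "(\<Pi>\<^sub>M A\<in>?W. seed_measure \<nu> A) = ?U"
      using emp by (intro PiM_cong) (auto simp: seed_measure_def)
    then show ?thesis
      using distr_pair_PiM_eq_PiM[of ?W "seed_measure \<nu>" "{}", OF prob_space_seed prob_space_seed] by (simp only: seed_empty)
  qed
  have main: "(\<integral>\<^sup>+y. q y * indicator C y \<partial>\<nu>) = (\<integral>\<^sup>+y. ennreal (prob (actual_event ?T a)) * indicator C y \<partial>\<nu>)"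
    and qm: "q \<in> borel_measurable \<nu>"
    if C: "C \<in> sets \<nu>" for C
  proof -
    have Cb[measurable]: "C \<in> sets borel" using C by simp
    \<comment> \<open>The event expressed through codes alone, so that it can be evaluated under
      \<open>P\<close> as well as under the seeds.\<close>
    define G where "G C = {y \<in> space ?Q. (\<forall>e\<in>?T. clip_digit D (tuple_position r e) (y (tuple_support r e)) = a e) \<and> y {} \<in> C}" for C :: "real set"
    have Gm: "G C \<in> sets ?Q" if [measurable]: "C \<in> sets borel" for C
    proof -
      have [measurable]: "(\<lambda>y. y {}) \<in> borel_measurable ?Q" by (intro measurable_component_singleton) simp
      have "{y \<in> space ?Q. \<forall>e\<in>?T. clip_digit D (tuple_position r e) (y (tuple_support r e)) = a e} \<in> sets ?Q"
      proof (rule sets.sets_Collect_finite_All)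
        fix e assume "e \<in> ?T"
        then have [measurable]: "(\<lambda>y. y (tuple_support r e)) \<in> borel_measurable ?Q"
          by (intro measurable_component_singleton) (simp add: tuple_support_seed_sets)
        show "{y \<in> space ?Q. clip_digit D (tuple_position r e) (y (tuple_support r e)) = a e} \<in> sets ?Q" by measurable
      qed simp
      moreover have "{y \<in> space ?Q. y {} \<in> C} \<in> sets ?Q" by measurable
      ultimately have "{y \<in> space ?Q. \<forall>e\<in>?T. clip_digit D (tuple_position r e) (y (tuple_support r e)) = a e} \<inter> {y \<in> space ?Q. y {} \<in> C} \<in> sets ?Q"
        by (rule sets.Int)
      then show ?thesis by (rule back_subst[where P="\<lambda>x. x \<in> sets ?Q"]) (auto simp: G_def)
    qed
    have Ymm: "(\<lambda>\<omega>. \<lambda>A\<in>?\<A>. Y A \<omega>) \<in> measurable P ?Q" by (intro measurable_restrict measurable_Y)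
    have pre2: "(\<lambda>(x, X). X({} := x)) -` ((\<lambda>u. \<lambda>A\<in>?\<A>. coded_value F A u) -` G C \<inter> space ?SM) \<inter> space (\<nu> \<Otimes>\<^sub>M ?U) = {x \<in> E. fst x \<in> C}" for C
    proof (intro equalityI subsetI)
      fix x assume x: "x \<in> (\<lambda>(x, X). X({} := x)) -` ((\<lambda>u. \<lambda>A\<in>?\<A>. coded_value F A u) -` G C \<inter> space ?SM) \<inter> space (\<nu> \<Otimes>\<^sub>M ?U)"
      obtain y u where xyu: "x = (y, u)" by (cases x)
      show "x \<in> {x \<in> E. fst x \<in> C}"
        using x by (simp add: xyu E_def G_def coded_entry_def tuple_support_seed_sets)
    next
      fix x assume x: "x \<in> {x \<in> E. fst x \<in> C}"
      obtain y u where xyu: "x = (y, u)" by (cases x)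
      have sx: "x \<in> space (\<nu> \<Otimes>\<^sub>M ?U)" using x by (simp add: E_def)
      have "(\<lambda>(x, X). X({} := x)) x \<in> space ?SM" by (rule measurable_space[OF um sx])
      moreover from measurable_space[OF cm this]
      have "(\<lambda>A\<in>?\<A>. coded_value F A ((\<lambda>(x, X). X({} := x)) x)) \<in> space ?Q" .
      ultimately show "x \<in> (\<lambda>(x, X). X({} := x)) -` ((\<lambda>u. \<lambda>A\<in>?\<A>. coded_value F A u) -` G C \<inter> space ?SM) \<inter> space (\<nu> \<Otimes>\<^sub>M ?U)"
        using x sx by (simp add: xyu E_def G_def coded_entry_def tuple_support_seed_sets)
    qed
    have Em: "{x \<in> E. fst x \<in> C} \<in> sets (\<nu> \<Otimes>\<^sub>M ?U)" if "C \<in> sets borel" for C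
      unfolding pre2[symmetric] by (intro measurable_sets[OF um] measurable_sets[OF cm] Gm that)
    have Em': "E \<in> sets (\<nu> \<Otimes>\<^sub>M ?U)" using Em[of UNIV] by simp
    have sec: "Pair y -` E = {u \<in> space ?U. \<forall>e\<in>?T. coded_entry r D F e (u({} := y)) = a e}" for y
      by (auto simp: E_def space_pair_measure \<nu>_def)
    show "q \<in> borel_measurable \<nu>"
      using U.measurable_emeasure_Pair[OF Em'] by (simp add: sec q_def[abs_def])
    have "(\<integral>\<^sup>+y. q y * indicator C y \<partial>\<nu>) = emeasure (\<nu> \<Otimes>\<^sub>M ?U) {x \<in> E. fst x \<in> C}"
    proof (subst U.emeasure_pair_measure_alt[OF Em[OF Cb]], intro nn_integral_cong)
      fix y
      have "Pair y -` {x \<in> E. fst x \<in> C} = (if y \<in> C then Pair y -` E else {})" by auto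
      then show "q y * indicator C y = emeasure ?U (Pair y -` {x \<in> E. fst x \<in> C})"
        by (simp add: sec q_def)
    qed
    also have "\<dots> = emeasure ?SM ((\<lambda>u. \<lambda>A\<in>?\<A>. coded_value F A u) -` G C \<inter> space ?SM)"
      unfolding pre2[symmetric] by (subst (2) pairSM, subst emeasure_distr[OF um]) (auto intro: measurable_sets[OF cm Gm[OF Cb]])
    also have "\<dots> = emeasure (distr ?SM ?Q (\<lambda>u. \<lambda>A\<in>?\<A>. coded_value F A u)) (G C)"
      by (rule emeasure_distr[OF cm Gm[OF Cb], symmetric])
    also have "\<dots> = emeasure P ((\<lambda>\<omega>. \<lambda>A\<in>?\<A>. Y A \<omega>) -` G C \<inter> space P)"
      unfolding law[symmetric] by (rule emeasure_distr[OF Ymm Gm[OF Cb]])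
    also have "(\<lambda>\<omega>. \<lambda>A\<in>?\<A>. Y A \<omega>) -` G C \<inter> space P = {\<omega> \<in> actual_event ?T a. Y {} \<omega> \<in> C}"
      by (auto simp: G_def actual_event_def tuple_support_seed_sets digit_Y_support space_PiM)
    also have "emeasure P \<dots> = prob (actual_event ?T a) * prob {\<omega> \<in> space P. Y {} \<omega> \<in> C}"
      using a tuples_eq unfolding emeasure_eq_measure
      by (subst actual_event_indep_empty_code) auto
    also have "\<dots> = ennreal (prob (actual_event ?T a)) * emeasure \<nu> C"
      unfolding \<nu>_def by (subst emeasure_distr)
        (auto simp: emeasure_eq_measure ennreal_mult' intro!: arg_cong2[where f="(*)"] arg_cong[where f="\<lambda>x. ennreal (prob x)"])
    also have "\<dots> = (\<integral>\<^sup>+y. ennreal (prob (actual_event ?T a)) * indicator C y \<partial>\<nu>)"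
      using C by (simp add: nn_integral_cmult_indicator)
    finally show "(\<integral>\<^sup>+y. q y * indicator C y \<partial>\<nu>) = \<dots>" .
  qed
  have "UNIV \<in> sets \<nu>" by simp
  note qm = qm[OF this]
  have q1: "q y \<le> 1" for y unfolding q_def by (rule U.emeasure_le_1)
  have "AE y in \<nu>. q y \<le> ennreal (prob (actual_event ?T a))"
    by (rule AE_le_of_set_nn_integral_le[OF qm]) (auto simp: main nu.emeasure_space_1 ennreal_mult_eq_top_iff)
  moreover have "AE y in \<nu>. ennreal (prob (actual_event ?T a)) \<le> q y"
  proof (rule AE_le_of_set_nn_integral_le[OF _ qm])
    have "(\<integral>\<^sup>+y. q y \<partial>\<nu>) \<le> (\<integral>\<^sup>+y. 1 \<partial>\<nu>)" by (intro nn_integral_mono q1)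
    also have "\<dots> < \<infinity>" by (simp add: nu.emeasure_space_1)
    finally show "(\<integral>\<^sup>+y. q y \<partial>\<nu>) \<noteq> \<infinity>" by simp
  qed (simp_all add: main)
  ultimately have "AE y in \<nu>. q y = ennreal (prob (actual_event ?T a))"
    by eventually_elim (rule antisym)
  then show ?thesis
    by eventually_elim (simp add: q_def U.emeasure_eq_measure)
qed

text \<open>There are countably many windows with prescribed values, so one \<open>y\<close> outside
  countably many null sets works for all of them at once.\<close>

theorem ex_seeded_coding:
  "\<exists>F y. (\<forall>k\<in>{1..r}. F k \<in> borel_measurable (codes_space k \<Otimes>\<^sub>M unit_uniform)) \<and>
    (\<forall>m. \<forall>a\<in>tuples r m \<rightarrow>\<^sub>E {..<D}. measure (\<Pi>\<^sub>M A\<in>seed_sets m. unit_uniform)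
      {u \<in> space (\<Pi>\<^sub>M A\<in>seed_sets m. unit_uniform). \<forall>e\<in>tuples r m. coded_entry r D F e (u({} := y)) = a e} =
      prob (actual_event (tuples r m) a))"
proof -
  obtain F where F: "is_coding F" using ex_coding by blast
  interpret nu: prob_space \<nu> unfolding \<nu>_def by (intro prob_space_distr) simp
  have "countable (tuples r m \<rightarrow>\<^sub>E {..<D})" for m by (intro countable_PiE) auto
  then have "AE y in \<nu>. \<forall>m. \<forall>a\<in>tuples r m \<rightarrow>\<^sub>E {..<D}. measure (\<Pi>\<^sub>M A\<in>seed_sets m. unit_uniform)
      {u \<in> space (\<Pi>\<^sub>M A\<in>seed_sets m. unit_uniform). \<forall>e\<in>tuples r m. coded_entry r D F e (u({} := y)) = a e} =
      prob (actual_event (tuples r m) a)"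
    using AE_coded_array[OF F] by (simp add: AE_all_countable AE_ball_countable)
  from eventually_happens'[OF nu.ae_filter_bot this] show ?thesis
    using F by (auto simp: is_coding_def)
qed

end

section \<open>Splitting a uniform variable\<close>

definition unit_rats :: "real set" where
  "unit_rats = {q \<in> \<rat>. 0 \<le> q \<and> q \<le> 1}"

lemma countable_unit_rats: "countable unit_rats"
  unfolding unit_rats_def by (rule countable_subset[OF _ countable_rat]) auto

lemma Inf_unit_rats_ge:
  assumes "0 \<le> x" "x \<le> 1"
  shows "Inf (insert 1 {q \<in> unit_rats. x \<le> q}) = x"
proof (rule antisym)
  have bdd: "bdd_below (insert 1 {q \<in> unit_rats. x \<le> q})"
    by (rule bdd_belowI[of _ 0]) (auto simp: unit_rats_def)
  show "x \<le> Inf (insert 1 {q \<in> unit_rats. x \<le> q})"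
    using assms by (intro cInf_greatest) auto
  show "Inf (insert 1 {q \<in> unit_rats. x \<le> q}) \<le> x"
  proof (rule dense_ge)
    fix y assume "x < y"
    show "Inf (insert 1 {q \<in> unit_rats. x \<le> q}) \<le> y"
    proof (cases "1 \<le> y")
      case True
      have "Inf (insert 1 {q \<in> unit_rats. x \<le> q}) \<le> 1" by (intro cInf_lower bdd) simp
      with True show ?thesis by simp
    next
      case False
      obtain q where "q \<in> \<rat>" "x < q" "q < y" using Rats_dense_in_real[OF \<open>x < y\<close>] by blast
      then have "q \<in> insert 1 {q \<in> unit_rats. x \<le> q}" using False assms by (auto simp: unit_rats_def)
      then have "Inf (insert 1 {q \<in> unit_rats. x \<le> q}) \<le> q" by (intro cInf_lower bdd)
      with \<open>q < y\<close> show ?thesis by simp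
    qed
  qed
qed

text \<open>Even and odd digits are the Dedekind cuts of the two coordinates against an enumeration
  of the rationals in [0,1]. This gives an injection of the square with measurable inverse and no
  ambiguous expansions.\<close>

definition pair_digit :: "real \<times> real \<Rightarrow> nat \<Rightarrow> nat" where
  "pair_digit p n = of_bool ((if even n then fst p else snd p) \<le> from_nat_into unit_rats (n div 2))"

definition pair_code :: "real \<times> real \<Rightarrow> real" where
  "pair_code p = seq_code 2 (pair_digit p)"

definition pair_decode :: "nat \<Rightarrow> real \<Rightarrow> real" where
  "pair_decode j z = Inf (insert 1 {q \<in> unit_rats. seq_digit 2 (2 * to_nat_on unit_rats q + j) z = 1})"

lemma pair_decode_less:
  "pair_decode j z < t \<longleftrightarrow> 1 < t \<or> (\<exists>q\<in>unit_rats. q < t \<and> seq_digit 2 (2 * to_nat_on unit_rats q + j) z = 1)"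
  unfolding pair_decode_def
  by (subst cInf_less_iff) (auto intro!: bdd_belowI[of _ 0] simp: unit_rats_def)

lemma borel_measurable_pair_decode[measurable]: "pair_decode j \<in> borel_measurable borel"
  unfolding borel_measurable_iff_less pair_decode_less
  using countable_unit_rats by (auto intro!: sets.sets_Collect_disj sets.sets_Collect_countable_Bex)

lemma pair_decode_bounds: "0 \<le> pair_decode j z" "pair_decode j z \<le> 1"
proof -
  have bdd: "bdd_below (insert 1 {q \<in> unit_rats. seq_digit 2 (2 * to_nat_on unit_rats q + j) z = 1})"
    by (rule bdd_belowI[of _ 0]) (auto simp: unit_rats_def)
  then show "pair_decode j z \<le> 1" unfolding pair_decode_def by (intro cInf_lower) auto
  show "0 \<le> pair_decode j z" unfolding pair_decode_def
    by (intro cInf_greatest) (auto simp: unit_rats_def)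
qed

lemma pair_digit_less: "pair_digit p n < 2"
  by (simp add: pair_digit_def)

lemma pair_decode_code:
  assumes "0 \<le> x" "x \<le> 1" "0 \<le> y" "y \<le> 1"
  shows "pair_decode 0 (pair_code (x, y)) = x" "pair_decode 1 (pair_code (x, y)) = y"
proof -
  have digit: "seq_digit 2 n (pair_code (x, y)) = pair_digit (x, y) n" for n
    unfolding pair_code_def by (rule seq_digit_code) (rule pair_digit_less)
  have "{q \<in> unit_rats. seq_digit 2 (2 * to_nat_on unit_rats q + 0) (pair_code (x, y)) = 1} = {q \<in> unit_rats. x \<le> q}"
    unfolding digit by (auto simp: pair_digit_def countable_unit_rats)
  then show "pair_decode 0 (pair_code (x, y)) = x"
    unfolding pair_decode_def using Inf_unit_rats_ge[OF assms(1,2)] by simp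
  have "{q \<in> unit_rats. seq_digit 2 (2 * to_nat_on unit_rats q + 1) (pair_code (x, y)) = 1} = {q \<in> unit_rats. y \<le> q}"
    unfolding digit by (auto simp: pair_digit_def countable_unit_rats)
  then show "pair_decode 1 (pair_code (x, y)) = y"
    unfolding pair_decode_def using Inf_unit_rats_ge[OF assms(3,4)] by simp
qed

lemma measurable_unit_uniformI:
  assumes "f \<in> borel_measurable M" "\<And>x. x \<in> space M \<Longrightarrow> 0 \<le> f x \<and> f x \<le> 1"
  shows "f \<in> measurable M unit_uniform"
  by (subst measurable_cong_sets[OF refl sets_unit_uniform_cong])
     (use assms in \<open>auto intro!: measurable_restrict_space2\<close>)

text \<open>A pair of independent uniform variables is packed into one real, whose law is realised
  as a function of a single uniform variable; unpacking that function gives the two halves.\<close>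

theorem ex_uniform_split:
  "\<exists>s t. s \<in> measurable unit_uniform unit_uniform \<and> t \<in> measurable unit_uniform unit_uniform \<and>
    distr unit_uniform (unit_uniform \<Otimes>\<^sub>M unit_uniform) (\<lambda>u. (s u, t u)) = unit_uniform \<Otimes>\<^sub>M unit_uniform"
proof -
  interpret U: prob_space unit_uniform by (rule prob_space_unit_uniform)
  interpret UU: pair_prob_space unit_uniform unit_uniform ..
  let ?M = "unit_uniform \<Otimes>\<^sub>M unit_uniform"
  have [measurable]: "pair_code \<in> borel_measurable ?M"
    unfolding pair_code_def
  proof (rule borel_measurable_seq_code)
    fix n :: nat
    have [measurable]: "(\<lambda>p. if even n then fst p else snd p) \<in> borel_measurable ?M"
      by (cases "even n") auto
    show "(\<lambda>x. pair_digit x n) \<in> measurable ?M (count_space UNIV)"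
      unfolding pair_digit_def by measurable
  qed
  have bounds: "0 \<le> pair_code p \<and> pair_code p \<le> 1" for p
    using seq_code_bounds[of "pair_digit p" 2] pair_digit_less by (simp add: pair_code_def less_imp_le)
  \<comment> \<open>Over a one-point space outsourcing yields a function of the uniform seed
    alone.\<close>
  define Nt where "Nt = count_space (UNIV :: unit set)"
  obtain F where F[measurable]: "F \<in> borel_measurable (Nt \<Otimes>\<^sub>M unit_uniform)"
    and FD: "distr ?M (Nt \<Otimes>\<^sub>M borel) (\<lambda>p. ((), pair_code p)) =
      distr (distr ?M Nt (\<lambda>_. ()) \<Otimes>\<^sub>M unit_uniform) (Nt \<Otimes>\<^sub>M borel) (\<lambda>(y, u). (y, F (y, u)))"
    using outsourcing[OF UU.prob_space_axioms, of "\<lambda>_. ()" Nt pair_code] bounds by (auto simp: Nt_def)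
  define h where "h u = F ((), u)" for u
  have [measurable]: "h \<in> borel_measurable unit_uniform"
    unfolding h_def by (rule measurable_compose[OF _ F]) (auto simp: Nt_def)
  have law: "distr ?M borel pair_code = distr unit_uniform borel h"
  proof -
    have "distr ?M borel pair_code = distr (distr ?M (Nt \<Otimes>\<^sub>M borel) (\<lambda>p. ((), pair_code p))) borel snd"
      by (subst distr_distr) (auto simp: comp_def Nt_def)
    also have "\<dots> = distr (distr ?M Nt (\<lambda>_. ()) \<Otimes>\<^sub>M unit_uniform) borel (\<lambda>x. h (snd x))"
      unfolding FD
    proof (subst distr_distr)
      show "(\<lambda>(y, u). (y, F (y, u))) \<in> measurable (distr ?M Nt (\<lambda>_. ()) \<Otimes>\<^sub>M unit_uniform) (Nt \<Otimes>\<^sub>M borel)"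
        by measurable
    qed (auto simp: comp_def case_prod_beta' h_def unit_eq intro!: distr_cong)
    also have "\<dots> = distr (distr (distr ?M Nt (\<lambda>_. ()) \<Otimes>\<^sub>M unit_uniform) unit_uniform snd) borel h"
      by (subst distr_distr) (auto simp: comp_def)
    also have "distr (distr ?M Nt (\<lambda>_. ()) \<Otimes>\<^sub>M unit_uniform) unit_uniform snd = unit_uniform"
    proof -
      interpret T: prob_space "distr ?M Nt (\<lambda>_. ())" by (rule UU.prob_space_distr) (simp add: Nt_def)
      interpret TU: pair_prob_space "distr ?M Nt (\<lambda>_. ())" unit_uniform ..
      show ?thesis
      proof (rule measure_eqI)
        fix A assume "A \<in> sets (distr (distr ?M Nt (\<lambda>_. ()) \<Otimes>\<^sub>M unit_uniform) unit_uniform snd)"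
        then have A: "A \<in> sets unit_uniform" by simp
        have "snd -` A \<inter> space (distr ?M Nt (\<lambda>_. ()) \<Otimes>\<^sub>M unit_uniform) = space (distr ?M Nt (\<lambda>_. ())) \<times> A"
          using sets.sets_into_space[OF A] by (auto simp: space_pair_measure)
        then show "emeasure (distr (distr ?M Nt (\<lambda>_. ()) \<Otimes>\<^sub>M unit_uniform) unit_uniform snd) A = emeasure unit_uniform A"
          unfolding emeasure_distr[OF measurable_snd A]
          using U.emeasure_pair_measure_Times[OF sets.top[of "distr ?M Nt (\<lambda>_. ())"] A]
          by (simp only: T.emeasure_space_1 mult_1)
      qed simp
    qed
    finally show ?thesis .
  qed
  define s where "s j u = pair_decode j (h u)" for j u
  have s: "s j \<in> measurable unit_uniform unit_uniform" for j
    unfolding s_def by (intro measurable_unit_uniformI) (auto simp: pair_decode_bounds)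
  have dec: "pair_decode j \<in> measurable borel unit_uniform" for j
    by (intro measurable_unit_uniformI) (auto simp: pair_decode_bounds)
  have "distr unit_uniform ?M (\<lambda>u. (s 0 u, s 1 u)) = distr (distr unit_uniform borel h) ?M (\<lambda>z. (pair_decode 0 z, pair_decode 1 z))"
    using dec by (subst distr_distr) (auto simp: comp_def s_def)
  also have "\<dots> = distr ?M ?M (\<lambda>p. (pair_decode 0 (pair_code p), pair_decode 1 (pair_code p)))"
    unfolding law[symmetric] using dec by (subst distr_distr) (auto simp: comp_def)
  also have "\<dots> = distr ?M ?M (\<lambda>p. p)"
    by (intro distr_cong) (auto simp: space_pair_measure space_unit_uniform pair_decode_code simp del: One_nat_def)
  also have "\<dots> = ?M" by simp
  finally show ?thesis using s by blast
qed

section \<open>Ordering the vertices\<close>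

text \<open>Dense ranks: ties share a rank, and the ranks fill an initial segment. The pattern thus
  records the order type of the positions, coincidences included.\<close>

definition rank_pattern :: "nat \<Rightarrow> (nat \<Rightarrow> 'b::linorder) \<Rightarrow> nat \<Rightarrow> nat" where
  "rank_pattern r x = (\<lambda>i\<in>{..<r}. card {y \<in> x ` {..<r}. y < x i})"

lemma rank_pattern_cong:
  fixes x :: "nat \<Rightarrow> 'b::linorder" and y :: "nat \<Rightarrow> 'c::linorder"
  assumes ord: "\<And>i j. i < r \<Longrightarrow> j < r \<Longrightarrow> x i < x j \<longleftrightarrow> y i < y j"
  shows "rank_pattern r x = rank_pattern r y"
  unfolding rank_pattern_def
proof (rule restrict_ext)
  fix i assume i: "i \<in> {..<r}"
  have eq: "x j = x k \<longleftrightarrow> y j = y k" if "j < r" "k < r" for j k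
    using ord[OF that] ord[OF that(2,1)] by (metis linorder_neq_iff)
  \<comment> \<open>\<open>f\<close> sends a value of \<open>x\<close> to the value of
    \<open>y\<close> at the same position; this is well defined because ties agree.\<close>
  define f where "f a = y (SOME j. j < r \<and> x j = a)" for a
  have f: "f (x j) = y j" if "j < r" for j
  proof -
    have "(SOME k. k < r \<and> x k = x j) < r \<and> x (SOME k. k < r \<and> x k = x j) = x j"
      by (rule someI[of _ j]) (use that in simp)
    then show ?thesis using eq[of "SOME k. k < r \<and> x k = x j" j] that by (simp add: f_def)
  qed
  have "bij_betw f {a \<in> x ` {..<r}. a < x i} {b \<in> y ` {..<r}. b < y i}"
    unfolding bij_betw_def
  proof
    show "inj_on f {a \<in> x ` {..<r}. a < x i}"
      by (rule inj_onI) (auto simp: f eq)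
    show "f ` {a \<in> x ` {..<r}. a < x i} = {b \<in> y ` {..<r}. b < y i}"
    proof (intro equalityI subsetI)
      fix b assume "b \<in> {b \<in> y ` {..<r}. b < y i}"
      then obtain j where j: "j < r" "b = y j" "y j < y i" by auto
      then have "x j < x i" using ord i by auto
      then show "b \<in> f ` {a \<in> x ` {..<r}. a < x i}" using j f by (auto intro!: image_eqI[of _ _ "x j"])
    qed (use f ord i in auto)
  qed
  then show "card {a \<in> x ` {..<r}. a < x i} = card {b \<in> y ` {..<r}. b < y i}"
    by (rule bij_betw_same_card)
qed

lemma rank_pattern_eq_elem_index:
  "i < r \<Longrightarrow> rank_pattern r e i = elem_index (tuple_support r e) (e i)"
  by (simp add: rank_pattern_def elem_index_def tuple_support_def)

lemma rank_pattern_support: "tuple_support r (rank_pattern r (e :: nat \<Rightarrow> nat)) = {..<card (tuple_support r e)}"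
proof -
  have "tuple_support r (rank_pattern r e) = elem_index (tuple_support r e) ` tuple_support r e"
    by (force simp: tuple_support_def[of r "rank_pattern r e"] rank_pattern_eq_elem_index image_iff tuple_support_def[of r e])
  then show ?thesis by (simp add: elem_index_image)
qed

lemma elem_index_lessThan: "i < k \<Longrightarrow> elem_index {..<k} i = i"
proof -
  assume "i < k"
  then have "{x \<in> {..<k}. x < i} = {..<i}" by auto
  then show ?thesis by (simp add: elem_index_def)
qed

lemma tuple_position_rank_pattern: "tuple_position r (rank_pattern r e) = tuple_position r e"
proof -
  let ?k = "card (tuple_support r e)"
  have lt: "elem_index (tuple_support r e) (e j) < ?k" if "j < r" for j
    using that elem_index_image[of "tuple_support r e"] by (auto simp: tuple_support_def)
  have "comp_tuple r (\<lambda>i. (0::nat, elem_index {..<?k} i)) (rank_pattern r e) =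
    comp_tuple r (\<lambda>i. (0, elem_index (tuple_support r e) i)) e"
    by (rule comp_tuple_cong) (simp add: rank_pattern_eq_elem_index elem_index_lessThan lt)
  then show ?thesis unfolding tuple_position_def rank_pattern_support by simp
qed

text \<open>An order embedding carries the enumeration of each set to that of its image, so the two
  recursions run in parallel.\<close>

lemma coded_value_relabel:
  "finite S \<Longrightarrow> strict_mono_on S f \<Longrightarrow> coded_value F (f ` S) v = coded_value F S (\<lambda>T. v (f ` T))"
proof (induction "card S" arbitrary: S rule: less_induct)
  case less
  show ?case
  proof (cases "S = {}")
    case False
    have card: "card (f ` S) = card S"
      using less.prems by (intro card_image strict_mono_on_imp_inj_on)
    have "coded_value F (nth_elem (f ` S) ` B) v = coded_value F (nth_elem S ` B) (\<lambda>T. v (f ` T))"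
      if B: "B \<in> proper_subsets (card S)" for B
    proof -
      have "nth_elem (f ` S) ` B = f ` nth_elem S ` B"
        unfolding image_image using B less.prems
        by (intro image_cong refl nth_elem_of_strict_mono_image) (auto simp: proper_subsets_def)
      moreover have "nth_elem S ` B \<subseteq> S" using nth_elem_image_subset[OF less.prems(1) B] .
      ultimately show ?thesis
        using card_nth_elem_image_less[OF B less.prems(1) False] less.prems
        by (auto intro!: less.hyps intro: finite_subset simp: strict_mono_on_def subset_eq)
    qed
    then show ?thesis using False less.prems by (simp add: coded_value_nonempty card cong: restrict_cong)
  qed simp
qed

definition pattern_entry ::
  "nat \<Rightarrow> nat \<Rightarrow> (nat \<Rightarrow> (nat set \<Rightarrow> real) \<times> real \<Rightarrow> real) \<Rightarrow> real \<Rightarrow> (nat \<Rightarrow> 'b::linorder) \<Rightarrow> (nat set \<Rightarrow> real) \<Rightarrow> nat" where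
  "pattern_entry r D F y x V = coded_entry r D F (rank_pattern r x)
     (\<lambda>T. let B = {i. i < r \<and> rank_pattern r x i \<in> T} in if B = {} then y else V B)"

lemma pattern_entry_cong:
  "(\<And>B. B \<subseteq> {..<r} \<Longrightarrow> B \<noteq> {} \<Longrightarrow> V B = V' B) \<Longrightarrow> pattern_entry r D F y x V = pattern_entry r D F y x V'"
proof -
  assume V: "\<And>B. B \<subseteq> {..<r} \<Longrightarrow> B \<noteq> {} \<Longrightarrow> V B = V' B"
  have "(let B = {i. i < r \<and> rank_pattern r x i \<in> T} in if B = {} then y else V B) =
    (let B = {i. i < r \<and> rank_pattern r x i \<in> T} in if B = {} then y else V' B)" for T
    using V[of "{i. i < r \<and> rank_pattern r x i \<in> T}"] by (auto simp only: Let_def split: if_split)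
  then show ?thesis unfolding pattern_entry_def by simp
qed

lemma pattern_entry_pattern_cong:
  "rank_pattern r x = rank_pattern r x' \<Longrightarrow> pattern_entry r D F y x V = pattern_entry r D F y x' V"
  by (simp add: pattern_entry_def)

text \<open>When the vertices themselves serve as ordering data, passing to ranks is an order
  isomorphism of the support, and the recursion is invariant under it.\<close>

lemma pattern_entry_eq_coded_entry:
  fixes e :: "nat \<Rightarrow> nat"
  shows "pattern_entry r D F y e V =
    coded_entry r D F e (\<lambda>T. let B = {i. i < r \<and> e i \<in> T} in if B = {} then y else V B)"
proof -
  let ?S = "tuple_support r e" and ?\<rho> = "rank_pattern r e"
  let ?k = "card ?S"
  let ?u = "\<lambda>T. let B = {i. i < r \<and> e i \<in> T} in if B = {} then y else V B"
  have "coded_value F ?S ?u = coded_value F (nth_elem ?S ` {..<?k}) ?u"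
    by (simp add: nth_elem_image)
  also have "\<dots> = coded_value F {..<?k} (\<lambda>T. ?u (nth_elem ?S ` T))"
    by (rule coded_value_relabel) (simp_all add: nth_elem_strict_mono)
  also have "\<dots> = coded_value F {..<?k} (\<lambda>T. let B = {i. i < r \<and> ?\<rho> i \<in> T} in if B = {} then y else V B)"
  proof (rule coded_value_cong)
    fix T assume T: "T \<subseteq> {..<?k}"
    have "e i \<in> nth_elem ?S ` T \<longleftrightarrow> ?\<rho> i \<in> T" if i: "i < r" for i
    proof -
      have ei: "e i \<in> ?S" using i by (simp add: tuple_support_def)
      have "?\<rho> i \<in> T" if "e i \<in> nth_elem ?S ` T"
      proof -
        obtain j where "j \<in> T" "e i = nth_elem ?S j" using \<open>e i \<in> nth_elem ?S ` T\<close> by auto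
        then show ?thesis using T i elem_index_nth_elem[of ?S j] by (auto simp: rank_pattern_eq_elem_index)
      qed
      moreover have "e i \<in> nth_elem ?S ` T" if "?\<rho> i \<in> T"
        using that i nth_elem_elem_index[of ?S "e i"] ei by (auto simp: rank_pattern_eq_elem_index image_iff intro!: bexI[of _ "?\<rho> i"])
      ultimately show ?thesis by blast
    qed
    then have "{i. i < r \<and> e i \<in> nth_elem ?S ` T} = {i. i < r \<and> ?\<rho> i \<in> T}" by auto
    then show "?u (nth_elem ?S ` T) = (let B = {i. i < r \<and> ?\<rho> i \<in> T} in if B = {} then y else V B)" by simp
  qed simp
  finally show ?thesis
    unfolding pattern_entry_def coded_entry_def tuple_position_rank_pattern rank_pattern_support by simp
qed

text \<open>There are finitely many order patterns. On each of them the entry is a fixed measurable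
  expression, and the pieces are glued along the comparison set \<open>R\<close>.\<close>

lemma measurable_pattern_entry:
  fixes X :: "nat \<Rightarrow> 'a \<Rightarrow> real"
  assumes F: "\<And>k. k \<in> {1..r} \<Longrightarrow> F k \<in> borel_measurable ((\<Pi>\<^sub>M B\<in>proper_subsets k. borel) \<Otimes>\<^sub>M unit_uniform)"
    and X[measurable]: "\<And>j. j < r \<Longrightarrow> X j \<in> borel_measurable M"
    and V: "\<And>B. B \<subseteq> {..<r} \<Longrightarrow> B \<noteq> {} \<Longrightarrow> (\<lambda>w. V w B) \<in> measurable M unit_uniform"
  shows "(\<lambda>w. pattern_entry r D F y (\<lambda>j. X j w) (V w)) \<in> measurable M (count_space UNIV)"
proof -
  define R where "R w = {p \<in> {..<r} \<times> {..<r}. X (fst p) w < X (snd p) w}" for w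
  let ?RR = "Pow ({..<r} \<times> {..<r})"
  \<comment> \<open>A sample point realising the comparison set \<open>S\<close>; it turns the
    pattern into a function of \<open>R w\<close> alone.\<close>
  define w0 where "w0 S = (SOME w. w \<in> space M \<and> R w = S)" for S
  have pat: "rank_pattern r (\<lambda>j. X j w) = rank_pattern r (\<lambda>j. X j (w0 (R w)))" if "w \<in> space M" for w
  proof (rule rank_pattern_cong)
    have "R (w0 (R w)) = R w" unfolding w0_def using someI[of "\<lambda>v. v \<in> space M \<and> R v = R w" w] that by simp
    moreover have "(i, j) \<in> R v \<longleftrightarrow> i < r \<and> j < r \<and> X i v < X j v" for i j v by (simp add: R_def)
    ultimately show "X i w < X j w \<longleftrightarrow> X i (w0 (R w)) < X j (w0 (R w))" if "i < r" "j < r" for i j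
      using that by metis
  qed
  have Rm: "R \<in> measurable M (count_space ?RR)"
  proof (subst measurable_count_space_eq2)
    show "finite ?RR" by simp
    have "R -` {S} \<inter> space M \<in> sets M" if "S \<subseteq> {..<r} \<times> {..<r}" for S
    proof -
      have "R w = S \<longleftrightarrow> (\<forall>p\<in>{..<r} \<times> {..<r}. (X (fst p) w < X (snd p) w) = (p \<in> S))" for w
        using that unfolding R_def by blast
      then have "R -` {S} \<inter> space M = {w \<in> space M. \<forall>p\<in>{..<r} \<times> {..<r}. (X (fst p) w < X (snd p) w) = (p \<in> S)}"
        by (simp add: set_eq_iff conj_commute)
      also have "\<dots> \<in> sets M"
      proof (rule sets.sets_Collect_finite_All)
        fix p assume "p \<in> {..<r} \<times> {..<r}"
        then have [measurable]: "X (fst p) \<in> borel_measurable M" "X (snd p) \<in> borel_measurable M" by auto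
        show "{w \<in> space M. (X (fst p) w < X (snd p) w) = (p \<in> S)} \<in> sets M" by measurable
      qed simp
      finally show ?thesis .
    qed
    then show "R \<in> space M \<rightarrow> ?RR \<and> (\<forall>S\<in>?RR. R -` {S} \<inter> space M \<in> sets M)"
      by (auto simp: R_def)
  qed
  have "(\<lambda>w. pattern_entry r D F y (\<lambda>j. X j (w0 (R w))) (V w)) \<in> measurable M (count_space UNIV)"
  proof (rule measurable_compose_countable'[OF _ Rm])
    fix S assume "S \<in> ?RR"
    let ?\<rho> = "rank_pattern r (\<lambda>j. X j (w0 S))"
    let ?T = "tuple_support r ?\<rho>"
    let ?B = "\<lambda>T. {i. i < r \<and> ?\<rho> i \<in> T}"
    have Bne: "?B T \<noteq> {}" if T: "T \<subseteq> ?T" "T \<noteq> {}" for T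
    proof -
      obtain t where "t \<in> T" using T by auto
      then obtain i where "i < r" "t = ?\<rho> i" using T by (auto simp: tuple_support_def)
      then show ?thesis using \<open>t \<in> T\<close> by auto
    qed
    have dc: "down_closed (Pow ?T)" by (auto simp: down_closed_def)
    have "(\<lambda>w. \<lambda>T\<in>Pow ?T. let B = ?B T in if B = {} then y else V w B) \<in> measurable M (\<Pi>\<^sub>M T\<in>Pow ?T. seed_measure borel T)"
    proof (rule measurable_restrict)
      fix T assume T: "T \<in> Pow ?T"
      show "(\<lambda>w. let B = ?B T in if B = {} then y else V w B) \<in> measurable M (seed_measure borel T)"
      proof (cases "T = {}")
        case True
        then show ?thesis by (simp add: seed_measure_def)
      next
        case False
        then have ne: "?B T \<noteq> {}" using Bne T by auto
        have "(\<lambda>w. V w (?B T)) \<in> measurable M unit_uniform" using ne by (intro V) auto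
        then show ?thesis using False ne by (simp only: Let_def if_False seed_measure_def)
      qed
    qed
    moreover have "coded_value F ?T \<in> borel_measurable (\<Pi>\<^sub>M T\<in>Pow ?T. seed_measure borel T)"
      by (rule borel_measurable_coded_value[where r=r]) (auto simp: F dc card_tuple_support)
    ultimately have cm: "(\<lambda>w. coded_value F ?T (\<lambda>T\<in>Pow ?T. let B = ?B T in if B = {} then y else V w B)) \<in> borel_measurable M"
      by (rule measurable_compose)
    have "coded_value F ?T (\<lambda>T\<in>Pow ?T. let B = ?B T in if B = {} then y else V w B) =
      coded_value F ?T (\<lambda>T. let B = ?B T in if B = {} then y else V w B)" for w
      by (rule coded_value_cong) auto
    then have [measurable]: "(\<lambda>w. coded_value F ?T (\<lambda>T. let B = ?B T in if B = {} then y else V w B)) \<in> borel_measurable M"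
      using cm by simp
    show "(\<lambda>w. pattern_entry r D F y (\<lambda>j. X j (w0 S)) (V w)) \<in> measurable M (count_space UNIV)"
      unfolding pattern_entry_def coded_entry_def by measurable
  qed (rule countable_finite, simp)
  then show ?thesis
    by (subst measurable_cong[OF pattern_entry_pattern_cong[OF pat]])
qed

section \<open>Permutations of vertices and families of uniform seeds\<close>

lemma comp_tuple_tuples:
  "(\<And>i. i < m \<Longrightarrow> \<sigma> i < n) \<Longrightarrow> e \<in> tuples r m \<Longrightarrow> comp_tuple r \<sigma> e \<in> tuples r n"
  by (auto simp: tuples_def comp_tuple_def)

lemma comp_tuple_inverse:
  assumes "\<And>i. i < m \<Longrightarrow> \<tau> (\<sigma> i) = i" "e \<in> tuples r m"
  shows "comp_tuple r \<tau> (comp_tuple r \<sigma> e) = e"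
proof -
  have "comp_tuple r \<tau> (comp_tuple r \<sigma> e) = comp_tuple r (\<lambda>i. i) e"
    unfolding comp_tuple_comp by (rule comp_tuple_cong) (use assms in \<open>auto simp: tuples_def\<close>)
  also have "\<dots> = e"
    using assms(2) by (intro comp_tuple_id) (auto simp: tuples_def all_tuples_def)
  finally show ?thesis .
qed

lemma permutation_inverse:
  assumes "bij_betw \<sigma> {..<m} {..<m}" "i < m"
  shows "\<sigma> i < m" "the_inv_into {..<m} \<sigma> i < m"
    "the_inv_into {..<m} \<sigma> (\<sigma> i) = i" "\<sigma> (the_inv_into {..<m} \<sigma> i) = (i :: nat)"
  using assms bij_betw_the_inv_into[OF assms(1)] f_the_inv_into_f_bij_betw[OF assms(1)]
  by (auto simp: bij_betw_def intro: the_inv_into_f_f)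

lemma coded_entry_less: "D \<ge> 1 \<Longrightarrow> coded_entry r D F e u < D"
  by (simp add: coded_entry_def clip_digit_def min_less_iff_disj)

text \<open>For each pair, Fubini isolates one coordinate, and a uniform variable hits a given
  number with probability 0. Thus seeds order the vertices without false ties.\<close>

lemma AE_uniform_distinct:
  fixes I :: "'i set"
  assumes I: "finite I"
  shows "AE \<xi> in (\<Pi>\<^sub>M p\<in>I. unit_uniform). inj_on \<xi> I"
proof -
  interpret U: prob_space unit_uniform by (rule prob_space_unit_uniform)
  have "AE \<xi> in (\<Pi>\<^sub>M p\<in>I. unit_uniform). \<xi> p \<noteq> \<xi> q" if pq: "p \<in> I" "q \<in> I" "p \<noteq> q" for p q
  proof -
    let ?J = "I - {p}"
    let ?M = "\<Pi>\<^sub>M p\<in>?J. unit_uniform"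
    interpret M: prob_space ?M by (intro prob_space_PiM prob_space_unit_uniform)
    interpret UM: pair_prob_space unit_uniform ?M ..
    have [measurable]: "(\<lambda>X. X q) \<in> measurable ?M unit_uniform"
      using pq by (intro measurable_component_singleton) auto
    have "AE x in unit_uniform \<Otimes>\<^sub>M ?M. fst x \<noteq> snd x q"
    proof (rule UM.AE_pair_measure)
      show "{x \<in> space (unit_uniform \<Otimes>\<^sub>M ?M). fst x \<noteq> snd x q} \<in> sets (unit_uniform \<Otimes>\<^sub>M ?M)" by measurable
      have "AE X in ?M. x \<noteq> X q" for x
      proof (rule AE_PiM_component)
        show "AE y in unit_uniform. x \<noteq> y"
          unfolding unit_uniform_def by (subst AE_restrict_space_iff) (auto intro: AE_lborel_singleton[THEN AE_mp])
      qed (use pq prob_space_unit_uniform in auto)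
      then show "AE x in unit_uniform. AE X in ?M. fst (x, X) \<noteq> snd (x, X) q" by simp
    qed
    then have ae: "AE x in unit_uniform \<Otimes>\<^sub>M ?M. (case x of (x, X) \<Rightarrow> X(p := x)) p \<noteq> (case x of (x, X) \<Rightarrow> X(p := x)) q"
      using pq by (auto simp: case_prod_beta')
    have PM: "(\<Pi>\<^sub>M p\<in>I. unit_uniform) = distr (unit_uniform \<Otimes>\<^sub>M ?M) (\<Pi>\<^sub>M p\<in>I. unit_uniform) (\<lambda>(x, X). X(p := x))"
      using distr_pair_PiM_eq_PiM[of ?J "\<lambda>_. unit_uniform" p] prob_space_unit_uniform pq by (simp add: insert_absorb)
    have um: "(\<lambda>(x, X). X(p := x)) \<in> measurable (unit_uniform \<Otimes>\<^sub>M ?M) (\<Pi>\<^sub>M p\<in>I. unit_uniform)"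
    proof -
      have "(\<lambda>x. (snd x)(p := fst x)) \<in> measurable (unit_uniform \<Otimes>\<^sub>M ?M) (\<Pi>\<^sub>M p\<in>I. unit_uniform)"
        by (rule measurable_fun_upd[where J="?J"]) (use pq in auto)
      then show ?thesis by (simp add: case_prod_beta')
    qed
    have neq: "{\<xi> \<in> space (\<Pi>\<^sub>M p\<in>I. unit_uniform). \<xi> p \<noteq> \<xi> q} \<in> sets (\<Pi>\<^sub>M p\<in>I. unit_uniform)"
    proof -
      have "(\<lambda>\<xi>. \<xi> i) \<in> borel_measurable (\<Pi>\<^sub>M p\<in>I. unit_uniform)" if "i \<in> I" for i
        using measurable_compose[OF measurable_component_singleton[OF that] measurable_ident_unit_uniform] .
      then show ?thesis using pq by (intro borel_measurable_neq) auto
    qed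
    show ?thesis using AE_distr_iff[OF um neq] ae unfolding PM[symmetric] by blast
  qed
  then have neq2: "AE \<xi> in (\<Pi>\<^sub>M p\<in>I. unit_uniform). p \<noteq> q \<longrightarrow> \<xi> p \<noteq> \<xi> q" if "p \<in> I" "q \<in> I" for p q
    using that by (cases "p = q") auto
  have "AE \<xi> in (\<Pi>\<^sub>M p\<in>I. unit_uniform). \<forall>p\<in>I. \<forall>q\<in>I. p \<noteq> q \<longrightarrow> \<xi> p \<noteq> \<xi> q"
    by (rule AE_finite_allI[OF I], rule AE_finite_allI[OF I], rule neq2)
  then show ?thesis
  proof (rule eventually_mono)
    fix \<xi> :: "'i \<Rightarrow> real" assume "\<forall>p\<in>I. \<forall>q\<in>I. p \<noteq> q \<longrightarrow> \<xi> p \<noteq> \<xi> q"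
    then show "inj_on \<xi> I" unfolding inj_on_def by metis
  qed
qed

text \<open>Checked on boxes, where each factor splits by \<open>st\<close>. The half tagged
  \<open>True\<close> will order the vertices, the half tagged \<open>False\<close> will drive the
  recursion.\<close>

lemma PiM_uniform_split:
  assumes K: "finite K"
    and s[measurable]: "s \<in> measurable unit_uniform unit_uniform" and t[measurable]: "t \<in> measurable unit_uniform unit_uniform"
    and st: "distr unit_uniform (unit_uniform \<Otimes>\<^sub>M unit_uniform) (\<lambda>u. (s u, t u)) = unit_uniform \<Otimes>\<^sub>M unit_uniform"
  shows "distr (\<Pi>\<^sub>M i\<in>K. unit_uniform) (\<Pi>\<^sub>M p\<in>K \<times> (UNIV :: bool set). unit_uniform)
      (\<lambda>U. \<lambda>p\<in>K \<times> UNIV. (if snd p then s else t) (U (fst p))) = (\<Pi>\<^sub>M p\<in>K \<times> UNIV. unit_uniform)"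
proof -
  interpret U: prob_space unit_uniform by (rule prob_space_unit_uniform)
  interpret UU: pair_prob_space unit_uniform unit_uniform ..
  interpret PK: product_sigma_finite "\<lambda>_. unit_uniform"
    by (rule product_sigma_finite.intro) (rule prob_space_imp_sigma_finite[OF prob_space_unit_uniform])
  let ?K = "\<Pi>\<^sub>M i\<in>K. unit_uniform" and ?KB = "\<Pi>\<^sub>M p\<in>K \<times> (UNIV :: bool set). unit_uniform"
  let ?g = "\<lambda>U. \<lambda>p\<in>K \<times> UNIV. (if snd p then s else t) (U (fst p))"
  have gm: "?g \<in> measurable ?K ?KB"
  proof (rule measurable_restrict)
    fix p :: "_ \<times> bool" assume "p \<in> K \<times> UNIV"
    then have "(\<lambda>U. U (fst p)) \<in> measurable ?K unit_uniform" by (intro measurable_component_singleton) auto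
    then show "(\<lambda>U. (if snd p then s else t) (U (fst p))) \<in> measurable ?K unit_uniform"
      by (cases "snd p") (auto intro: measurable_compose)
  qed
  show ?thesis
  proof (rule PK.PiM_eqI)
    fix A :: "_ \<times> bool \<Rightarrow> real set" assume A: "\<And>p. p \<in> K \<times> UNIV \<Longrightarrow> A p \<in> sets unit_uniform"
    define C where "C i = {u \<in> space unit_uniform. s u \<in> A (i, True) \<and> t u \<in> A (i, False)}" for i
    have C: "C i \<in> sets unit_uniform" "emeasure unit_uniform (C i) = emeasure unit_uniform (A (i, True)) * emeasure unit_uniform (A (i, False))"
      if "i \<in> K" for i
    proof -
      have [measurable]: "A (i, True) \<in> sets unit_uniform" "A (i, False) \<in> sets unit_uniform" using A that by auto
      show "C i \<in> sets unit_uniform" unfolding C_def by measurable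
      have m: "(\<lambda>u. (s u, t u)) \<in> measurable unit_uniform (unit_uniform \<Otimes>\<^sub>M unit_uniform)" by measurable
      have "emeasure unit_uniform (C i) = emeasure (distr unit_uniform (unit_uniform \<Otimes>\<^sub>M unit_uniform) (\<lambda>u. (s u, t u))) (A (i, True) \<times> A (i, False))"
        by (subst emeasure_distr[OF m]) (auto simp: C_def intro!: arg_cong[where f="emeasure unit_uniform"])
      also have "\<dots> = emeasure unit_uniform (A (i, True)) * emeasure unit_uniform (A (i, False))"
        unfolding st by (rule U.emeasure_pair_measure_Times) auto
      finally show "emeasure unit_uniform (C i) = \<dots>" .
    qed
    have "?g -` PiE (K \<times> UNIV) A \<inter> space ?K = PiE K C"
    proof (intro equalityI subsetI)
      fix U assume U: "U \<in> ?g -` PiE (K \<times> UNIV) A \<inter> space ?K"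
      then have gU: "?g U \<in> PiE (K \<times> UNIV) A" by (rule IntD1[THEN vimageD])
      show "U \<in> PiE K C"
      proof (rule PiE_I)
        fix i assume "i \<in> K"
        then show "U i \<in> C i"
          using U PiE_mem[OF gU, of "(i, True)"] PiE_mem[OF gU, of "(i, False)"] by (auto simp: C_def space_PiM PiE_iff)
      qed (use U in \<open>auto simp: space_PiM PiE_iff extensional_def\<close>)
    qed (auto simp: C_def space_PiM PiE_iff split: if_splits)
    moreover have "PiE (K \<times> UNIV) A \<in> sets ?KB" using A K by (intro sets_PiM_I_finite) auto
    ultimately have "emeasure (distr ?K ?KB ?g) (PiE (K \<times> UNIV) A) = emeasure ?K (PiE K C)"
      by (subst emeasure_distr[OF gm]) auto
    also have "\<dots> = (\<Prod>i\<in>K. emeasure unit_uniform (C i))"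
      using K C by (intro PK.emeasure_PiM) auto
    also have "\<dots> = (\<Prod>i\<in>K. \<Prod>b\<in>UNIV. emeasure unit_uniform (A (i, b)))"
      using C by (intro prod.cong) (auto simp: UNIV_bool mult.commute)
    also have "\<dots> = (\<Prod>p\<in>K \<times> UNIV. emeasure unit_uniform (A p))"
      by (simp add: prod.cartesian_product)
    finally show "emeasure (distr ?K ?KB ?g) (PiE (K \<times> UNIV) A) = \<dots>" .
  qed (use K in auto)
qed

text \<open>Without ties dense ranks are ordinary ranks, so the pattern is the permutation that
  sorts \<open>x\<close>.\<close>

lemma rank_pattern_bij:
  fixes x :: "nat \<Rightarrow> real"
  assumes x: "inj_on x {..<m}"
  shows "bij_betw (rank_pattern m x) {..<m} {..<m}"
    and "\<And>i j. i < m \<Longrightarrow> j < m \<Longrightarrow> rank_pattern m x i < rank_pattern m x j \<longleftrightarrow> x i < x j"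
proof -
  have less: "rank_pattern m x i < rank_pattern m x j" if "i < m" "j < m" "x i < x j" for i j
  proof -
    have "{y \<in> x ` {..<m}. y < x i} \<subset> {y \<in> x ` {..<m}. y < x j}" using that by force
    then show ?thesis using that by (auto simp: rank_pattern_def intro!: psubset_card_mono)
  qed
  show iff: "rank_pattern m x i < rank_pattern m x j \<longleftrightarrow> x i < x j" if "i < m" "j < m" for i j
    using less[OF that] less[OF that(2,1)] inj_onD[OF x, of i j] that
    by (metis lessThan_iff linorder_neq_iff order_less_asym)
  have "inj_on (rank_pattern m x) {..<m}"
    using less inj_onD[OF x] by (intro inj_onI) (metis lessThan_iff linorder_neq_iff)
  moreover have "rank_pattern m x ` {..<m} \<subseteq> {..<m}"
  proof clarify
    fix i assume "i < m"
    then have "{y \<in> x ` {..<m}. y < x i} \<subset> x ` {..<m}" by auto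
    then have "card {y \<in> x ` {..<m}. y < x i} < card (x ` {..<m})" by (intro psubset_card_mono) auto
    also have "\<dots> \<le> m" using card_image_le[of "{..<m}" x] by simp
    finally show "rank_pattern m x i < m" using \<open>i < m\<close> by (simp add: rank_pattern_def)
  qed
  ultimately show "bij_betw (rank_pattern m x) {..<m} {..<m}"
    by (simp add: bij_betw_def card_image card_subset_eq)
qed

context vertex_process
begin

lemma sets_coded_event:
  assumes F: "\<And>k. k \<in> {1..r} \<Longrightarrow> F k \<in> borel_measurable (codes_space k \<Otimes>\<^sub>M unit_uniform)"
    and T: "finite T" "\<And>e. e \<in> T \<Longrightarrow> f e \<in> tuples r m"
  shows "{u \<in> space (\<Pi>\<^sub>M A\<in>seed_sets m. unit_uniform). \<forall>e\<in>T. coded_entry r D F (f e) (u({} := y)) = a e}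
     \<in> sets (\<Pi>\<^sub>M A\<in>seed_sets m. unit_uniform)"
proof (rule sets.sets_Collect_finite_All[OF _ T(1)])
  fix e assume e: "e \<in> T"
  let ?U = "\<Pi>\<^sub>M A\<in>seed_sets m. unit_uniform" and ?SM = "\<Pi>\<^sub>M A\<in>insert {} (seed_sets m). seed_measure borel A"
  have um: "(\<lambda>u. u({} := y)) \<in> measurable ?U ?SM"
  proof -
    have eq: "?U = (\<Pi>\<^sub>M A\<in>seed_sets m. seed_measure borel A)"
      by (intro PiM_cong) (auto simp: seed_measure_def seed_sets_def)
    show ?thesis unfolding eq
    proof (rule measurable_fun_upd[where J="seed_sets m"])
      show "(\<lambda>_. y) \<in> measurable (\<Pi>\<^sub>M A\<in>seed_sets m. seed_measure borel A) (seed_measure borel {})"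
        by (simp add: seed_measure_def)
    qed simp_all
  qed
  have "coded_value F (tuple_support r (f e)) \<in> borel_measurable ?SM"
    by (rule borel_measurable_coded_value[where r=r])
       (auto simp: F down_closed_seed_sets card_tuple_support tuple_support_seed_sets T(2)[OF e])
  from measurable_compose[OF um this]
  have [measurable]: "(\<lambda>u. coded_value F (tuple_support r (f e)) (u({} := y))) \<in> borel_measurable ?U" .
  show "{u \<in> space ?U. coded_entry r D F (f e) (u({} := y)) = a e} \<in> sets ?U"
    unfolding coded_entry_def by measurable
qed

text \<open>Exchangeability for the permutation, extended by the identity to the other actual
  vertices and to all auxiliary ones.\<close>

lemma prob_actual_event_permute:
  assumes \<sigma>: "bij_betw \<sigma> {..<m} {..<m}"
    and ab: "\<And>e. e \<in> tuples r m \<Longrightarrow> b (comp_tuple r \<sigma> e) = a e"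
  shows "prob (actual_event (tuples r m) b) = prob (actual_event (tuples r m) a)"
proof -
  define \<sigma>' where "\<sigma>' i = (if i < m then \<sigma> i else i)" for i
  have "inj \<sigma>'"
  proof (rule injI)
    fix i j assume "\<sigma>' i = \<sigma>' j"
    moreover have "\<sigma> i < m" if "i < m" for i using \<sigma> that by (auto simp: bij_betw_def)
    ultimately show "i = j"
      using \<sigma> by (auto simp: \<sigma>'_def bij_betw_def dest: inj_onD split: if_splits)
  qed
  have inj: "inj (lift_vertex \<sigma>')"
  proof (rule injI)
    fix v w assume eq: "lift_vertex \<sigma>' v = lift_vertex \<sigma>' w"
    obtain a i b j where "v = (a, i)" "w = (b, j)" by (cases v, cases w)
    then show "v = w"
      using eq injD[OF \<open>inj \<sigma>'\<close>, of i j] by (auto simp: lift_vertex_def split: if_splits)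
  qed
  have rel: "relabel r (lift_vertex \<sigma>') \<omega> (comp_tuple r (Pair 0) e) = \<omega> (comp_tuple r (Pair 0) (comp_tuple r \<sigma> e))"
    if "e \<in> tuples r m" for e \<omega>
  proof -
    have "comp_tuple r (lift_vertex \<sigma>') (comp_tuple r (Pair 0) e) = comp_tuple r (Pair 0) (comp_tuple r \<sigma> e)"
      unfolding comp_tuple_comp
      by (rule comp_tuple_cong) (use that in \<open>auto simp: lift_vertex_def \<sigma>'_def tuples_def\<close>)
    then show ?thesis by (simp add: relabel_def)
  qed
  have surj: "\<exists>f\<in>tuples r m. e = comp_tuple r \<sigma> f" if e: "e \<in> tuples r m" for e
  proof (intro bexI)
    let ?\<tau> = "the_inv_into {..<m} \<sigma>"
    show "e = comp_tuple r \<sigma> (comp_tuple r ?\<tau> e)"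
      using comp_tuple_inverse[of m \<sigma> ?\<tau>, OF permutation_inverse(4)[OF \<sigma>] e] by simp
    show "comp_tuple r ?\<tau> e \<in> tuples r m"
      using permutation_inverse(2)[OF \<sigma>] e by (rule comp_tuple_tuples)
  qed
  have "actual_event (tuples r m) b = relabel r (lift_vertex \<sigma>') -` actual_event (tuples r m) a \<inter> space P"
  proof (intro equalityI subsetI)
    fix \<omega> assume \<omega>: "\<omega> \<in> actual_event (tuples r m) b"
    have "relabel r (lift_vertex \<sigma>') \<omega> (comp_tuple r (Pair 0) e) = a e" if "e \<in> tuples r m" for e
    proof -
      have "comp_tuple r \<sigma> e \<in> tuples r m" using that \<sigma> by (auto simp: tuples_def comp_tuple_def bij_betw_def)
      then show ?thesis using \<omega> ab[OF that] by (simp add: rel[OF that] actual_event_def)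
    qed
    then show "\<omega> \<in> relabel r (lift_vertex \<sigma>') -` actual_event (tuples r m) a \<inter> space P"
      using \<omega> relabel_space by (auto simp: actual_event_def)
  next
    fix \<omega> assume \<omega>: "\<omega> \<in> relabel r (lift_vertex \<sigma>') -` actual_event (tuples r m) a \<inter> space P"
    have "\<omega> (comp_tuple r (Pair 0) e) = b e" if e: "e \<in> tuples r m" for e
    proof -
      obtain f where f: "f \<in> tuples r m" "e = comp_tuple r \<sigma> f" using surj[OF e] by blast
      have "relabel r (lift_vertex \<sigma>') \<omega> (comp_tuple r (Pair 0) f) = a f" using \<omega> f by (auto simp: actual_event_def)
      then show ?thesis using ab[OF f(1)] by (simp add: rel[OF f(1)] f(2))
    qed
    then show "\<omega> \<in> actual_event (tuples r m) b" using \<omega> by (auto simp: actual_event_def)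
  qed
  then have "prob (actual_event (tuples r m) b) = measure (distr P P (relabel r (lift_vertex \<sigma>'))) (actual_event (tuples r m) a)"
    by (simp add: measure_distr sets_actual_event)
  also have "distr P P (relabel r (lift_vertex \<sigma>')) = P"
    using distr_relabel[OF inj, of "\<lambda>\<omega>. \<omega>" P] by (simp add: distr_id2)
  finally show ?thesis .
qed

end

section \<open>The law of the limit array\<close>

lemma pattern_entry_eq:
  assumes "\<And>i j. i < r \<Longrightarrow> j < r \<Longrightarrow> x i < x j \<longleftrightarrow> x' i < x' j"
    and "\<And>B. B \<subseteq> {..<r} \<Longrightarrow> B \<noteq> {} \<Longrightarrow> V B = V' B"
  shows "pattern_entry r D F y x V = pattern_entry r D F y x' V'"
proof -
  have "rank_pattern r x = rank_pattern r x'" by (rule rank_pattern_cong) (rule assms(1))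
  then have "pattern_entry r D F y x V = pattern_entry r D F y x' V" by (simp add: pattern_entry_def)
  also have "\<dots> = pattern_entry r D F y x' V'" by (rule pattern_entry_cong) (rule assms(2))
  finally show ?thesis .
qed

context vertex_process
begin

lemma image_seed_sets:
  assumes "e \<in> tuples r m" "B \<subseteq> {..<r}" "B \<noteq> {}" shows "e ` B \<in> seed_sets m"
proof -
  have "card (e ` B) \<le> card {..<r}"
    using assms card_image_le[of B e] card_mono[of "{..<r}" B] finite_subset[of B "{..<r}"] by simp
  moreover have "e ` B \<subseteq> {..<m}" using assms by (auto simp: tuples_def subset_eq)
  ultimately show ?thesis using assms by (simp add: seed_sets_def)
qed

lemma singleton_seed_sets: "i < m \<Longrightarrow> {i} \<in> seed_sets m"
  using r_pos by (simp add: seed_sets_def)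

text \<open>Comparing \<open>x\<close> at two vertices is the same as comparing their ranks under
  \<open>\<sigma>\<close>. An entry ordered by \<open>x\<close> is therefore the coded entry of the
  permuted tuple, provided the seeds are renamed by the inverse \<open>\<tau>\<close>.\<close>

lemma pattern_entry_permuted:
  assumes e: "e \<in> tuples r m" and x: "inj_on x {..<m}"
  defines "\<sigma> \<equiv> rank_pattern m x"
  defines "\<tau> \<equiv> the_inv_into {..<m} \<sigma>"
  shows "pattern_entry r D F y (\<lambda>j. x (e j) :: real) (\<lambda>B. v (e ` B)) =
    coded_entry r D F (comp_tuple r \<sigma> e) ((\<lambda>T\<in>seed_sets m. v (\<tau> ` T))({} := y))"
proof -
  let ?e = "comp_tuple r \<sigma> e"
  note bij = rank_pattern_bij(1)[OF x, folded \<sigma>_def] and ord = rank_pattern_bij(2)[OF x, folded \<sigma>_def]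
  have em: "e j < m" if "j < r" for j using e that by (auto simp: tuples_def)
  note \<tau> = permutation_inverse(3)[OF bij, folded \<tau>_def] and \<sigma>m = permutation_inverse(1)[OF bij]
  have "pattern_entry r D F y (\<lambda>j. x (e j)) (\<lambda>B. v (e ` B)) = pattern_entry r D F y ?e (\<lambda>B. v (e ` B))"
    by (rule pattern_entry_eq) (simp_all add: ord em)
  also have "\<dots> = coded_entry r D F ?e (\<lambda>T. let B = {i. i < r \<and> ?e i \<in> T} in if B = {} then y else v (e ` B))"
    by (rule pattern_entry_eq_coded_entry)
  also have "\<dots> = coded_entry r D F ?e ((\<lambda>T\<in>seed_sets m. v (\<tau> ` T))({} := y))"
    unfolding coded_entry_def
  proof (intro arg_cong[where f="clip_digit D (tuple_position r ?e)"] coded_value_cong)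
    fix T assume T: "T \<subseteq> tuple_support r ?e"
    let ?B = "{i. i < r \<and> ?e i \<in> T}"
    show "(let B = ?B in if B = {} then y else v (e ` B)) = ((\<lambda>T\<in>seed_sets m. v (\<tau> ` T))({} := y)) T"
    proof (cases "T = {}")
      case False
      then obtain i where "i < r" "?e i \<in> T" using T by (auto simp: tuple_support_def)
      then have ne: "?B \<noteq> {}" by auto
      have supp: "tuple_support r ?e \<in> seed_sets m"
        using comp_tuple_tuples[of m \<sigma> m e] \<sigma>m e by (intro tuple_support_seed_sets) auto
      then have "card T \<le> card (tuple_support r ?e)" using T by (intro card_mono) auto
      then have "T \<in> seed_sets m" using supp T False by (auto simp: seed_sets_def)
      \<comment> \<open>\<open>\<tau>\<close> undoes \<open>\<sigma>\<close>, so a set of permuted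
        vertices is pulled back to the vertices at the positions it covers.\<close>
      moreover have "\<tau> ` T = e ` ?B"
      proof (intro equalityI subsetI)
        fix z assume "z \<in> \<tau> ` T"
        then obtain s where s: "s \<in> T" "z = \<tau> s" by auto
        then obtain i where "i < r" "s = ?e i" using T by (auto simp: tuple_support_def)
        then show "z \<in> e ` ?B" using s \<tau> em by auto
      next
        fix z assume "z \<in> e ` ?B"
        then obtain i where i: "i < r" "?e i \<in> T" "z = e i" by auto
        then have "z = \<tau> (?e i)" using \<tau> em by simp
        then show "z \<in> \<tau> ` T" using i by blast
      qed
      ultimately show ?thesis using False ne by (simp only: Let_def if_False fun_upd_other restrict_apply' not_False_eq_True)
    qed simp
  qed simp
  finally show ?thesis .
qed

definition seeded_coding :: "(nat \<Rightarrow> (nat set \<Rightarrow> real) \<times> real \<Rightarrow> real) \<Rightarrow> real \<Rightarrow> bool" where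
  "seeded_coding F y \<longleftrightarrow> (\<forall>k\<in>{1..r}. F k \<in> borel_measurable (codes_space k \<Otimes>\<^sub>M unit_uniform)) \<and>
    (\<forall>m. \<forall>a\<in>tuples r m \<rightarrow>\<^sub>E {..<D}. measure (\<Pi>\<^sub>M A\<in>seed_sets m. unit_uniform)
      {u \<in> space (\<Pi>\<^sub>M A\<in>seed_sets m. unit_uniform). \<forall>e\<in>tuples r m. coded_entry r D F e (u({} := y)) = a e} =
      prob (actual_event (tuples r m) a))"

definition seed_space :: "nat \<Rightarrow> bool set \<Rightarrow> (nat set \<times> bool \<Rightarrow> real) measure" where
  "seed_space m C = (\<Pi>\<^sub>M p\<in>seed_sets m \<times> C. unit_uniform)"

lemma prob_space_seed_space: "prob_space (seed_space m C)"
  unfolding seed_space_def by (intro prob_space_PiM prob_space_unit_uniform)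

text \<open>Once the ordering seeds are fixed, the coding seeds are merely renamed by
  \<open>\<tau>\<close>, which preserves an i.i.d. family. What is left is a permuted coded array,
  and exchangeability absorbs the permutation.\<close>

lemma emeasure_permuted_entries:
  assumes Fy: "seeded_coding F y" and a: "a \<in> tuples r m \<rightarrow>\<^sub>E {..<D}"
    and \<xi>: "inj_on \<xi> (seed_sets m \<times> {True})"
  shows "emeasure (seed_space m {False}) {v \<in> space (seed_space m {False}). \<forall>e\<in>tuples r m.
      pattern_entry r D F y (\<lambda>j. \<xi> ({e j}, True) :: real) (\<lambda>B. v (e ` B, False)) = a e} =
    ennreal (prob (actual_event (tuples r m) a))"
proof -
  let ?K = "seed_sets m"
  let ?UK = "\<Pi>\<^sub>M A\<in>?K. unit_uniform" and ?MJ = "\<Pi>\<^sub>M p\<in>?K \<times> {False}. unit_uniform"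
  interpret UK: prob_space ?UK by (intro prob_space_PiM prob_space_unit_uniform)
  have F: "\<And>k. k \<in> {1..r} \<Longrightarrow> F k \<in> borel_measurable (codes_space k \<Otimes>\<^sub>M unit_uniform)"
    using Fy by (simp add: seeded_coding_def)
  have seeded: "measure ?UK {u \<in> space ?UK. \<forall>e\<in>tuples r m. coded_entry r D F e (u({} := y)) = b e} =
    prob (actual_event (tuples r m) b)" if "b \<in> tuples r m \<rightarrow>\<^sub>E {..<D}" for b
    using Fy that by (simp add: seeded_coding_def)
  define x where "x i = \<xi> ({i}, True)" for i
  have x: "inj_on x {..<m}"
  proof (rule inj_onI)
    fix i j assume ij: "i \<in> {..<m}" "j \<in> {..<m}" "x i = x j"
    have "({i}, True) = ({j}, True)"
      by (rule inj_onD[OF \<xi>]) (use ij singleton_seed_sets in \<open>simp_all add: x_def\<close>)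
    then show "i = j" by simp
  qed
  define \<sigma> where "\<sigma> = rank_pattern m x"
  define \<tau> where "\<tau> = the_inv_into {..<m} \<sigma>"
  note bij = rank_pattern_bij(1)[OF x, folded \<sigma>_def]
  note perm = pattern_entry_permuted[OF _ x, folded \<sigma>_def, folded \<tau>_def]
  note \<sigma>m = permutation_inverse(1)[OF bij] and \<tau>m = permutation_inverse(2)[OF bij, folded \<tau>_def]
    and \<tau>\<sigma> = permutation_inverse(3)[OF bij, folded \<tau>_def] and \<sigma>\<tau> = permutation_inverse(4)[OF bij, folded \<tau>_def]
  have \<tau>K: "\<tau> ` T \<in> ?K" if "T \<in> ?K" for T
  proof -
    have T: "T \<subseteq> {..<m}" "T \<noteq> {}" "card T \<le> r" using that by (auto simp: seed_sets_def)
    have "card (\<tau> ` T) \<le> card T" using T by (intro card_image_le) (auto intro: finite_subset)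
    then show ?thesis using T \<tau>m by (auto simp: seed_sets_def)
  qed
  let ?f = "\<lambda>T. (\<tau> ` T, False)" and ?rm = "\<lambda>v. \<lambda>T\<in>?K. v (\<tau> ` T, False) :: real"
  have rml: "distr ?MJ ?UK ?rm = ?UK"
  proof (rule distr_PiM_reindex[where f="?f"])
    show "inj_on ?f ?K"
    proof (rule inj_onI)
      fix T S assume TS: "T \<in> ?K" "S \<in> ?K" "(\<tau> ` T, False) = (\<tau> ` S, False)"
      have "\<sigma> ` \<tau> ` A = A" if "A \<in> ?K" for A
        using that \<sigma>\<tau> by (force simp: seed_sets_def image_image subset_eq)
      then show "T = S" using TS by (metis prod.inject)
    qed
  qed (use \<tau>K prob_space_unit_uniform in auto)
  have rmm: "?rm \<in> measurable ?MJ ?UK"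
    using \<tau>K by (intro measurable_restrict measurable_component_singleton) auto
  define E' where "E' = {u \<in> space ?UK. \<forall>e\<in>tuples r m. coded_entry r D F (comp_tuple r \<sigma> e) (u({} := y)) = a e}"
  have E': "E' \<in> sets ?UK"
    unfolding E'_def
    by (rule sets_coded_event) (use \<sigma>m in \<open>auto intro: F comp_tuple_tuples\<close>)
  have "{v \<in> space ?MJ. \<forall>e\<in>tuples r m. pattern_entry r D F y (\<lambda>j. \<xi> ({e j}, True)) (\<lambda>B. v (e ` B, False)) = a e}
    = ?rm -` E' \<inter> space ?MJ"
  proof -
    have "pattern_entry r D F y (\<lambda>j. \<xi> ({e j}, True)) (\<lambda>B. v (e ` B, False)) =
      coded_entry r D F (comp_tuple r \<sigma> e) ((?rm v)({} := y))" if e: "e \<in> tuples r m" for e v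
      using perm[OF e, where v="\<lambda>T. v (T, False)"] by (simp only: x_def)
    then show ?thesis
      using measurable_space[OF rmm] unfolding E'_def by (auto simp del: fun_upd_apply)
  qed
  then have "emeasure ?MJ {v \<in> space ?MJ. \<forall>e\<in>tuples r m. pattern_entry r D F y (\<lambda>j. \<xi> ({e j}, True)) (\<lambda>B. v (e ` B, False)) = a e}
     = emeasure (distr ?MJ ?UK ?rm) E'"
    by (simp only: emeasure_distr[OF rmm E'])
  also have "\<dots> = emeasure ?UK E'" unfolding rml ..
  also have "\<dots> = ennreal (prob (actual_event (tuples r m) a))"
  proof -
    \<comment> \<open>\<open>b\<close> is \<open>a\<close> read along the inverse permutation:
      prescribing \<open>a\<close> at the permuted tuples means prescribing
      \<open>b\<close>.\<close>
    define b where "b = (\<lambda>e\<in>tuples r m. a (comp_tuple r \<tau> e))"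
    note back1 = comp_tuple_inverse[of m \<tau> \<sigma>, OF \<tau>\<sigma>] and back2 = comp_tuple_inverse[of m \<sigma> \<tau>, OF \<sigma>\<tau>]
    have in\<sigma>: "comp_tuple r \<sigma> e \<in> tuples r m" if "e \<in> tuples r m" for e
      using \<sigma>m that by (rule comp_tuple_tuples)
    have in\<tau>: "comp_tuple r \<tau> e \<in> tuples r m" if "e \<in> tuples r m" for e
      using \<tau>m that by (rule comp_tuple_tuples)
    have b: "b \<in> tuples r m \<rightarrow>\<^sub>E {..<D}" using a in\<tau> by (auto simp: b_def)
    have ba: "b (comp_tuple r \<sigma> e) = a e" if "e \<in> tuples r m" for e
      using that by (simp add: b_def in\<sigma> back1)
    have "E' = {u \<in> space ?UK. \<forall>e\<in>tuples r m. coded_entry r D F e (u({} := y)) = b e}"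
      unfolding E'_def
    proof (intro Collect_cong conj_cong refl iffI ballI)
      fix u e assume "\<forall>e\<in>tuples r m. coded_entry r D F (comp_tuple r \<sigma> e) (u({} := y)) = a e" and e: "e \<in> tuples r m"
      then have "coded_entry r D F (comp_tuple r \<sigma> (comp_tuple r \<tau> e)) (u({} := y)) = a (comp_tuple r \<tau> e)"
        using in\<tau> by blast
      then show "coded_entry r D F e (u({} := y)) = b e" using e by (simp add: back2 b_def)
    next
      fix u e assume "\<forall>e\<in>tuples r m. coded_entry r D F e (u({} := y)) = b e" and e: "e \<in> tuples r m"
      then show "coded_entry r D F (comp_tuple r \<sigma> e) (u({} := y)) = a e"
        using in\<sigma>[OF e] ba[OF e] by simp
    qed
    then show ?thesis
      using seeded[OF b] prob_actual_event_permute[of \<sigma> m b a, OF bij ba] by (simp add: UK.emeasure_eq_measure)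
  qed
  finally show ?thesis unfolding seed_space_def .
qed

lemma sets_split_event:
  assumes Fy: "seeded_coding F y"
  shows "{z \<in> space (seed_space m UNIV). \<forall>e\<in>tuples r m.
      pattern_entry r D F y (\<lambda>j. z ({e j}, True)) (\<lambda>B. z (e ` B, False)) = a e} \<in> sets (seed_space m UNIV)"
  unfolding seed_space_def
    proof (rule sets.sets_Collect_finite_All)
      fix e assume e: "e \<in> tuples r m"
      have [measurable]: "(\<lambda>z. pattern_entry r D F y (\<lambda>j. z ({e j}, True)) (\<lambda>B. z (e ` B, False))) \<in> measurable (\<Pi>\<^sub>M p\<in>seed_sets m \<times> (UNIV :: bool set). unit_uniform) (count_space UNIV)"
      proof (rule measurable_pattern_entry[where M="\<Pi>\<^sub>M p\<in>seed_sets m \<times> (UNIV :: bool set). unit_uniform"])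
        fix j assume "j < r"
        then have "(\<lambda>z. z ({e j}, True)) \<in> measurable (\<Pi>\<^sub>M p\<in>seed_sets m \<times> (UNIV :: bool set). unit_uniform) unit_uniform"
          using e by (intro measurable_component_singleton) (auto simp: tuples_def intro: singleton_seed_sets)
        from measurable_compose[OF this measurable_ident_unit_uniform]
        show "(\<lambda>z. z ({e j}, True)) \<in> borel_measurable (\<Pi>\<^sub>M p\<in>seed_sets m \<times> (UNIV :: bool set). unit_uniform)" .
      next
        show "\<And>k. k \<in> {1..r} \<Longrightarrow> F k \<in> borel_measurable (codes_space k \<Otimes>\<^sub>M unit_uniform)"
          using Fy by (simp add: seeded_coding_def)
      next
        fix B assume "B \<subseteq> {..<r}" "B \<noteq> {}"
        then show "(\<lambda>z. z (e ` B, False)) \<in> measurable (\<Pi>\<^sub>M p\<in>seed_sets m \<times> (UNIV :: bool set). unit_uniform) unit_uniform"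
          using image_seed_sets[OF e] by (intro measurable_component_singleton) auto
      qed
      show "{z \<in> space (\<Pi>\<^sub>M p\<in>seed_sets m \<times> (UNIV :: bool set). unit_uniform). pattern_entry r D F y (\<lambda>j. z ({e j}, True)) (\<lambda>B. z (e ` B, False)) = a e} \<in> sets (\<Pi>\<^sub>M p\<in>seed_sets m \<times> (UNIV :: bool set). unit_uniform)"
        by measurable
    qed simp

text \<open>Fubini with the ordering seeds outside: for almost all of them the inner probability is
  the same number.\<close>

lemma emeasure_split_event:
  assumes Fy: "seeded_coding F y" and a: "a \<in> tuples r m \<rightarrow>\<^sub>E {..<D}"
  shows "emeasure (seed_space m UNIV) {z \<in> space (seed_space m UNIV). \<forall>e\<in>tuples r m.
      pattern_entry r D F y (\<lambda>j. z ({e j}, True)) (\<lambda>B. z (e ` B, False)) = a e} = ennreal (prob (actual_event (tuples r m) a))"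
proof -
  let ?I = "seed_sets m \<times> {True}" and ?J = "seed_sets m \<times> {False}"
  let ?p = "ennreal (prob (actual_event (tuples r m) a))"
  define MI where "MI = seed_space m {True}"
  define MJ where "MJ = seed_space m {False}"
  define KB where "KB = seed_space m UNIV"
  define E where "E = {z \<in> space KB. \<forall>e\<in>tuples r m.
      pattern_entry r D F y (\<lambda>j. z ({e j}, True)) (\<lambda>B. z (e ` B, False)) = a e}"
  have E: "E \<in> sets KB" unfolding E_def KB_def by (rule sets_split_event[OF Fy])
  interpret MI: prob_space MI unfolding MI_def by (rule prob_space_seed_space)
  interpret MJ: prob_space MJ unfolding MJ_def by (rule prob_space_seed_space)
  interpret PK: product_sigma_finite "\<lambda>_ :: nat set \<times> bool. unit_uniform"
    by (rule product_sigma_finite.intro) (rule prob_space_imp_sigma_finite[OF prob_space_unit_uniform])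
  have union: "?I \<union> ?J = seed_sets m \<times> UNIV" by auto
  have mm: "merge ?I ?J \<in> measurable (MI \<Otimes>\<^sub>M MJ) KB"
    using measurable_merge[of ?I ?J "\<lambda>_. unit_uniform"] by (simp only: union MI_def MJ_def KB_def seed_space_def)
  have "distr (MI \<Otimes>\<^sub>M MJ) KB (merge ?I ?J) = KB"
  proof -
    have "?I \<inter> ?J = {}" "finite ?I" "finite ?J" by auto
    from PK.distr_merge[OF this] show ?thesis by (simp only: union MI_def MJ_def KB_def seed_space_def)
  qed
  then have "emeasure KB E = emeasure (distr (MI \<Otimes>\<^sub>M MJ) KB (merge ?I ?J)) E" by (rule arg_cong[OF sym])
  also have "\<dots> = emeasure (MI \<Otimes>\<^sub>M MJ) (merge ?I ?J -` E \<inter> space (MI \<Otimes>\<^sub>M MJ))" by (rule emeasure_distr[OF mm E])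
  also have "\<dots> = (\<integral>\<^sup>+\<xi>. emeasure MJ (Pair \<xi> -` (merge ?I ?J -` E \<inter> space (MI \<Otimes>\<^sub>M MJ))) \<partial>MI)"
    by (rule MJ.emeasure_pair_measure_alt[OF measurable_sets[OF mm E]])
  also have "\<dots> = (\<integral>\<^sup>+\<xi>. ?p \<partial>MI)"
  proof (rule nn_integral_cong_AE)
    have sec_law: "emeasure MJ (Pair \<xi> -` (merge ?I ?J -` E \<inter> space (MI \<Otimes>\<^sub>M MJ))) = ?p"
      if \<xi>: "inj_on \<xi> ?I" "\<xi> \<in> space MI" for \<xi>
    proof -
      have entry: "pattern_entry r D F y (\<lambda>j. merge ?I ?J (\<xi>, v) ({e j}, True)) (\<lambda>B. merge ?I ?J (\<xi>, v) (e ` B, False)) =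
        pattern_entry r D F y (\<lambda>j. \<xi> ({e j}, True)) (\<lambda>B. v (e ` B, False))" if e: "e \<in> tuples r m" for e v
      proof (rule pattern_entry_eq)
        have "merge ?I ?J (\<xi>, v) ({e j}, True) = \<xi> ({e j}, True)" if "j < r" for j
          using that e singleton_seed_sets[of "e j" m] by (auto simp: merge_def tuples_def)
        then show "i < r \<Longrightarrow> j < r \<Longrightarrow>
          (merge ?I ?J (\<xi>, v) ({e i}, True) < merge ?I ?J (\<xi>, v) ({e j}, True)) = (\<xi> ({e i}, True) < \<xi> ({e j}, True))" for i j
          by simp
        show "B \<subseteq> {..<r} \<Longrightarrow> B \<noteq> {} \<Longrightarrow> merge ?I ?J (\<xi>, v) (e ` B, False) = v (e ` B, False)" for B
          using image_seed_sets[OF e, of B] by (simp add: merge_def)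
      qed
      have "merge ?I ?J (\<xi>, v) \<in> space KB" if "v \<in> space MJ" for v
        using \<xi>(2) that by (intro measurable_space[OF mm]) (simp add: space_pair_measure)
      then have "Pair \<xi> -` (merge ?I ?J -` E \<inter> space (MI \<Otimes>\<^sub>M MJ)) = {v \<in> space MJ. \<forall>e\<in>tuples r m.
        pattern_entry r D F y (\<lambda>j. \<xi> ({e j}, True)) (\<lambda>B. v (e ` B, False)) = a e}"
        using \<xi>(2) by (auto simp: E_def entry space_pair_measure)
      then show ?thesis
        using emeasure_permuted_entries[OF Fy a \<xi>(1)] by (simp only: MJ_def)
    qed
    have "AE \<xi> in MI. inj_on \<xi> ?I"
      unfolding MI_def seed_space_def by (rule AE_uniform_distinct) simp
    then show "AE \<xi> in MI. emeasure MJ (Pair \<xi> -` (merge ?I ?J -` E \<inter> space (MI \<Otimes>\<^sub>M MJ))) = ?p"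
      using AE_space
    proof eventually_elim
      case (elim \<xi>)
      then show ?case by (rule sec_law)
    qed
  qed
  also have "\<dots> = ?p" by (simp add: MI.emeasure_space_1)
  finally show ?thesis unfolding E_def KB_def .
qed

text \<open>\<open>W\<close> splits its arguments: first halves at singletons order the positions,
  second halves serve as seeds. Positions carrying the same vertex see the same singleton seed and
  hence get equal ranks, which takes care of tuples with repetitions.\<close>

theorem ex_limit_array:
  "\<exists>W \<in> measurable (W_domain r) (count_space {..<D}). \<forall>m. \<forall>a\<in>tuples r m \<rightarrow>\<^sub>E {..<D}.
    measure (U_space r) {U \<in> space (U_space r). \<forall>e\<in>tuples r m. random_array r W U e = a e} =
    prob (actual_event (tuples r m) a)"
proof -
  obtain F y where Fy: "seeded_coding F y"
    using ex_seeded_coding unfolding seeded_coding_def by (elim exE) blast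
  then have F: "\<And>k. k \<in> {1..r} \<Longrightarrow> F k \<in> borel_measurable (codes_space k \<Otimes>\<^sub>M unit_uniform)"
    by (simp add: seeded_coding_def)
  obtain s t where s[measurable]: "s \<in> measurable unit_uniform unit_uniform"
    and t[measurable]: "t \<in> measurable unit_uniform unit_uniform"
    and st: "distr unit_uniform (unit_uniform \<Otimes>\<^sub>M unit_uniform) (\<lambda>u. (s u, t u)) = unit_uniform \<Otimes>\<^sub>M unit_uniform"
    using ex_uniform_split by (elim exE conjE)
  define W where "W w = pattern_entry r D F y (\<lambda>j. s (w {j})) (\<lambda>B. t (w B))" for w
  have WD: "W w < D" for w
    unfolding W_def pattern_entry_def by (rule coded_entry_less[OF D_pos])
  have "W \<in> measurable (W_domain r) (count_space UNIV)"
    unfolding W_def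
  proof (rule measurable_pattern_entry[OF F])
    fix j assume "j < r"
    then have "(\<lambda>w. w {j}) \<in> measurable (W_domain r) unit_uniform"
      unfolding W_domain_def by (intro measurable_component_singleton) (simp add: nonempty_subsets_def)
    from measurable_compose[OF this measurable_compose[OF s measurable_ident_unit_uniform]]
    show "(\<lambda>w. s (w {j})) \<in> borel_measurable (W_domain r)" .
  next
    fix B assume "B \<subseteq> {..<r}" "B \<noteq> {}"
    then have "(\<lambda>w. w B) \<in> measurable (W_domain r) unit_uniform"
      unfolding W_domain_def by (intro measurable_component_singleton) (simp add: nonempty_subsets_def)
    from measurable_compose[OF this t] show "(\<lambda>w. t (w B)) \<in> measurable (W_domain r) unit_uniform" .
  qed
  then have Wm: "W \<in> measurable (W_domain r) (count_space {..<D})"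
    using measurable_restrict_space2[of W "W_domain r" "{..<D}" "count_space UNIV"] WD
    by (simp add: restrict_count_space)
  have "measure (U_space r) {U \<in> space (U_space r). \<forall>e\<in>tuples r m. random_array r W U e = a e} =
    prob (actual_event (tuples r m) a)" if a: "a \<in> tuples r m \<rightarrow>\<^sub>E {..<D}" for m a
  proof -
    let ?K = "seed_sets m" and ?UU = "{T :: nat set. finite T \<and> T \<noteq> {} \<and> card T \<le> r}"
    let ?UK = "\<Pi>\<^sub>M A\<in>?K. unit_uniform" and ?KB = "\<Pi>\<^sub>M p\<in>?K \<times> (UNIV :: bool set). unit_uniform"
    define E where "E = {z \<in> space ?KB. \<forall>e\<in>tuples r m.
      pattern_entry r D F y (\<lambda>j. z ({e j}, True)) (\<lambda>B. z (e ` B, False)) = a e}"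
    have E: "E \<in> sets ?KB"
      using sets_split_event[OF Fy, of m a] unfolding E_def seed_space_def .
    have "measure (U_space r) {U \<in> space (U_space r). \<forall>e\<in>tuples r m. random_array r W U e = a e} = measure ?KB E"
    proof -
      \<comment> \<open>A window involves only the seeds in \<open>seed_sets m\<close>; restricting
        to them and splitting each one gives the product law \<open>?KB\<close>.\<close>
      let ?g = "\<lambda>U. \<lambda>p\<in>?K \<times> UNIV. (if snd p then s else t) (U (fst p))"
      let ?res = "\<lambda>U. \<lambda>T\<in>?K. U T :: real"
      have resl: "distr (U_space r) ?UK ?res = ?UK"
        unfolding U_space_def
        by (rule distr_PiM_reindex) (auto simp: seed_sets_def prob_space_unit_uniform intro: finite_subset)
      have resm: "?res \<in> measurable (U_space r) ?UK"
        unfolding U_space_def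
        by (intro measurable_restrict measurable_component_singleton) (auto simp: seed_sets_def intro: finite_subset)
      have gl: "distr ?UK ?KB ?g = ?KB" by (rule PiM_uniform_split[OF finite_seed_sets s t st])
      have gm: "?g \<in> measurable ?UK ?KB"
      proof (rule measurable_restrict)
        fix p :: "nat set \<times> bool" assume "p \<in> ?K \<times> UNIV"
        then have "(\<lambda>U. U (fst p)) \<in> measurable ?UK unit_uniform" by (intro measurable_component_singleton) auto
        then show "(\<lambda>U. (if snd p then s else t) (U (fst p))) \<in> measurable ?UK unit_uniform"
          by (cases "snd p") (auto intro: measurable_compose)
      qed
      have hm: "(\<lambda>U. ?g (?res U)) \<in> measurable (U_space r) ?KB" by (rule measurable_compose[OF resm gm])
      have "measure ?KB E = measure (distr (distr (U_space r) ?UK ?res) ?KB ?g) E"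
        unfolding resl gl ..
      also have "\<dots> = measure (distr (U_space r) ?KB (\<lambda>U. ?g (?res U))) E"
        unfolding distr_distr[OF gm resm] by (simp only: comp_def)
      also have "\<dots> = measure (U_space r) ((\<lambda>U. ?g (?res U)) -` E \<inter> space (U_space r))"
        by (rule measure_distr[OF hm E])
      also have "(\<lambda>U. ?g (?res U)) -` E \<inter> space (U_space r) =
        {U \<in> space (U_space r). \<forall>e\<in>tuples r m. random_array r W U e = a e}"
      proof -
        have eq: "pattern_entry r D F y (\<lambda>j. ?g (?res U) ({e j}, True)) (\<lambda>B. ?g (?res U) (e ` B, False)) = random_array r W U e"
          if e: "e \<in> tuples r m" for U e
        proof -
          have "random_array r W U e = pattern_entry r D F y
            (\<lambda>j. s ((\<lambda>A\<in>nonempty_subsets r. U (e ` A)) {j})) (\<lambda>B. t ((\<lambda>A\<in>nonempty_subsets r. U (e ` A)) B))"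
            using tuples_eq[OF e] by (simp add: random_array_def W_def all_tuples_def)
          also have "\<dots> = pattern_entry r D F y (\<lambda>j. ?g (?res U) ({e j}, True)) (\<lambda>B. ?g (?res U) (e ` B, False))"
          proof (rule pattern_entry_eq)
            have "s ((\<lambda>A\<in>nonempty_subsets r. U (e ` A)) {j}) = ?g (?res U) ({e j}, True)" if "j < r" for j
              using that e singleton_seed_sets[of "e j" m] by (auto simp: nonempty_subsets_def tuples_def)
            then show "i < r \<Longrightarrow> j < r \<Longrightarrow>
              (s ((\<lambda>A\<in>nonempty_subsets r. U (e ` A)) {i}) < s ((\<lambda>A\<in>nonempty_subsets r. U (e ` A)) {j})) =
              (?g (?res U) ({e i}, True) < ?g (?res U) ({e j}, True))" for i j
              by simp
            show "B \<subseteq> {..<r} \<Longrightarrow> B \<noteq> {} \<Longrightarrow> t ((\<lambda>A\<in>nonempty_subsets r. U (e ` A)) B) = ?g (?res U) (e ` B, False)" for B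
              using image_seed_sets[OF e, of B] by (simp add: nonempty_subsets_def)
          qed
          finally show ?thesis by simp
        qed
        show ?thesis
        proof (intro equalityI subsetI)
          fix U assume U: "U \<in> (\<lambda>U. ?g (?res U)) -` E \<inter> space (U_space r)"
          then have gE: "?g (?res U) \<in> E" by (rule IntD1[THEN vimageD])
          have "random_array r W U e = a e" if e: "e \<in> tuples r m" for e
            using gE e eq[OF e, of U] unfolding E_def by simp
          then show "U \<in> {U \<in> space (U_space r). \<forall>e\<in>tuples r m. random_array r W U e = a e}" using U by blast
        next
          fix U assume U: "U \<in> {U \<in> space (U_space r). \<forall>e\<in>tuples r m. random_array r W U e = a e}"
          then have sp: "U \<in> space (U_space r)" by blast
          have "?g (?res U) \<in> E"
            unfolding E_def
          proof (intro CollectI conjI ballI)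
            show "?g (?res U) \<in> space ?KB" by (rule measurable_space[OF hm sp])
            fix e assume e: "e \<in> tuples r m"
            show "pattern_entry r D F y (\<lambda>j. ?g (?res U) ({e j}, True)) (\<lambda>B. ?g (?res U) (e ` B, False)) = a e"
              unfolding eq[OF e] using U e by blast
          qed
          then show "U \<in> (\<lambda>U. ?g (?res U)) -` E \<inter> space (U_space r)" using sp by blast
        qed
      qed
      finally show ?thesis by simp
    qed
    moreover have "emeasure ?KB E = ennreal (prob (actual_event (tuples r m) a))"
      using emeasure_split_event[OF Fy a] unfolding E_def seed_space_def .
    ultimately show ?thesis by (simp add: measure_def)
  qed
  then show ?thesis using Wm by blast
qed

end

section \<open>Convergence of densities\<close>

text \<open>A window reads only the labels of \<open>m\<close> vertices, and these form a uniformly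
  random map into \<open>{..<N}\<close>. This links the process to the counts in
  \<open>hom_density\<close>.\<close>

lemma vertex_sampling_prob:
  assumes N: "N \<ge> 1"
  shows "measure (vertex_sampling N :: (nat \<times> nat \<Rightarrow> nat) measure)
      {\<phi>. \<forall>e\<in>tuples r m. G (comp_tuple r \<phi> (comp_tuple r (Pair (0::nat)) e)) = (a e :: nat)} =
    real (card {\<phi> \<in> {..<m} \<rightarrow>\<^sub>E {..<N}. \<forall>e\<in>tuples r m. G (\<lambda>j\<in>{..<r}. \<phi> (e j)) = a e}) / real N ^ m"
proof -
  let ?p = "\<lambda>_. measure_pmf (pmf_of_set {..<N})"
  let ?M = "PiM {..<m} ?p"
  let ?S = "{\<phi> \<in> space ?M. \<forall>e\<in>tuples r m. G (comp_tuple r \<phi> e) = a e}"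
  let ?Q = "{\<phi> \<in> {..<m} \<rightarrow>\<^sub>E {..<N}. \<forall>e\<in>tuples r m. G (\<lambda>j\<in>{..<r}. \<phi> (e j)) = a e}"
  let ?f = "\<lambda>\<phi> :: nat \<times> nat \<Rightarrow> nat. \<lambda>i\<in>{..<m}. \<phi> (0, i)"
  interpret M: prob_space ?M by (intro prob_space_PiM measure_pmf.prob_space_axioms)
  interpret PM: product_prob_space ?p "{..<m}"
    by (rule product_prob_spaceI) (rule measure_pmf.prob_space_axioms)
  have finT: "finite (tuples r m)" unfolding tuples_def by (intro finite_PiE) auto
  have S: "?S \<in> sets ?M"
    by (rule sets_sample_event_gen[OF finT]) (auto simp: tuples_def)
  have single: "{\<phi>} = (\<Pi>\<^sub>E i\<in>{..<m}. {\<phi> i})" if "\<phi> \<in> {..<m} \<rightarrow>\<^sub>E {..<N}" for \<phi>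
  proof -
    have "\<phi> \<in> extensional {..<m}" using that by (simp add: PiE_def)
    from PiE_singleton[OF this] show ?thesis by simp
  qed
  have single_sets: "{\<phi>} \<in> sets ?M" if "\<phi> \<in> {..<m} \<rightarrow>\<^sub>E {..<N}" for \<phi>
    unfolding single[OF that] by (intro sets_PiM_I_finite) auto
  have finS0: "finite ?Q"
    by (rule finite_subset[of _ "{..<m} \<rightarrow>\<^sub>E {..<N}"]) (auto intro!: finite_PiE)
  have S0: "?Q \<in> sets ?M"
    by (rule sets.countable) (auto intro!: single_sets countable_finite[OF finS0])
  \<comment> \<open>The product space also contains maps with values outside \<open>{..<N}\<close>;
    they form a null set.\<close>
  have AE_S: "AE \<phi> in ?M. (\<phi> \<in> ?S) = (\<phi> \<in> ?Q)"
  proof -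
    have "AE \<phi> in ?M. \<phi> i \<in> {..<N}" if "i \<in> {..<m}" for i
    proof (rule AE_PiM_component)
      show "AE x in measure_pmf (pmf_of_set {..<N}). x \<in> {..<N}"
        using N by (subst AE_measure_pmf_iff) (auto simp: set_pmf_of_set lessThan_empty_iff)
    qed (use that measure_pmf.prob_space_axioms in auto)
    then have "AE \<phi> in ?M. \<forall>i\<in>{..<m}. \<phi> i \<in> {..<N}" by (intro AE_finite_allI) auto
    then show ?thesis
      using AE_space by eventually_elim (auto simp: space_PiM PiE_iff comp_tuple_def)
  qed
  have law: "distr (vertex_sampling N) ?M ?f = ?M"
    unfolding vertex_sampling_def
    by (rule distr_PiM_reindex) (auto simp: inj_on_def intro: measure_pmf.prob_space_axioms)
  have fm: "?f \<in> measurable (vertex_sampling N) ?M"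
    unfolding vertex_sampling_def by (intro measurable_restrict measurable_component_singleton) auto
  have "?f -` ?S \<inter> space (vertex_sampling N) =
    {\<phi>. \<forall>e\<in>tuples r m. G (comp_tuple r \<phi> (comp_tuple r (Pair (0::nat)) e)) = a e}"
  proof -
    have "comp_tuple r (?f \<phi>) e = comp_tuple r \<phi> (comp_tuple r (Pair (0::nat)) e)" if "e \<in> tuples r m" for e \<phi>
      unfolding comp_tuple_comp by (rule comp_tuple_cong) (use that in \<open>auto simp: tuples_def\<close>)
    then show ?thesis by (auto simp: space_PiM)
  qed
  then have "measure (vertex_sampling N) {\<phi>. \<forall>e\<in>tuples r m. G (comp_tuple r \<phi> (comp_tuple r (Pair (0::nat)) e)) = a e} = measure ?M ?S"
    using measure_distr[OF fm S, symmetric] by (simp only: law)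
  also have "\<dots> = measure ?M ?Q"
    by (rule M.finite_measure_eq_AE[OF AE_S S S0])
  also have "\<dots> = (\<Sum>\<phi>\<in>?Q. measure ?M {\<phi>})"
    by (rule M.finite_measure_eq_sum_singleton[OF finS0]) (auto intro!: single_sets)
  also have "\<dots> = (\<Sum>\<phi>\<in>?Q. 1 / real N ^ m)"
  proof (rule sum.cong[OF refl])
    fix \<phi> assume \<phi>: "\<phi> \<in> ?Q"
    then have "{\<phi>} = (\<Pi>\<^sub>E i\<in>{..<m}. {\<phi> i})" by (intro single) auto
    then have "measure ?M {\<phi>} = (\<Prod>i\<in>{..<m}. measure (measure_pmf (pmf_of_set {..<N})) {\<phi> i})"
      using PM.measure_PiM_emb[of "{..<m}" "\<lambda>i. {\<phi> i}"] by (simp add: prod_emb_id PiE_mono)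
    also have "\<dots> = (\<Prod>i\<in>{..<m}. 1 / real N)"
      using N \<phi> by (intro prod.cong refl) (auto simp: measure_pmf_single PiE_iff lessThan_empty_iff)
    finally show "measure ?M {\<phi>} = 1 / real N ^ m" by (simp add: power_divide)
  qed
  finally show ?thesis by simp
qed

lemma measurable_random_array:
  assumes "W \<in> measurable (W_domain r) K" "e \<in> tuples r m"
  shows "(\<lambda>U. random_array r W U e) \<in> measurable (U_space r) K"
proof -
  have "(\<lambda>U. \<lambda>A\<in>nonempty_subsets r. U (e ` A)) \<in> measurable (U_space r) (W_domain r)"
    unfolding U_space_def W_domain_def
  proof (intro measurable_restrict measurable_component_singleton)
    fix A assume "A \<in> nonempty_subsets r"
    then have A: "A \<subseteq> {..<r}" "A \<noteq> {}" by (auto simp: nonempty_subsets_def)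
    then have "finite A" "card A \<le> r" using finite_subset[of A "{..<r}"] card_mono[of "{..<r}" A] by auto
    then show "e ` A \<in> {T. finite T \<and> T \<noteq> {} \<and> card T \<le> r}"
      using A card_image_le[of A e] by auto
  qed
  from measurable_compose[OF this assms(1)] show ?thesis
    using tuples_def assms(2) by (simp add: random_array_def PiE_iff)
qed

text \<open>The permutation \<open>\<sigma>\<close> is present because \<open>limit_density\<close>
  averages over the injections of \<open>{..<m}\<close> into itself. By exchangeability the limit is
  the same for each of them.\<close>

theorem array_sampling_limit:
  fixes N :: "nat \<Rightarrow> nat" and G :: "nat \<Rightarrow> (nat \<Rightarrow> nat) \<Rightarrow> nat"
  assumes r: "r \<ge> 1" and GD: "\<And>n e. G n e < D" and N: "\<And>n. N n \<ge> 1"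
  shows "\<exists>s W. strict_mono s \<and> W \<in> measurable (W_domain r) (count_space {..<D}) \<and>
    (\<forall>m \<sigma>. \<forall>a\<in>tuples r m \<rightarrow>\<^sub>E {..<D}. bij_betw \<sigma> {..<m} {..<m} \<longrightarrow>
      (\<lambda>k. real (card {\<phi> \<in> {..<m} \<rightarrow>\<^sub>E {..<N (s k)}. \<forall>e\<in>tuples r m. G (s k) (\<lambda>j\<in>{..<r}. \<phi> (e j)) = a e}) / real (N (s k)) ^ m)
      \<longlonglongrightarrow> measure (U_space r) {U \<in> space (U_space r). \<forall>e\<in>tuples r m. random_array r W U (comp_tuple r \<sigma> e) = a e})"
proof -
  obtain s and P :: "((nat \<Rightarrow> nat \<times> nat) \<Rightarrow> nat) measure" where s: "strict_mono s"
    and P: "exchangeable_process P r D"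
    and lim: "\<forall>J a. finite J \<longrightarrow> J \<subseteq> all_tuples r \<longrightarrow> a \<in> J \<rightarrow>\<^sub>E {..<D} \<longrightarrow>
      (\<lambda>k. measure (vertex_sampling (N (s k))) (sample_event r (G (s k)) J a))
        \<longlonglongrightarrow> measure P (cylinder (all_tuples r) D J a)"
    using sampling_limit_process[where G=G and N=N and D=D, OF r GD] by (elim exE conjE)
  interpret vertex_process P r D using P by (rule vertex_process.intro)
  obtain W where W: "W \<in> measurable (W_domain r) (count_space {..<D})"
    and WP: "\<forall>m. \<forall>a\<in>tuples r m \<rightarrow>\<^sub>E {..<D}. measure (U_space r) {U \<in> space (U_space r). \<forall>e\<in>tuples r m. random_array r W U e = a e} =
      prob (actual_event (tuples r m) a)"
    using ex_limit_array by (elim bexE)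
  have "(\<lambda>k. real (card {\<phi> \<in> {..<m} \<rightarrow>\<^sub>E {..<N (s k)}. \<forall>e\<in>tuples r m. G (s k) (\<lambda>j\<in>{..<r}. \<phi> (e j)) = a e}) / real (N (s k)) ^ m)
      \<longlonglongrightarrow> measure (U_space r) {U \<in> space (U_space r). \<forall>e\<in>tuples r m. random_array r W U (comp_tuple r \<sigma> e) = a e}"
    if a: "a \<in> tuples r m \<rightarrow>\<^sub>E {..<D}" and \<sigma>: "bij_betw \<sigma> {..<m} {..<m}" for m \<sigma> a
  proof -
    have T: "tuples r m \<subseteq> all_tuples r" "a \<in> tuples r m \<rightarrow> {..<D}" using tuples_eq a by auto
    obtain b where b: "b \<in> comp_tuple r (Pair 0) ` tuples r m \<rightarrow>\<^sub>E {..<D}"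
      "actual_event (tuples r m) a = cylinder (all_tuples r) D (comp_tuple r (Pair 0) ` tuples r m) b"
      "\<And>e. e \<in> tuples r m \<Longrightarrow> b (comp_tuple r (Pair 0) e) = a e"
      using actual_event_eq_cylinder[OF T] by metis
    have "(\<lambda>k. measure (vertex_sampling (N (s k))) (sample_event r (G (s k)) (comp_tuple r (Pair 0) ` tuples r m) b))
      \<longlonglongrightarrow> prob (actual_event (tuples r m) a)"
      unfolding b(2) by (rule lim[rule_format, OF _ _ b(1)]) auto
    moreover have "sample_event r (G n) (comp_tuple r (Pair 0) ` tuples r m) b =
      {\<phi>. \<forall>e\<in>tuples r m. G n (comp_tuple r \<phi> (comp_tuple r (Pair 0) e)) = a e}" for n
      by (simp add: sample_event_def b(3))
    ultimately have "(\<lambda>k. real (card {\<phi> \<in> {..<m} \<rightarrow>\<^sub>E {..<N (s k)}. \<forall>e\<in>tuples r m. G (s k) (\<lambda>j\<in>{..<r}. \<phi> (e j)) = a e}) / real (N (s k)) ^ m)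
      \<longlonglongrightarrow> prob (actual_event (tuples r m) a)"
      by (simp only: vertex_sampling_prob[OF N])
    moreover have "measure (U_space r) {U \<in> space (U_space r). \<forall>e\<in>tuples r m. random_array r W U (comp_tuple r \<sigma> e) = a e} = prob (actual_event (tuples r m) a)"
    proof -
      let ?\<tau> = "the_inv_into {..<m} \<sigma>"
      define c where "c = (\<lambda>e\<in>tuples r m. a (comp_tuple r ?\<tau> e))"
      note back1 = comp_tuple_inverse[of m ?\<tau> \<sigma>, OF permutation_inverse(3)[OF \<sigma>]]
        and back2 = comp_tuple_inverse[of m \<sigma> ?\<tau>, OF permutation_inverse(4)[OF \<sigma>]]
      have in\<sigma>: "comp_tuple r \<sigma> e \<in> tuples r m" if "e \<in> tuples r m" for e using permutation_inverse(1)[OF \<sigma>] that by (rule comp_tuple_tuples)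
      have in\<tau>: "comp_tuple r ?\<tau> e \<in> tuples r m" if "e \<in> tuples r m" for e using permutation_inverse(2)[OF \<sigma>] that by (rule comp_tuple_tuples)
      have c: "c \<in> tuples r m \<rightarrow>\<^sub>E {..<D}" using a in\<tau> by (auto simp: c_def)
      have ca: "c (comp_tuple r \<sigma> e) = a e" if "e \<in> tuples r m" for e
        using that by (simp add: c_def in\<sigma> back1)
      have "(\<forall>e\<in>tuples r m. random_array r W U (comp_tuple r \<sigma> e) = a e) \<longleftrightarrow> (\<forall>e\<in>tuples r m. random_array r W U e = c e)" for U
      proof (intro iffI ballI)
        fix e assume *: "\<forall>e\<in>tuples r m. random_array r W U (comp_tuple r \<sigma> e) = a e" and e: "e \<in> tuples r m"
        from bspec[OF * in\<tau>[OF e]] show "random_array r W U e = c e" using e by (simp add: back2 c_def)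
      next
        fix e assume *: "\<forall>e\<in>tuples r m. random_array r W U e = c e" and e: "e \<in> tuples r m"
        from bspec[OF * in\<sigma>[OF e]] show "random_array r W U (comp_tuple r \<sigma> e) = a e" using ca[OF e] by simp
      qed
      then have "measure (U_space r) {U \<in> space (U_space r). \<forall>e\<in>tuples r m. random_array r W U (comp_tuple r \<sigma> e) = a e} =
        prob (actual_event (tuples r m) c)"
        using WP c by simp
      also have "\<dots> = prob (actual_event (tuples r m) a)"
        by (rule prob_actual_event_permute[of \<sigma> m c a, OF \<sigma> ca])
      finally show ?thesis .
    qed
    ultimately show ?thesis by simp
  qed
  then show ?thesis using s W by (intro exI[of _ s] exI[of _ W]) simp
qed

text \<open>Exactly one window value \<open>a\<close> matches the array. Averaged over maps or
  seeds, the indicators become window probabilities, while the coefficients do not depend on the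
  array.\<close>

lemma map_weight_expand:
  fixes g :: "(nat \<Rightarrow> nat) \<Rightarrow> nat" and D :: nat
  assumes A: "\<And>e. e \<in> tuples r m \<Longrightarrow> X e = dec (g e)" and g: "\<And>e. e \<in> tuples r m \<Longrightarrow> g e < D"
  shows "(\<Prod>e\<in>tuples r m. h e (X e)) =
    (\<Sum>a\<in>tuples r m \<rightarrow>\<^sub>E {..<D}. of_bool (\<forall>e\<in>tuples r m. g e = a e) * (\<Prod>e\<in>tuples r m. h e (dec (a e)) :: real))"
proof -
  let ?T = "tuples r m"
  have finT: "finite ?T" unfolding tuples_def by (intro finite_PiE) auto
  have finA: "finite (?T \<rightarrow>\<^sub>E {..<D})" using finT by (intro finite_PiE) auto
  define b where "b = (\<lambda>e\<in>?T. g e)"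
  have b: "b \<in> ?T \<rightarrow>\<^sub>E {..<D}" using g by (auto simp: b_def)
  have "(\<Sum>a\<in>?T \<rightarrow>\<^sub>E {..<D}. of_bool (\<forall>e\<in>?T. g e = a e) * (\<Prod>e\<in>?T. h e (dec (a e)))) =
    (\<Sum>a\<in>?T \<rightarrow>\<^sub>E {..<D}. if a = b then (\<Prod>e\<in>?T. h e (dec (b e))) else 0)"
  proof (rule sum.cong[OF refl])
    fix a assume a: "a \<in> ?T \<rightarrow>\<^sub>E {..<D}"
    have "(\<forall>e\<in>?T. g e = a e) \<longleftrightarrow> a = b"
    proof
      assume "\<forall>e\<in>?T. g e = a e"
      then show "a = b" using a b by (intro extensionalityI[of a ?T b]) (auto simp: b_def PiE_def)
    qed (simp add: b_def)
    then show "of_bool (\<forall>e\<in>?T. g e = a e) * (\<Prod>e\<in>?T. h e (dec (a e))) = (if a = b then (\<Prod>e\<in>?T. h e (dec (b e))) else 0)"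
      by simp
  qed
  also have "\<dots> = (\<Prod>e\<in>?T. h e (dec (b e)))"
    using b finA by simp
  also have "\<dots> = (\<Prod>e\<in>?T. h e (X e))"
    using A by (intro prod.cong) (auto simp: b_def)
  finally show ?thesis by simp
qed

theorem theorem7:
  fixes r q d :: nat and F :: "nat \<Rightarrow> csp"
  assumes "r \<ge> 1" and "q \<ge> 1" and "d \<ge> 1"
    and "\<And>n. csp_formula r q (F n)"
    and "\<And>n. eval_bounded r q d (F n)"
    and "filterlim (\<lambda>n. nvars (F n)) at_top sequentially"
    and "\<And>H. csp_formula r q H \<Longrightarrow> eval_bounded r q d H \<Longrightarrow>
           convergent (\<lambda>n. csp_density r q H (F n))"
  shows "\<exists>W. W \<in> measurable (W_domain r) (count_space (decorations r q d)) \<and>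
    (\<forall>H. csp_formula r q H \<longrightarrow> eval_bounded r q d H \<longrightarrow>
      (\<lambda>n. csp_density r q H (F n))
        \<longlonglongrightarrow> limit_density r (nvars H) (tilde r q (csp_eval r q H)) W)"
proof -
  define L where "L = decorations r q d"
  have finL: "finite L" unfolding L_def decorations_def tuples_def by (intro finite_PiE) auto
  have "(\<lambda>z\<in>tuples r q. 0) \<in> L" by (auto simp: L_def decorations_def)
  then have neL: "L \<noteq> {}" by auto
  define D where "D = card L"
  have D: "D \<ge> 1" unfolding D_def using finL neL by (simp add: Suc_le_eq card_gt_0_iff)
  obtain enc where enc: "bij_betw enc L {..<D}"
    using ex_bij_betw_finite_nat[OF finL] unfolding D_def by (auto simp: lessThan_atLeast0)
  define dec where "dec = the_inv_into L enc"
  have decL: "dec i \<in> L" if "i < D" for i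
    using bij_betw_the_inv_into[OF enc] that by (auto simp: dec_def bij_betw_def)
  have dec_enc: "dec (enc A) = A" if "A \<in> L" for A
    using enc that by (auto simp: dec_def bij_betw_def intro: the_inv_into_f_f)
  have encD: "enc A < D" if "A \<in> L" for A using enc that by (auto simp: bij_betw_def)
  \<comment> \<open>Initial formulas without variables are skipped, so that a uniformly chosen
    vertex makes sense.\<close>
  obtain k0 where k0: "\<And>n. n \<ge> k0 \<Longrightarrow> nvars (F n) \<ge> 1"
    using assms(6) unfolding filterlim_at_top eventually_sequentially by blast
  define N where "N n = nvars (F (n + k0))" for n
  \<comment> \<open>The value 0 off the tuples keeps \<open>G n e < D\<close> for every
    \<open>e\<close>; the densities never look there.\<close>
  define G where "G n e = (if e \<in> tuples r (N n) then enc (csp_eval r q (F (n + k0)) e) else 0)" for n e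
  have evL: "csp_eval r q (F n) e \<in> L" if "e \<in> tuples r (nvars (F n))" for n e
    using csp_eval_in_decorations[OF assms(5)[of n]] that by (auto simp: L_def)
  have GD: "G n e < D" for n e using D evL encD by (auto simp: G_def N_def)
  have N1: "N n \<ge> 1" for n using k0 by (simp add: N_def)
  obtain s W where s: "strict_mono s" and W: "W \<in> measurable (W_domain r) (count_space {..<D})"
    and lim: "\<forall>m \<sigma>. \<forall>a\<in>tuples r m \<rightarrow>\<^sub>E {..<D}. bij_betw \<sigma> {..<m} {..<m} \<longrightarrow>
      (\<lambda>k. real (card {\<phi> \<in> {..<m} \<rightarrow>\<^sub>E {..<N (s k)}. \<forall>e\<in>tuples r m. G (s k) (\<lambda>j\<in>{..<r}. \<phi> (e j)) = a e}) / real (N (s k)) ^ m)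
      \<longlonglongrightarrow> measure (U_space r) {U \<in> space (U_space r). \<forall>e\<in>tuples r m. random_array r W U (comp_tuple r \<sigma> e) = a e}"
    using array_sampling_limit[where G=G and N=N and D=D, OF assms(1) GD N1] by (elim exE conjE)
  define W' where "W' w = dec (W w)" for w
  have W': "W' \<in> measurable (W_domain r) (count_space L)"
    unfolding W'_def by (rule measurable_compose[OF W]) (use decL in auto)
  interpret U: prob_space "U_space r" unfolding U_space_def by (intro prob_space_PiM prob_space_unit_uniform)
  have "(\<lambda>n. csp_density r q H (F n)) \<longlonglongrightarrow> limit_density r (nvars H) (tilde r q (csp_eval r q H)) W'"
    if H: "csp_formula r q H" "eval_bounded r q d H" for H
  proof -
    define m where "m = nvars H"
    define h where "h = tilde r q (csp_eval r q H)"
    let ?T = "tuples r m" and ?A = "tuples r m \<rightarrow>\<^sub>E {..<D}"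
    \<comment> \<open>The weight of the window value \<open>a\<close>; it depends on
      \<open>H\<close> but on no array, so it is shared by all formulas and by the limit.\<close>
    define c where "c a = (\<Prod>e\<in>?T. h e (dec (a e)))" for a :: "(nat \<Rightarrow> nat) \<Rightarrow> nat"
    define pk where "pk k a = real (card {\<phi> \<in> {..<m} \<rightarrow>\<^sub>E {..<N k}. \<forall>e\<in>?T. G k (\<lambda>j\<in>{..<r}. \<phi> (e j)) = a e}) / real (N k) ^ m" for k a
    define pU where "pU \<sigma> a = measure (U_space r) {U \<in> space (U_space r). \<forall>e\<in>?T. random_array r W U (comp_tuple r \<sigma> e) = a e}" for \<sigma> a
    have finT: "finite ?T" unfolding tuples_def by (intro finite_PiE) auto
    have finA: "finite ?A" using finT by (intro finite_PiE) auto
    have limp: "(\<lambda>k. pk (s k) a) \<longlonglongrightarrow> pU \<sigma> a" if "a \<in> ?A" "bij_betw \<sigma> {..<m} {..<m}" for \<sigma> a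
      using lim that unfolding pk_def pU_def by blast
    define p where "p a = pU (\<lambda>i. i) a" for a
    \<comment> \<open>Different permutations give limits of one and the same sequence, since
      \<open>pk\<close> does not mention \<open>\<sigma>\<close>.\<close>
    have pUp: "pU \<sigma> a = p a" if "a \<in> ?A" "bij_betw \<sigma> {..<m} {..<m}" for \<sigma> a
      unfolding p_def using LIMSEQ_unique[OF limp[OF that] limp[OF that(1) bij_betw_id[unfolded id_def]]] .
    have dens: "csp_density r q H (F (k + k0)) = (\<Sum>a\<in>?A. pk k a * c a)" for k
    proof -
      let ?\<Phi> = "{..<m} \<rightarrow>\<^sub>E {..<N k}"
      have fin\<Phi>: "finite ?\<Phi>" by (intro finite_PiE) auto
      have "map_weight r m h (csp_eval r q (F (k + k0))) \<phi> =
        (\<Sum>a\<in>?A. of_bool (\<forall>e\<in>?T. G k (\<lambda>j\<in>{..<r}. \<phi> (e j)) = a e) * c a)" if \<phi>: "\<phi> \<in> ?\<Phi>" for \<phi>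
        unfolding map_weight_def c_def
      proof (rule map_weight_expand[where X="\<lambda>e. csp_eval r q (F (k + k0)) (\<lambda>j\<in>{..<r}. \<phi> (e j))"
            and g="\<lambda>e. G k (\<lambda>j\<in>{..<r}. \<phi> (e j))" and h=h and dec=dec and D=D])
        fix e assume "e \<in> ?T"
        then have t: "(\<lambda>j\<in>{..<r}. \<phi> (e j)) \<in> tuples r (N k)" using \<phi> by (auto simp: tuples_def)
        then show "csp_eval r q (F (k + k0)) (\<lambda>j\<in>{..<r}. \<phi> (e j)) = dec (G k (\<lambda>j\<in>{..<r}. \<phi> (e j)))"
          using dec_enc evL by (simp add: G_def N_def)
      qed (rule GD)
      then have "(\<Sum>\<phi>\<in>?\<Phi>. map_weight r m h (csp_eval r q (F (k + k0))) \<phi>) =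
        (\<Sum>\<phi>\<in>?\<Phi>. \<Sum>a\<in>?A. of_bool (\<forall>e\<in>?T. G k (\<lambda>j\<in>{..<r}. \<phi> (e j)) = a e) * c a)"
        by (rule sum.cong[OF refl])
      also have "\<dots> = (\<Sum>a\<in>?A. (\<Sum>\<phi>\<in>?\<Phi>. of_bool (\<forall>e\<in>?T. G k (\<lambda>j\<in>{..<r}. \<phi> (e j)) = a e)) * c a)"
        by (subst sum.swap) (simp only: sum_distrib_right)
      also have "\<dots> = (\<Sum>a\<in>?A. real (card {\<phi> \<in> ?\<Phi>. \<forall>e\<in>?T. G k (\<lambda>j\<in>{..<r}. \<phi> (e j)) = a e}) * c a)"
      proof (intro sum.cong refl arg_cong2[where f="(*)"])
        fix a
        show "(\<Sum>\<phi>\<in>?\<Phi>. of_bool (\<forall>e\<in>?T. G k (\<lambda>j\<in>{..<r}. \<phi> (e j)) = a e)) =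
          real (card {\<phi> \<in> ?\<Phi>. \<forall>e\<in>?T. G k (\<lambda>j\<in>{..<r}. \<phi> (e j)) = a e})"
          using fin\<Phi> by (simp add: of_bool_def sum.If_cases Int_def)
      qed
      finally show ?thesis
        unfolding csp_density_def hom_density_def m_def[symmetric] h_def[symmetric] N_def[symmetric] pk_def
        by (simp add: sum_divide_distrib)
    qed
    have "limit_density r m h W' = (\<Sum>a\<in>?A. p a * c a)"
    proof -
      let ?In = "injections m m"
      have finI: "finite ?In" unfolding injections_def
        by (rule finite_subset[of _ "{..<m} \<rightarrow>\<^sub>E {..<m}"]) (auto intro!: finite_PiE)
      have "(\<lambda>i\<in>{..<m}. i) \<in> ?In" by (auto simp: injections_def inj_on_def)
      then have cardI: "card ?In \<noteq> 0" using finI by auto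
      \<comment> \<open>Injections of a finite set into itself are permutations, so
        \<open>pUp\<close> covers every term of the average.\<close>
      have bij: "bij_betw \<phi> {..<m} {..<m}" if "\<phi> \<in> ?In" for \<phi>
      proof -
        have "\<phi> ` {..<m} \<subseteq> {..<m}" "inj_on \<phi> {..<m}" using that by (auto simp: injections_def)
        then show ?thesis using endo_inj_surj[of "{..<m}" \<phi>] by (simp add: bij_betw_def)
      qed
      define ev where "ev \<phi> a = {U \<in> space (U_space r). \<forall>e\<in>?T. random_array r W U (comp_tuple r \<phi> e) = a e}" for \<phi> a
      have ct: "comp_tuple r \<phi> e \<in> ?T" if "\<phi> \<in> ?In" "e \<in> ?T" for \<phi> e
        using bij[OF that(1)] that(2) by (intro comp_tuple_tuples[of m]) (auto simp: bij_betw_def)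
      have evm: "ev \<phi> a \<in> sets (U_space r)" if "\<phi> \<in> ?In" for \<phi> a
        unfolding ev_def
      proof (rule sets.sets_Collect_finite_All[OF _ finT])
        fix e assume e: "e \<in> ?T"
        have "(\<lambda>U. random_array r W U (comp_tuple r \<phi> e)) \<in> measurable (U_space r) (count_space {..<D})"
          by (rule measurable_random_array[OF W ct[OF that e]])
        then have [measurable]: "(\<lambda>U. random_array r W U (comp_tuple r \<phi> e)) \<in> measurable (U_space r) (count_space UNIV)"
          by (rule measurable_compose) simp
        show "{U \<in> space (U_space r). random_array r W U (comp_tuple r \<phi> e) = a e} \<in> sets (U_space r)" by measurable
      qed
      have expand: "map_weight r m h (restrict (random_array r W' U) ?T) \<phi> = (\<Sum>a\<in>?A. indicator (ev \<phi> a) U * c a)"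
        if U: "U \<in> space (U_space r)" and \<phi>: "\<phi> \<in> ?In" for U \<phi>
      proof -
        have "map_weight r m h (restrict (random_array r W' U) ?T) \<phi> =
          (\<Sum>a\<in>?A. of_bool (\<forall>e\<in>?T. random_array r W U (comp_tuple r \<phi> e) = a e) * c a)"
          unfolding map_weight_def c_def
        proof (rule map_weight_expand[where X="\<lambda>e. restrict (random_array r W' U) ?T (\<lambda>j\<in>{..<r}. \<phi> (e j))"
              and g="\<lambda>e. random_array r W U (comp_tuple r \<phi> e)" and h=h and dec=dec and D=D])
          fix e assume e: "e \<in> ?T"
          have eq: "(\<lambda>j\<in>{..<r}. \<phi> (e j)) = comp_tuple r \<phi> e" by (simp add: comp_tuple_def)
          show "restrict (random_array r W' U) ?T (\<lambda>j\<in>{..<r}. \<phi> (e j)) = dec (random_array r W U (comp_tuple r \<phi> e))"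
            unfolding eq using ct[OF \<phi> e] comp_tuple_in[of r \<phi> e]
            by (simp add: random_array_def W'_def all_tuples_def del: comp_tuple_in)
          show "random_array r W U (comp_tuple r \<phi> e) < D"
            using measurable_space[OF measurable_random_array[OF W ct[OF \<phi> e]] U] by simp
        qed
        then show ?thesis using U by (simp add: ev_def indicator_def of_bool_def)
      qed
      have "limit_density r m h W' = (\<integral>U. (\<Sum>\<phi>\<in>?In. \<Sum>a\<in>?A. indicator (ev \<phi> a) U * c a) / real (card ?In) \<partial>U_space r)"
        unfolding limit_density_def inj_density_def
        by (intro Bochner_Integration.integral_cong refl arg_cong2[where f="(/)"] sum.cong expand)
      also have "\<dots> = (\<Sum>\<phi>\<in>?In. \<Sum>a\<in>?A. measure (U_space r) (ev \<phi> a) * c a) / real (card ?In)"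
        using evm by (simp add: Bochner_Integration.integral_sum integrable_indicator_iff U.emeasure_eq_measure)
      also have "\<dots> = (\<Sum>\<phi>\<in>?In. \<Sum>a\<in>?A. p a * c a) / real (card ?In)"
        using pUp bij by (simp add: pU_def ev_def)
      also have "\<dots> = (\<Sum>a\<in>?A. p a * c a)" using cardI by simp
      finally show ?thesis .
    qed
    moreover have "(\<lambda>k. csp_density r q H (F (s k + k0))) \<longlonglongrightarrow> (\<Sum>a\<in>?A. p a * c a)"
      unfolding dens p_def using limp[OF _ bij_betw_id[unfolded id_def]]
      by (intro tendsto_sum tendsto_mult tendsto_const) auto
    \<comment> \<open>The indices \<open>s k + k0\<close> form a subsequence, so the limit of the
      full sequence, which exists by assumption, is the value just computed.\<close>
    moreover have "(\<lambda>n. csp_density r q H (F n)) \<longlonglongrightarrow> lim (\<lambda>n. csp_density r q H (F n))"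
      using assms(7)[OF H] by (simp add: convergent_LIMSEQ_iff)
    then have "(\<lambda>k. csp_density r q H (F (s k + k0))) \<longlonglongrightarrow> lim (\<lambda>n. csp_density r q H (F n))"
      using LIMSEQ_subseq_LIMSEQ[of "\<lambda>n. csp_density r q H (F n)" _ "\<lambda>k. s k + k0"] s
      by (simp add: comp_def strict_mono_def)
    ultimately show ?thesis
      using LIMSEQ_unique \<open>(\<lambda>n. csp_density r q H (F n)) \<longlonglongrightarrow> lim (\<lambda>n. csp_density r q H (F n))\<close>
      unfolding m_def h_def by metis
  qed
  then show ?thesis using W' unfolding L_def by blast
qed

end
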